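(* The following are equivalent: (1) There exists a (not necessarily continuous) linear map $E':c_{00}(\Sigma)\to C(X)'_*$ which is the identity on $C(X)'_{00}$ and is a morphism of left $C(X)$-modules. (2) There exists a (not necessarily continuous) linear map $E':c_{00}(\Sigma)\to C(X)'_*$ which is the identity on $C(X)'_{00}$ and is a morphism of right $C(X)$-modules. (3) The sets $\mathrm{Fix}_k(\sigma)^\circ$ are closed in $X$ for all $k\in\mathbb{Z}$. (4) There exists a faithful positive norm one projection $E':C^*(\Sigma)\to C(X)'_*$ onto $C(X)'_*$ which is a morphism of $C(X)'_*$-bimodules and which restricts to a projection from $c_{00}(\Sigma)$ onto $C(X)'_{00}$.
   Context: Let $X$ be a non-empty compact Hausdorff space and $\sigma:X\to X$ a homeomorphism; $\mathrm{Fix}_k(\sigma)=\{x:\sigma^kx=x\}$ and superscript $\circ$ denotes interior. $C(X)$ is the algebra of continuous complex functions with sup norm, $\alpha(f)=f\circ\sigma^{-1}$. $\ell^1(\Sigma)$ is the set of $\ell:\mathbb{Z}\to C(X)$ with $\|\ell\|=\sum_k\|\ell(k)\|_\infty<\infty$, product $(\ell\ell')(n)=\sum_k\ell(k)\alpha^k(\ell'(n-k))$, involution $\ell^*(n)=\overline{\alpha^n(\ell(-n))}$; with $\delta$ the element equal to the constant $1$ at $1\in\mathbb{Z}$ and $0$ elsewhere, elements are written $\sum_kf_k\delta^k$ ($f_k=\ell(k)$), $C(X)$ is embedded as $\{f\delta^0\}$, and $\delta f\delta^{-1}=f\circ\sigma^{-1}$. $c_{00}(\Sigma)$ is the $*$-subalgebra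 of finite sums. $C^*(\Sigma)$ is the enveloping $C^*$-algebra of $\ell^1(\Sigma)$, containing $\ell^1(\Sigma)$ densely. $C(X)'_*$ and $C(X)'_{00}$ are the commutants of $C(X)$ in $C^*(\Sigma)$ and in $c_{00}(\Sigma)$. A projection onto a subalgebra is a linear idempotent map with that range; a positive map is faithful if it vanishes on no non-zero positive element. *)

theory Defs
  imports "HOL-Analysis.Analysis"
begin

definition spow :: "('a \<Rightarrow> 'a) \<Rightarrow> int \<Rightarrow> 'a \<Rightarrow> 'a" where
  "spow \<sigma> k = (if 0 \<le> k then \<sigma> ^^ nat k else (inv \<sigma>) ^^ nat (- k))"

definition Fix :: "('a \<Rightarrow> 'a) \<Rightarrow> int \<Rightarrow> 'a set" where
  "Fix \<sigma> k = {x. spow \<sigma> k x = x}"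

definition CX :: "('a::topological_space \<Rightarrow> complex) set" where
  "CX = {f. continuous_on UNIV f}"

definition supn :: "('a \<Rightarrow> complex) \<Rightarrow> real" where
  "supn f = (SUP x. cmod (f x))"

text \<open>Elements of l1(Sigma) are maps int => C(X); an element is written as the
  function k, x |-> f_k(x).\<close>
type_synonym 'a l1elt = "int \<Rightarrow> 'a \<Rightarrow> complex"

definition l1 :: "'a::topological_space l1elt set" where
  "l1 = {a. (\<forall>k. a k \<in> CX) \<and> (\<lambda>k. supn (a k)) summable_on UNIV}"

definition l1_norm :: "'a l1elt \<Rightarrow> real" where
  "l1_norm a = (\<Sum>\<^sub>\<infinity>k. supn (a k))"

definition c00 :: "'a::topological_space l1elt set" where
  "c00 = {a \<in> l1. finite {k. a k \<noteq> (\<lambda>x. 0)}}"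

definition l1_add :: "'a l1elt \<Rightarrow> 'a l1elt \<Rightarrow> 'a l1elt" where
  "l1_add a b = (\<lambda>k x. a k x + b k x)"

definition l1_sub :: "'a l1elt \<Rightarrow> 'a l1elt \<Rightarrow> 'a l1elt" where
  "l1_sub a b = (\<lambda>k x. a k x - b k x)"

definition l1_smult :: "complex \<Rightarrow> 'a l1elt \<Rightarrow> 'a l1elt" where
  "l1_smult c a = (\<lambda>k x. c * a k x)"

definition alpha_pow :: "('a \<Rightarrow> 'a) \<Rightarrow> int \<Rightarrow> ('a \<Rightarrow> complex) \<Rightarrow> 'a \<Rightarrow> complex" where
  "alpha_pow \<sigma> k f = f \<circ> spow \<sigma> (- k)"

definition l1_mult :: "('a \<Rightarrow> 'a) \<Rightarrow> 'a l1elt \<Rightarrow> 'a l1elt \<Rightarrow> 'a l1elt" where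
  "l1_mult \<sigma> a b = (\<lambda>n x. \<Sum>\<^sub>\<infinity>k. a k x * alpha_pow \<sigma> k (b (n - k)) x)"

definition l1_star :: "('a \<Rightarrow> 'a) \<Rightarrow> 'a l1elt \<Rightarrow> 'a l1elt" where
  "l1_star \<sigma> a = (\<lambda>n x. cnj (alpha_pow \<sigma> n (a (- n)) x))"

definition cx :: "('a \<Rightarrow> complex) \<Rightarrow> 'a l1elt" where
  "cx f = (\<lambda>k. if k = 0 then f else (\<lambda>x. 0))"

text \<open>C*-seminorms on l1(Sigma) bounded by the l1 norm (exactly the seminorms
  a |-> ||pi(a)|| coming from *-representations on Hilbert spaces).\<close>
definition cstar_seminorm :: "('a::topological_space \<Rightarrow> 'a) \<Rightarrow> ('a l1elt \<Rightarrow> real) \<Rightarrow> bool" where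
  "cstar_seminorm \<sigma> p \<longleftrightarrow>
     (\<forall>a\<in>l1. \<forall>b\<in>l1. \<forall>c. 0 \<le> p a \<and> p (l1_add a b) \<le> p a + p b
        \<and> p (l1_smult c a) = cmod c * p a
        \<and> p (l1_mult \<sigma> a b) \<le> p a * p b
        \<and> p (l1_mult \<sigma> (l1_star \<sigma> a) a) = (p a)\<^sup>2
        \<and> p a \<le> l1_norm a)"

definition unorm :: "('a::topological_space \<Rightarrow> 'a) \<Rightarrow> 'a l1elt \<Rightarrow> real" where
  "unorm \<sigma> a = (SUP p\<in>{p. cstar_seminorm \<sigma> p}. p a)"

text \<open>C*(Sigma) is the completion of l1(Sigma) modulo the kernel of unorm:
  equivalence classes of unorm-Cauchy sequences in l1(Sigma).\<close>
definition cs_cauchy :: "('a::topological_space \<Rightarrow> 'a) \<Rightarrow> (nat \<Rightarrow> 'a l1elt) \<Rightarrow> bool" where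
  "cs_cauchy \<sigma> s \<longleftrightarrow> (\<forall>n. s n \<in> l1) \<and>
     (\<forall>e>0. \<exists>N. \<forall>m\<ge>N. \<forall>n\<ge>N. unorm \<sigma> (l1_sub (s m) (s n)) < e)"

type_synonym 'a cselt = "(nat \<Rightarrow> 'a l1elt) set"

definition cs_cls :: "('a::topological_space \<Rightarrow> 'a) \<Rightarrow> (nat \<Rightarrow> 'a l1elt) \<Rightarrow> 'a cselt" where
  "cs_cls \<sigma> s = {t. cs_cauchy \<sigma> t \<and> (\<lambda>n. unorm \<sigma> (l1_sub (s n) (t n))) \<longlonglongrightarrow> 0}"

definition Cstar :: "('a::topological_space \<Rightarrow> 'a) \<Rightarrow> 'a cselt set" where
  "Cstar \<sigma> = {cs_cls \<sigma> s | s. cs_cauchy \<sigma> s}"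

definition rep :: "'a cselt \<Rightarrow> nat \<Rightarrow> 'a l1elt" where
  "rep A = (SOME s. s \<in> A)"

definition emb :: "('a::topological_space \<Rightarrow> 'a) \<Rightarrow> 'a l1elt \<Rightarrow> 'a cselt" where
  "emb \<sigma> a = cs_cls \<sigma> (\<lambda>n. a)"

definition cs_add :: "('a::topological_space \<Rightarrow> 'a) \<Rightarrow> 'a cselt \<Rightarrow> 'a cselt \<Rightarrow> 'a cselt" where
  "cs_add \<sigma> A B = cs_cls \<sigma> (\<lambda>n. l1_add (rep A n) (rep B n))"

definition cs_smult :: "('a::topological_space \<Rightarrow> 'a) \<Rightarrow> complex \<Rightarrow> 'a cselt \<Rightarrow> 'a cselt" where
  "cs_smult \<sigma> c A = cs_cls \<sigma> (\<lambda>n. l1_smult c (rep A n))"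

definition cs_mult :: "('a::topological_space \<Rightarrow> 'a) \<Rightarrow> 'a cselt \<Rightarrow> 'a cselt \<Rightarrow> 'a cselt" where
  "cs_mult \<sigma> A B = cs_cls \<sigma> (\<lambda>n. l1_mult \<sigma> (rep A n) (rep B n))"

definition cs_star :: "('a::topological_space \<Rightarrow> 'a) \<Rightarrow> 'a cselt \<Rightarrow> 'a cselt" where
  "cs_star \<sigma> A = cs_cls \<sigma> (\<lambda>n. l1_star \<sigma> (rep A n))"

definition cs_zero :: "('a::topological_space \<Rightarrow> 'a) \<Rightarrow> 'a cselt" where
  "cs_zero \<sigma> = emb \<sigma> (\<lambda>k x. 0)"

definition cs_norm :: "('a::topological_space \<Rightarrow> 'a) \<Rightarrow> 'a cselt \<Rightarrow> real" where
  "cs_norm \<sigma> A = lim (\<lambda>n. unorm \<sigma> (rep A n))"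

definition cs_pos :: "('a::topological_space \<Rightarrow> 'a) \<Rightarrow> 'a cselt \<Rightarrow> bool" where
  "cs_pos \<sigma> A \<longleftrightarrow> (\<exists>B\<in>Cstar \<sigma>. A = cs_mult \<sigma> (cs_star \<sigma> B) B)"

definition comm_star :: "('a::topological_space \<Rightarrow> 'a) \<Rightarrow> 'a cselt set" where
  "comm_star \<sigma> = {A \<in> Cstar \<sigma>. \<forall>f\<in>CX.
     cs_mult \<sigma> A (emb \<sigma> (cx f)) = cs_mult \<sigma> (emb \<sigma> (cx f)) A}"

definition comm_00 :: "('a::topological_space \<Rightarrow> 'a) \<Rightarrow> 'a l1elt set" where
  "comm_00 \<sigma> = {a \<in> c00. \<forall>f\<in>CX. l1_mult \<sigma> a (cx f) = l1_mult \<sigma> (cx f) a}"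

definition lin_c00 :: "('a::topological_space \<Rightarrow> 'a) \<Rightarrow> ('a l1elt \<Rightarrow> 'a cselt) \<Rightarrow> bool" where
  "lin_c00 \<sigma> E \<longleftrightarrow> (\<forall>a\<in>c00. \<forall>b\<in>c00. \<forall>c.
     E (l1_add a b) = cs_add \<sigma> (E a) (E b) \<and> E (l1_smult c a) = cs_smult \<sigma> c (E a))"

definition cond1 :: "('a::topological_space \<Rightarrow> 'a) \<Rightarrow> bool" where
  "cond1 \<sigma> \<longleftrightarrow> (\<exists>E. (\<forall>a\<in>c00. E a \<in> comm_star \<sigma>) \<and> lin_c00 \<sigma> E
     \<and> (\<forall>a\<in>comm_00 \<sigma>. E a = emb \<sigma> a)
     \<and> (\<forall>f\<in>CX. \<forall>a\<in>c00. E (l1_mult \<sigma> (cx f) a) = cs_mult \<sigma> (emb \<sigma> (cx f)) (E a)))"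

definition cond2 :: "('a::topological_space \<Rightarrow> 'a) \<Rightarrow> bool" where
  "cond2 \<sigma> \<longleftrightarrow> (\<exists>E. (\<forall>a\<in>c00. E a \<in> comm_star \<sigma>) \<and> lin_c00 \<sigma> E
     \<and> (\<forall>a\<in>comm_00 \<sigma>. E a = emb \<sigma> a)
     \<and> (\<forall>f\<in>CX. \<forall>a\<in>c00. E (l1_mult \<sigma> a (cx f)) = cs_mult \<sigma> (E a) (emb \<sigma> (cx f))))"

definition cond3 :: "('a::topological_space \<Rightarrow> 'a) \<Rightarrow> bool" where
  "cond3 \<sigma> \<longleftrightarrow> (\<forall>k::int. closed (interior (Fix \<sigma> k)))"

definition cs_projection_onto :: "('a::topological_space \<Rightarrow> 'a) \<Rightarrow> ('a cselt \<Rightarrow> 'a cselt) \<Rightarrow> 'a cselt set \<Rightarrow> bool" where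
  "cs_projection_onto \<sigma> E S \<longleftrightarrow>
     (\<forall>A\<in>Cstar \<sigma>. \<forall>B\<in>Cstar \<sigma>. \<forall>c.
        E (cs_add \<sigma> A B) = cs_add \<sigma> (E A) (E B) \<and> E (cs_smult \<sigma> c A) = cs_smult \<sigma> c (E A))
     \<and> (\<forall>A\<in>Cstar \<sigma>. E (E A) = E A)
     \<and> E ` Cstar \<sigma> = S"

definition cond4 :: "('a::topological_space \<Rightarrow> 'a) \<Rightarrow> bool" where
  "cond4 \<sigma> \<longleftrightarrow> (\<exists>E. cs_projection_onto \<sigma> E (comm_star \<sigma>)
     \<and> (\<forall>A\<in>Cstar \<sigma>. cs_pos \<sigma> A \<longrightarrow> cs_pos \<sigma> (E A))
     \<and> (\<forall>A\<in>Cstar \<sigma>. cs_pos \<sigma> A \<and> E A = cs_zero \<sigma> \<longrightarrow> A = cs_zero \<sigma>)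
     \<and> bdd_above ((\<lambda>A. cs_norm \<sigma> (E A)) ` {A \<in> Cstar \<sigma>. cs_norm \<sigma> A \<le> 1})
     \<and> (SUP A\<in>{A \<in> Cstar \<sigma>. cs_norm \<sigma> A \<le> 1}. cs_norm \<sigma> (E A)) = 1
     \<and> (\<forall>A\<in>comm_star \<sigma>. \<forall>B\<in>Cstar \<sigma>.
          E (cs_mult \<sigma> A B) = cs_mult \<sigma> A (E B) \<and> E (cs_mult \<sigma> B A) = cs_mult \<sigma> (E B) A)
     \<and> E ` (emb \<sigma> ` c00) = emb \<sigma> ` comm_00 \<sigma>)"

end

theory Submission
  imports Defs "HOL-Algebra.Ring"
begin

text \<open>
  Write \<open>F\<^sub>k\<close> for the interior of \<open>Fix\<^sub>k(\<sigma>)\<close>. The regular representations on \<open>\<ell>\<^sup>2(\<int>)\<close> show that every Fourier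
  coefficient extends continuously from \<open>\<ell>\<^sup>1(\<Sigma>)\<close> to \<open>C\<^sup>*(\<Sigma>)\<close>, and the \<open>k\<close>-th coefficient of an element commuting
  with \<open>C(X)\<close> vanishes off \<open>F\<^sub>k\<close>. If \<open>E'\<close> is as in (1) or (2), the \<open>k\<close>-th coefficient of \<open>E'(\<delta>\<^sup>k)\<close> is moreover \<open>1\<close> on
  \<open>F\<^sub>k\<close>, hence it is a continuous indicator function of \<open>F\<^sub>k\<close>.

  Conversely, if all \<open>F\<^sub>k\<close> are clopen, \<open>E'\<close> restricts the \<open>k\<close>-th coefficient to \<open>F\<^sub>k\<close>. The set \<open>{k. x \<in> F\<^sub>k}\<close> is a subgroup
  \<open>m(x)\<int>\<close> that is constant along orbits, so on elements of bounded support \<open>E'\<close> is an average of the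
  automorphisms \<open>f\<delta>\<^sup>k \<mapsto> w\<^sup>k f\<delta>\<^sup>k\<close> with \<open>w(x)\<close> an \<open>m(x)\<close>-th root of unity; hence \<open>E'\<close> is contractive. Averaging
  with Fejer weights over constant \<open>w\<close> shows that an element with vanishing Fourier coefficients is zero,
  which yields that \<open>E'\<close> is the identity on the commutant and that it is faithful. Being unital and contractive,
  \<open>E'\<close> is positive, once \<open>b\<^sup>* b\<close> is known to satisfy \<open>\<parallel>t - b\<^sup>* b\<parallel> \<le> t\<close> for some \<open>t > 0\<close>.
\<close>

section \<open>Positive elements of a C*-algebra\<close>

text \<open>The norm of C*(Sigma) is given as a supremum over abstract C*-seminorms, so there is no
  Hilbert space in which to estimate. Upper bounds come from symmetry instead: a *-automorphism
  permutes the admissible seminorms, hence convex combinations of automorphisms are contractive.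
  That is why both the candidate for E' and the Fejer means are realised as averages. Lower bounds
  need one explicit seminorm per point.

  Two obstacles shape the rest. The period m(x) may be infinite or unbounded in x, so no single
  finite average represents E'; one is found for each bound D on the support, and density does the
  gluing. Positivity in (4) means having the form B* B, which a linear map does not visibly
  preserve. It is translated into a norm condition and back, and both directions are proved in an
  abstract C*-algebra by iterated square roots and algebra, without spectra or functional calculus.

  Closedness of the sets F_k enters twice: restricted coefficients stay continuous, and so do the
  roots of unity used in the average.\<close>

locale cstar_algebra = ring R for R (structure) +
  fixes smul :: "complex \<Rightarrow> 'a \<Rightarrow> 'a" (infixr "\<cdot>" 75)
    and star :: "'a \<Rightarrow> 'a"
    and nrm :: "'a \<Rightarrow> real"
  assumes smul_closed [simp, intro]: "a \<in> carrier R \<Longrightarrow> c \<cdot> a \<in> carrier R"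
    and smul_add: "a \<in> carrier R \<Longrightarrow> b \<in> carrier R \<Longrightarrow> c \<cdot> (a \<oplus> b) = c \<cdot> a \<oplus> c \<cdot> b"
    and add_smul: "a \<in> carrier R \<Longrightarrow> (c + d) \<cdot> a = c \<cdot> a \<oplus> d \<cdot> a"
    and smul_smul: "a \<in> carrier R \<Longrightarrow> c \<cdot> d \<cdot> a = (c * d) \<cdot> a"
    and one_smul [simp]: "a \<in> carrier R \<Longrightarrow> 1 \<cdot> a = a"
    and smul_mult_left: "a \<in> carrier R \<Longrightarrow> b \<in> carrier R \<Longrightarrow> (c \<cdot> a) \<otimes> b = c \<cdot> (a \<otimes> b)"
    and smul_mult_right: "a \<in> carrier R \<Longrightarrow> b \<in> carrier R \<Longrightarrow> a \<otimes> (c \<cdot> b) = c \<cdot> (a \<otimes> b)"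
    and star_closed [simp, intro]: "a \<in> carrier R \<Longrightarrow> star a \<in> carrier R"
    and star_star [simp]: "a \<in> carrier R \<Longrightarrow> star (star a) = a"
    and star_add: "a \<in> carrier R \<Longrightarrow> b \<in> carrier R \<Longrightarrow> star (a \<oplus> b) = star a \<oplus> star b"
    and star_mult: "a \<in> carrier R \<Longrightarrow> b \<in> carrier R \<Longrightarrow> star (a \<otimes> b) = star b \<otimes> star a"
    and star_smul: "a \<in> carrier R \<Longrightarrow> star (c \<cdot> a) = cnj c \<cdot> star a"
    and nrm_nonneg [simp]: "a \<in> carrier R \<Longrightarrow> 0 \<le> nrm a"
    and nrm_zeroD: "a \<in> carrier R \<Longrightarrow> nrm a = 0 \<Longrightarrow> a = \<zero>"
    and nrm_triangle: "a \<in> carrier R \<Longrightarrow> b \<in> carrier R \<Longrightarrow> nrm (a \<oplus> b) \<le> nrm a + nrm b"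
    and nrm_smul: "a \<in> carrier R \<Longrightarrow> nrm (c \<cdot> a) = cmod c * nrm a"
    and nrm_mult: "a \<in> carrier R \<Longrightarrow> b \<in> carrier R \<Longrightarrow> nrm (a \<otimes> b) \<le> nrm a * nrm b"
    and nrm_star_mult: "a \<in> carrier R \<Longrightarrow> nrm (star a \<otimes> a) = (nrm a)\<^sup>2"
    and complete: "(\<And>n. s n \<in> carrier R) \<Longrightarrow>
        (\<forall>e>0. \<exists>N. \<forall>m\<ge>N. \<forall>n\<ge>N. nrm (s m \<oplus> (- 1) \<cdot> s n) < e) \<Longrightarrow>
        \<exists>l\<in>carrier R. (\<lambda>n. nrm (s n \<oplus> (- 1) \<cdot> l)) \<longlonglongrightarrow> 0"
begin

lemma zero_smul [simp]: "a \<in> carrier R \<Longrightarrow> 0 \<cdot> a = \<zero>"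
  by (metis add.r_cancel_one' add_smul add_0 smul_closed)

lemma smul_minus: "a \<in> carrier R \<Longrightarrow> (- c) \<cdot> a = \<ominus> (c \<cdot> a)"
  by (metis add.inv_equality add_smul add.left_inverse smul_closed zero_smul)

lemma diff_eq_smul: "a \<in> carrier R \<Longrightarrow> b \<in> carrier R \<Longrightarrow> a \<ominus> b = a \<oplus> (- 1) \<cdot> b"
  by (simp add: minus_eq smul_minus)

lemma smul_minus_right: "a \<in> carrier R \<Longrightarrow> c \<cdot> (\<ominus> a) = \<ominus> (c \<cdot> a)"
  by (metis mult_minus_right mult.right_neutral one_smul smul_minus smul_smul)

lemma smul_diff: "a \<in> carrier R \<Longrightarrow> b \<in> carrier R \<Longrightarrow> c \<cdot> (a \<ominus> b) = c \<cdot> a \<ominus> c \<cdot> b"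
  by (simp add: minus_eq smul_add smul_minus_right)

lemma star_minus: "a \<in> carrier R \<Longrightarrow> star (\<ominus> a) = \<ominus> star a"
  by (metis complex_cnj_minus complex_cnj_one one_smul smul_minus star_closed star_smul)

lemma star_diff: "a \<in> carrier R \<Longrightarrow> b \<in> carrier R \<Longrightarrow> star (a \<ominus> b) = star a \<ominus> star b"
  by (simp add: minus_eq star_add star_minus)

lemma nrm_minus [simp]: "a \<in> carrier R \<Longrightarrow> nrm (\<ominus> a) = nrm a"
  using nrm_smul[of a "-1"] by (simp add: smul_minus)

lemma nrm_diff_triangle: "a \<in> carrier R \<Longrightarrow> b \<in> carrier R \<Longrightarrow> nrm (a \<ominus> b) \<le> nrm a + nrm b"
  using nrm_triangle[of a "\<ominus> b"] by (simp add: minus_eq)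

lemma nrm_zero [simp]: "nrm \<zero> = 0"
  using nrm_smul[of \<zero> 0] by simp

text \<open>The C*-identity and submultiplicativity give |a|^2 \<le> |a*| |a|; used for
  \<open>star a\<close> as well, this makes the involution isometric.\<close>

lemma nrm_star_le: "a \<in> carrier R \<Longrightarrow> nrm a \<le> nrm (star a)"
  by (smt (verit) mult_le_cancel_right nrm_mult nrm_nonneg nrm_star_mult power2_eq_square star_closed)

lemma nrm_star [simp]: "a \<in> carrier R \<Longrightarrow> nrm (star a) = nrm a"
  by (metis nrm_star_le order_antisym star_closed star_star)

lemma star_one [simp]: "star \<one> = \<one>"
  by (metis l_one one_closed r_one star_closed star_mult star_star)

lemma star_zero [simp]: "star \<zero> = \<zero>"
  by (metis nrm_star nrm_zero nrm_zeroD star_closed zero_closed)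

text \<open>By the C*-identity the norm of the unit equals its own square, so it is 0 or 1; the
  value 0 occurs in the trivial ring.\<close>

lemma nrm_one_le: "nrm \<one> \<le> 1"
proof -
  have "nrm \<one> = (nrm \<one>)\<^sup>2"
    using nrm_star_mult[of \<one>] by simp
  then show ?thesis
    by (metis mult_cancel_right1 order_refl power2_eq_square zero_le_one)
qed

lemma nrm_square: "a \<in> carrier R \<Longrightarrow> star a = a \<Longrightarrow> nrm (a \<otimes> a) = (nrm a)\<^sup>2"
  using nrm_star_mult[of a] by simp

lemma diff_zeroD: "a \<in> carrier R \<Longrightarrow> b \<in> carrier R \<Longrightarrow> nrm (a \<ominus> b) = 0 \<Longrightarrow> a = b"
proof -
  assume ab: "a \<in> carrier R" "b \<in> carrier R" and "nrm (a \<ominus> b) = 0"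
  then have "a \<ominus> b = \<zero>" using nrm_zeroD by simp
  moreover have "a = (a \<ominus> b) \<oplus> b" using ab by algebra
  ultimately show "a = b" using ab by simp
qed

lemma nrm_diff_commute: "a \<in> carrier R \<Longrightarrow> b \<in> carrier R \<Longrightarrow> nrm (a \<ominus> b) = nrm (b \<ominus> a)"
  by (metis minus_closed minus_eq add.inv_closed nrm_minus a_comm minus_add minus_minus)

lemma nrm_diff_trans:
  assumes "a \<in> carrier R" "b \<in> carrier R" "c \<in> carrier R"
  shows "nrm (a \<ominus> c) \<le> nrm (a \<ominus> b) + nrm (b \<ominus> c)"
proof -
  have "a \<ominus> c = (a \<ominus> b) \<oplus> (b \<ominus> c)" using assms by algebra
  then show ?thesis using assms nrm_triangle[of "a \<ominus> b" "b \<ominus> c"] by simp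
qed

section \<open>Norm convergence\<close>

definition conv :: "(nat \<Rightarrow> 'a) \<Rightarrow> 'a \<Rightarrow> bool" where
  "conv s l \<longleftrightarrow> (\<lambda>n. nrm (s n \<ominus> l)) \<longlonglongrightarrow> 0"

lemma conv_const [simp]: "a \<in> carrier R \<Longrightarrow> conv (\<lambda>n. a) a"
  by (simp add: conv_def minus_eq r_neg)

lemma conv_unique:
  assumes "conv s a" "conv s b" "\<And>n. s n \<in> carrier R" "a \<in> carrier R" "b \<in> carrier R"
  shows "a = b"
proof (rule diff_zeroD)
  have "(\<lambda>n. nrm (s n \<ominus> a) + nrm (s n \<ominus> b)) \<longlonglongrightarrow> 0 + 0"
    using assms(1,2) unfolding conv_def by (rule tendsto_add)
  moreover have "nrm (a \<ominus> b) \<le> nrm (s n \<ominus> a) + nrm (s n \<ominus> b)" for n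
    using nrm_diff_trans[of a "s n" b] assms nrm_diff_commute[of a "s n"] by simp
  ultimately have "nrm (a \<ominus> b) \<le> 0"
    using LIMSEQ_le_const by fastforce
  then show "nrm (a \<ominus> b) = 0" using assms by (simp add: order_antisym)
qed (use assms in auto)

lemma conv_squeeze:
  assumes "f \<longlonglongrightarrow> 0" "\<And>n. nrm (s n \<ominus> l) \<le> f n" "\<And>n. s n \<in> carrier R" "l \<in> carrier R"
  shows "conv s l"
  unfolding conv_def
  by (rule tendsto_sandwich[OF _ _ tendsto_const assms(1)]) (use assms in auto)

lemma conv_add:
  assumes "conv s a" "conv t b" "\<And>n. s n \<in> carrier R" "\<And>n. t n \<in> carrier R"
    "a \<in> carrier R" "b \<in> carrier R"
  shows "conv (\<lambda>n. s n \<oplus> t n) (a \<oplus> b)"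
proof (rule conv_squeeze)
  show "(\<lambda>n. nrm (s n \<ominus> a) + nrm (t n \<ominus> b)) \<longlonglongrightarrow> 0"
    using tendsto_add[OF assms(1,2)[unfolded conv_def]] by simp
  have "(s n \<oplus> t n) \<ominus> (a \<oplus> b) = (s n \<ominus> a) \<oplus> (t n \<ominus> b)" for n
    using assms(3)[of n] assms(4)[of n] assms(5,6) by algebra
  then show "nrm ((s n \<oplus> t n) \<ominus> (a \<oplus> b)) \<le> nrm (s n \<ominus> a) + nrm (t n \<ominus> b)" for n
    using assms nrm_triangle by simp
qed (use assms in auto)

lemma conv_smul:
  assumes "conv s a" "\<And>n. s n \<in> carrier R" "a \<in> carrier R"
  shows "conv (\<lambda>n. c \<cdot> s n) (c \<cdot> a)"
proof (rule conv_squeeze)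
  show "(\<lambda>n. cmod c * nrm (s n \<ominus> a)) \<longlonglongrightarrow> 0"
    using tendsto_mult_left[OF assms(1)[unfolded conv_def]] by simp
  show "nrm (c \<cdot> s n \<ominus> c \<cdot> a) \<le> cmod c * nrm (s n \<ominus> a)" for n
    using assms by (simp add: smul_diff[symmetric] nrm_smul)
qed (use assms in auto)

lemma conv_star:
  assumes "conv s a" "\<And>n. s n \<in> carrier R" "a \<in> carrier R"
  shows "conv (\<lambda>n. star (s n)) (star a)"
proof (rule conv_squeeze)
  show "(\<lambda>n. nrm (s n \<ominus> a)) \<longlonglongrightarrow> 0"
    using assms(1)[unfolded conv_def] .
  show "nrm (star (s n) \<ominus> star a) \<le> nrm (s n \<ominus> a)" for n
    using assms by (simp add: star_diff[symmetric])
qed (use assms in auto)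

lemma conv_mult:
  assumes "conv s a" "conv t b" "\<And>n. s n \<in> carrier R" "\<And>n. t n \<in> carrier R"
    "a \<in> carrier R" "b \<in> carrier R"
  shows "conv (\<lambda>n. s n \<otimes> t n) (a \<otimes> b)"
proof (rule conv_squeeze)
  let ?u = "\<lambda>n. nrm (s n \<ominus> a)" and ?v = "\<lambda>n. nrm (t n \<ominus> b)"
  show "(\<lambda>n. ?u n * ?v n + ?u n * nrm b + nrm a * ?v n) \<longlonglongrightarrow> 0"
    using assms(1,2)[unfolded conv_def] by (auto intro!: tendsto_eq_intros)
  fix n
  have eq: "s n \<otimes> t n \<ominus> a \<otimes> b = ((s n \<ominus> a) \<otimes> (t n \<ominus> b) \<oplus> (s n \<ominus> a) \<otimes> b) \<oplus> a \<otimes> (t n \<ominus> b)"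
    using assms(3)[of n] assms(4)[of n] assms(5,6) by algebra
  have "nrm (s n \<otimes> t n \<ominus> a \<otimes> b) \<le> nrm ((s n \<ominus> a) \<otimes> (t n \<ominus> b)) + nrm ((s n \<ominus> a) \<otimes> b) + nrm (a \<otimes> (t n \<ominus> b))"
    unfolding eq using assms
    by (intro order_trans[OF nrm_triangle] add_mono nrm_triangle order_refl) auto
  also have "\<dots> \<le> ?u n * ?v n + ?u n * nrm b + nrm a * ?v n"
    using assms by (intro add_mono nrm_mult) auto
  finally show "nrm (s n \<otimes> t n \<ominus> a \<otimes> b) \<le> ?u n * ?v n + ?u n * nrm b + nrm a * ?v n" .
qed (use assms in auto)

text \<open>The element u = h + i k is normal with u* u = h^2 + k^2, and h is its real part, so |h|
  \<le> |u|. This stands in for the monotonicity of the norm on positive elements.\<close>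

lemma commuting_nrm_le:
  assumes "h \<in> carrier R" "k \<in> carrier R" "star h = h" "star k = k" "h \<otimes> k = k \<otimes> h"
  shows "(nrm h)\<^sup>2 \<le> nrm (h \<otimes> h \<oplus> k \<otimes> k)"
proof -
  define u where "u = h \<oplus> \<i> \<cdot> k"
  have u: "u \<in> carrier R" using assms by (simp add: u_def)
  have su: "star u = h \<ominus> \<i> \<cdot> k"
    using assms by (simp add: u_def star_add star_smul smul_minus minus_eq)
  have "star u \<otimes> u = h \<otimes> h \<oplus> \<i> \<cdot> (h \<otimes> k) \<ominus> \<i> \<cdot> (k \<otimes> h) \<oplus> k \<otimes> k"
  proof -
    have "(h \<ominus> \<i> \<cdot> k) \<otimes> (h \<oplus> \<i> \<cdot> k) = h \<otimes> h \<oplus> h \<otimes> (\<i> \<cdot> k) \<ominus> (\<i> \<cdot> k) \<otimes> h \<ominus> (\<i> \<cdot> k) \<otimes> (\<i> \<cdot> k)"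
      using assms(1,2) smul_closed[OF assms(2), of \<i>] by algebra
    also have "(\<i> \<cdot> k) \<otimes> (\<i> \<cdot> k) = \<ominus> (k \<otimes> k)"
      using assms by (simp add: smul_mult_left smul_mult_right smul_smul smul_minus)
    finally show ?thesis unfolding su unfolding u_def using assms(1,2)
      by (simp add: smul_mult_left smul_mult_right minus_eq)
  qed
  also have "\<dots> = h \<otimes> h \<oplus> k \<otimes> k"
    unfolding assms(5)[symmetric]
    using assms(1,2) smul_closed[OF m_closed[OF assms(1,2)], of \<i>] by algebra
  finally have n: "(nrm u)\<^sup>2 = nrm (h \<otimes> h \<oplus> k \<otimes> k)"
    using nrm_star_mult[OF u] by simp
  have "2 \<cdot> h = u \<oplus> star u"
  proof -
    have "2 \<cdot> h = h \<oplus> h" using add_smul[of h 1 1] assms by simp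
    also have "\<dots> = u \<oplus> star u" unfolding su unfolding u_def
      using assms(1) smul_closed[OF assms(2), of \<i>] by algebra
    finally show ?thesis .
  qed
  then have "2 * nrm h \<le> nrm u + nrm u"
    using nrm_smul[OF assms(1), of 2] nrm_triangle[of u "star u"] u by simp
  then show ?thesis
    using n assms power_mono[of "nrm h" "nrm u" 2] by simp
qed

section \<open>Square roots by iteration\<close>

lemma commute_one_diff:
  "z \<in> carrier R \<Longrightarrow> w \<in> carrier R \<Longrightarrow> z \<otimes> w = w \<otimes> z \<Longrightarrow> z \<otimes> (\<one> \<ominus> w) = (\<one> \<ominus> w) \<otimes> z"
  by (simp add: minus_eq r_distr l_distr r_minus l_minus)

text \<open>The square root is \<open>1 - l\<close> with \<open>l = lim y\<^sub>n\<close>, \<open>y\<^sub>n\<^sub>+\<^sub>1 = (x + y\<^sub>n\<^sup>2) / 2\<close>; the increments of \<open>y\<close> are dominated by those of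
  the same iteration for the number \<open>x = 1\<close>, which converges.\<close>

lemma sqrt_one_minus_exists:
  assumes x: "x \<in> carrier R" "star x = x" "nrm x \<le> 1"
  obtains s where "s \<in> carrier R" "star s = s" "s \<otimes> s = \<one> \<ominus> x" "nrm (\<one> \<ominus> s) \<le> 1"
    "\<And>z. z \<in> carrier R \<Longrightarrow> z \<otimes> x = x \<otimes> z \<Longrightarrow> z \<otimes> s = s \<otimes> z"
proof -
  define y where "y = rec_nat \<zero> (\<lambda>_ y. (1/2) \<cdot> (x \<oplus> y \<otimes> y))"
  define a :: "nat \<Rightarrow> real" where "a = rec_nat 0 (\<lambda>_ a. (1 + a * a) / 2)"
  have y0: "y 0 = \<zero>" and ySuc: "y (Suc n) = (1/2) \<cdot> (x \<oplus> y n \<otimes> y n)" for n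
    by (simp_all add: y_def)
  have a0: "a 0 = 0" and aSuc: "a (Suc n) = (1 + a n * a n) / 2" for n
    by (simp_all add: a_def)
  have yc [simp]: "y n \<in> carrier R" for n
    by (induction n) (use x in \<open>auto simp: y0 ySuc\<close>)
  have sy: "star (y n) = y n" for n
    by (induction n) (use x in \<open>auto simp: y0 ySuc star_smul star_add star_mult\<close>)
  have comm: "z \<otimes> y n = y n \<otimes> z" if z: "z \<in> carrier R" "z \<otimes> x = x \<otimes> z" for z n
  proof (induction n)
    case (Suc n)
    have "z \<otimes> (y n \<otimes> y n) = (y n \<otimes> y n) \<otimes> z"
      by (metis Suc m_assoc yc z(1))
    then show ?case using x z by (simp add: ySuc smul_mult_left smul_mult_right r_distr l_distr)
  qed (use z in \<open>simp add: y0\<close>)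
  \<comment> \<open>Every iterate is a polynomial in x, so the iterates commute; this lets the
    differences of squares below factor.\<close>
  have yy: "y m \<otimes> y n = y n \<otimes> y m" for m n
    by (rule comm) (use comm[of x] x in auto)
  have an: "0 \<le> a n \<and> a n \<le> 1" for n
  proof (induction n)
    case (Suc n)
    then have "a n * a n \<le> 1" by (simp add: mult_le_one)
    then show ?case using Suc by (simp add: aSuc)
  qed (simp add: a0)
  have ny: "nrm (y n) \<le> a n" for n
  proof (induction n)
    case (Suc n)
    have "nrm (y n \<otimes> y n) \<le> a n * a n"
      using nrm_mult[of "y n" "y n"] Suc by (meson mult_mono nrm_nonneg order_trans yc an)
    then have "nrm (x \<oplus> y n \<otimes> y n) \<le> 1 + a n * a n"
      using nrm_triangle[of x "y n \<otimes> y n"] x by simp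
    then show ?case using x by (simp add: ySuc nrm_smul aSuc)
  qed (simp add: y0 a0)
  have step: "nrm (y (Suc n) \<ominus> y n) \<le> a (Suc n) - a n" for n
  proof (induction n)
    case 0
    show ?case using x by (simp add: y0 a0 aSuc ySuc nrm_smul minus_eq)
  next
    case (Suc n)
    let ?u = "y (Suc n)" and ?v = "y n"
    have "(x \<oplus> ?u \<otimes> ?u) \<ominus> (x \<oplus> ?v \<otimes> ?v) = (?u \<otimes> ?u \<ominus> ?v \<otimes> ?v)"
      using x(1) yc[of "Suc n"] yc[of n] by algebra
    also have "\<dots> = (?u \<otimes> ?u \<ominus> ?u \<otimes> ?v \<oplus> ?u \<otimes> ?v \<ominus> ?v \<otimes> ?v)"
      using yc[of "Suc n"] yc[of n] by algebra
    also have "\<dots> = (?u \<otimes> ?u \<ominus> ?u \<otimes> ?v \<oplus> ?v \<otimes> ?u \<ominus> ?v \<otimes> ?v)"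
      using yy[of "Suc n" n] by simp
    also have "\<dots> = (?u \<oplus> ?v) \<otimes> (?u \<ominus> ?v)"
      using yc[of "Suc n"] yc[of n] by algebra
    finally have "y (Suc (Suc n)) \<ominus> y (Suc n) = (1/2) \<cdot> ((?u \<oplus> ?v) \<otimes> (?u \<ominus> ?v))"
      using x by (simp add: ySuc smul_diff[symmetric] del: yc)
        (simp add: ySuc smul_diff[symmetric])
    then have "nrm (y (Suc (Suc n)) \<ominus> y (Suc n)) = (1/2) * nrm ((?u \<oplus> ?v) \<otimes> (?u \<ominus> ?v))"
      by (simp add: nrm_smul)
    also have "\<dots> \<le> (1/2) * ((a (Suc n) + a n) * (a (Suc n) - a n))"
    proof -
      have "nrm ((?u \<oplus> ?v) \<otimes> (?u \<ominus> ?v)) \<le> nrm (?u \<oplus> ?v) * nrm (?u \<ominus> ?v)"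
        by (simp add: nrm_mult)
      also have "\<dots> \<le> (a (Suc n) + a n) * (a (Suc n) - a n)"
        using nrm_triangle[of ?u ?v] ny[of "Suc n"] ny[of n] an[of "Suc n"] an[of n] Suc
        by (intro mult_mono) auto
      finally show ?thesis by simp
    qed
    also have "\<dots> = a (Suc (Suc n)) - a (Suc n)"
    proof -
      have "a (Suc (Suc n)) - a (Suc n) = (1 + a (Suc n) * a (Suc n)) / 2 - (1 + a n * a n) / 2"
        by (metis aSuc)
      then show ?thesis by (simp add: field_simps)
    qed
    finally show ?case .
  qed
  have mono: "a n \<le> a (Suc n)" for n
    using step[of n] nrm_nonneg[OF minus_closed[OF yc yc], of "Suc n" n] by linarith
  have diff: "nrm (y (n + k) \<ominus> y n) \<le> a (n + k) - a n" for n k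
  proof (induction k)
    case 0
    show ?case by (simp add: minus_eq r_neg)
  next
    case (Suc k)
    show ?case using nrm_diff_trans[of "y (n + Suc k)" "y (n + k)" "y n"] step[of "n + k"] Suc by simp
  qed
  have "Cauchy a"
  proof (rule convergent_Cauchy, rule Bseq_monoseq_convergent)
    show "Bseq a" by (rule BseqI'[of _ 1]) (use an in auto)
    show "monoseq a" using mono by (simp add: monoseq_Suc)
  qed
  have "\<forall>e>0. \<exists>N. \<forall>m\<ge>N. \<forall>n\<ge>N. nrm (y m \<ominus> y n) < e"
  proof (intro allI impI)
    fix e :: real assume "e > 0"
    then obtain N where N: "\<And>m n. m \<ge> N \<Longrightarrow> n \<ge> N \<Longrightarrow> \<bar>a m - a n\<bar> < e"
      using \<open>Cauchy a\<close> unfolding Cauchy_def dist_real_def by blast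
    have "nrm (y m \<ominus> y n) < e" if "m \<ge> N" "n \<ge> N" for m n
    proof (cases "n \<le> m")
      case True
      then show ?thesis using diff[of n "m - n"] N[OF that] by simp
    next
      case False
      then show ?thesis using diff[of m "n - m"] N[OF that] nrm_diff_commute[of "y m" "y n"] by simp
    qed
    then show "\<exists>N. \<forall>m\<ge>N. \<forall>n\<ge>N. nrm (y m \<ominus> y n) < e" by blast
  qed
  then obtain l where l: "l \<in> carrier R" "conv y l"
    using complete[of y] unfolding conv_def by (auto simp: diff_eq_smul)
  have sl: "star l = l"
    using conv_unique[OF conv_star[OF l(2)] _ ] l sy by simp
  have lc: "z \<otimes> l = l \<otimes> z" if z: "z \<in> carrier R" "z \<otimes> x = x \<otimes> z" for z
  proof (rule conv_unique)
    show "conv (\<lambda>n. z \<otimes> y n) (z \<otimes> l)" using conv_mult[OF conv_const l(2)] l z by simp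
    show "conv (\<lambda>n. z \<otimes> y n) (l \<otimes> z)"
      using conv_mult[OF l(2) conv_const[of z]] l z comm[OF z] by simp
  qed (use l z in auto)
  \<comment> \<open>The bound on the limit l becomes the bound on 1 - s = l, which later makes the
    root positive in the sense of \<open>pos\<close>.\<close>
  have "(\<lambda>n. nrm (y n \<ominus> l) + 1) \<longlonglongrightarrow> 0 + 1"
    using l(2) unfolding conv_def by (intro tendsto_intros)
  moreover have "nrm l \<le> nrm (y n \<ominus> l) + 1" for n
  proof -
    have "l = y n \<ominus> (y n \<ominus> l)" using l(1) yc[of n] by algebra
    then have "nrm l \<le> nrm (y n) + nrm (y n \<ominus> l)"
      using nrm_diff_triangle[of "y n" "y n \<ominus> l"] l(1) by simp
    then show ?thesis using ny[of n] an[of n] by linarith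
  qed
  ultimately have nl: "nrm l \<le> 1"
    using LIMSEQ_le_const by fastforce
  have "conv (\<lambda>n. y (Suc n)) l"
    using l(2) unfolding conv_def by (rule LIMSEQ_Suc)
  moreover have "conv (\<lambda>n. y (Suc n)) ((1/2) \<cdot> (x \<oplus> l \<otimes> l))"
    unfolding ySuc using x l by (intro conv_smul conv_add conv_mult conv_const) auto
  ultimately have "l = (1/2) \<cdot> (x \<oplus> l \<otimes> l)"
    by (rule conv_unique) (use x l in auto)
  then have "2 \<cdot> l = 2 \<cdot> ((1/2) \<cdot> (x \<oplus> l \<otimes> l))" by simp
  \<comment> \<open>The fixed point equation 2 l = x + l^2 is (1 - l)^2 = 1 - x in disguise.\<close>
  then have eq: "l \<oplus> l = x \<oplus> l \<otimes> l"
    using add_smul[of l 1 1] x l by (simp add: smul_smul)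
  show thesis
  proof
    show "\<one> \<ominus> l \<in> carrier R" "star (\<one> \<ominus> l) = \<one> \<ominus> l" using l sl by (simp_all add: star_diff)
    have "(\<one> \<ominus> l) \<otimes> (\<one> \<ominus> l) = \<one> \<ominus> l \<ominus> l \<otimes> \<one> \<oplus> l \<otimes> l" using l(1) by algebra
    also have "\<dots> = \<one> \<ominus> (l \<oplus> l) \<oplus> l \<otimes> l" unfolding r_one[OF l(1)] using l(1) by algebra
    also have "\<dots> = \<one> \<ominus> x" unfolding eq using x l by algebra
    finally show "(\<one> \<ominus> l) \<otimes> (\<one> \<ominus> l) = \<one> \<ominus> x" .
    have "\<one> \<ominus> (\<one> \<ominus> l) = l" using l by algebra
    then show "nrm (\<one> \<ominus> (\<one> \<ominus> l)) \<le> 1" using nl by simp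
    show "z \<otimes> (\<one> \<ominus> l) = (\<one> \<ominus> l) \<otimes> z" if z: "z \<in> carrier R" "z \<otimes> x = x \<otimes> z" for z
      using lc[OF z] z(1) l(1) by (rule commute_one_diff[rotated 2])
  qed
qed

text \<open>Write 1 - h^2 = s^2 with s commuting with h. Then s^2 + h^2 = 1, so
  \<open>commuting_nrm_le\<close> bounds the norm of s by 1, and |1 - h^2| = |s|^2.\<close>

lemma nrm_one_minus_square_le:
  assumes h: "h \<in> carrier R" "star h = h" "nrm h \<le> 1"
  shows "nrm (\<one> \<ominus> h \<otimes> h) \<le> 1"
proof -
  have hh: "h \<otimes> h \<in> carrier R" "star (h \<otimes> h) = h \<otimes> h" "nrm (h \<otimes> h) \<le> 1"
    using nrm_square[OF h(1,2)] h by (simp_all add: power_le_one star_mult)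
  show ?thesis
  proof (rule sqrt_one_minus_exists[OF hh])
    fix s
    assume s: "s \<in> carrier R" "star s = s" "s \<otimes> s = \<one> \<ominus> h \<otimes> h"
      and cs: "\<And>z. z \<in> carrier R \<Longrightarrow> z \<otimes> (h \<otimes> h) = (h \<otimes> h) \<otimes> z \<Longrightarrow> z \<otimes> s = s \<otimes> z"
    have "h \<otimes> s = s \<otimes> h" using cs[of h] h by (simp add: m_assoc)
    then have "(nrm s)\<^sup>2 \<le> nrm (s \<otimes> s \<oplus> h \<otimes> h)"
      using commuting_nrm_le[of s h] s h by simp
    also have "s \<otimes> s \<oplus> h \<otimes> h = \<one>"
      unfolding s(3) using h(1) by algebra
    finally have "(nrm s)\<^sup>2 \<le> 1" using nrm_one_le by simp
    then show ?thesis using nrm_square[OF s(1,2)] s(3) by simp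
  qed
qed

text \<open>For self-adjoint a the norm condition says that the spectrum lies in [0, 2 t]. In this
  form positivity is additive by the triangle inequality and survives unital contractions that
  respect the involution.\<close>

definition pos :: "'a \<Rightarrow> bool" where
  "pos a \<longleftrightarrow> a \<in> carrier R \<and> star a = a \<and> (\<exists>t>0. nrm (complex_of_real t \<cdot> \<one> \<ominus> a) \<le> t)"

lemma pos_carrier [dest]: "pos a \<Longrightarrow> a \<in> carrier R"
  by (simp add: pos_def)

lemma nrm_minus_square_le:
  assumes h: "h \<in> carrier R" "star h = h" and t: "t > 0" "(nrm h)\<^sup>2 \<le> t"
  shows "nrm (complex_of_real t \<cdot> \<one> \<ominus> h \<otimes> h) \<le> t"
proof -
  define g where "g = complex_of_real (1 / sqrt t) \<cdot> h"
  have g: "g \<in> carrier R" "star g = g" using h by (simp_all add: g_def star_smul)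
  have "nrm h \<le> sqrt t" using t h by (simp add: real_le_rsqrt)
  then have "nrm g \<le> 1" using h t unfolding g_def by (simp add: nrm_smul norm_divide)
  then have "nrm (\<one> \<ominus> g \<otimes> g) \<le> 1" using nrm_one_minus_square_le g by simp
  moreover have "complex_of_real t \<cdot> \<one> \<ominus> h \<otimes> h = complex_of_real t \<cdot> (\<one> \<ominus> g \<otimes> g)"
  proof -
    have "t * (1 / sqrt t * (1 / sqrt t)) = 1" using t by (simp add: field_simps)
    then have "complex_of_real t * (complex_of_real (1 / sqrt t) * complex_of_real (1 / sqrt t)) = 1"
      by (metis of_real_1 of_real_mult)
    then show ?thesis using h t unfolding g_def
      by (simp only: smul_diff smul_mult_left smul_mult_right smul_smul m_closed one_closed smul_closed one_smul)
  qed
  ultimately show ?thesis using t g by (simp add: nrm_smul)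
qed

lemma pos_square: "h \<in> carrier R \<Longrightarrow> star h = h \<Longrightarrow> pos (h \<otimes> h)"
proof -
  assume h: "h \<in> carrier R" "star h = h"
  obtain t where "t > 0" "(nrm h)\<^sup>2 \<le> t"
    by (metis gt_ex le_less_linear less_imp_le order_less_trans zero_less_one linorder_neqE_linordered_idom)
  then show "pos (h \<otimes> h)"
    unfolding pos_def using nrm_minus_square_le[OF h] h by (auto simp: star_mult)
qed

text \<open>Divided by t, the element a becomes 1 - x with x of norm at most 1; its root is scaled
  back by the square root of t. The last clause, that the root commutes with whatever commutes with
  a, replaces functional calculus in the arguments below.\<close>

lemma pos_sqrt_exists:
  assumes "pos a"
  obtains s where "pos s" "s \<otimes> s = a"
    "\<And>z. z \<in> carrier R \<Longrightarrow> z \<otimes> a = a \<otimes> z \<Longrightarrow> z \<otimes> s = s \<otimes> z"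
proof -
  obtain t where a: "a \<in> carrier R" "star a = a" and t: "t > 0" "nrm (complex_of_real t \<cdot> \<one> \<ominus> a) \<le> t"
    using assms by (auto simp: pos_def)
  define c where "c = complex_of_real (1 / t)"
  define x where "x = \<one> \<ominus> c \<cdot> a"
  have x: "x \<in> carrier R" "star x = x" using a by (simp_all add: x_def c_def star_diff star_smul)
  have "x = c \<cdot> (complex_of_real t \<cdot> \<one> \<ominus> a)"
    using a t by (simp add: x_def smul_diff smul_smul c_def)
  then have "nrm x = 1 / t * nrm (complex_of_real t \<cdot> \<one> \<ominus> a)"
    using a t by (simp add: nrm_smul c_def norm_divide)
  then have "nrm x \<le> 1" using t by simp
  then obtain s where s: "s \<in> carrier R" "star s = s" "s \<otimes> s = \<one> \<ominus> x" "nrm (\<one> \<ominus> s) \<le> 1"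
    "\<And>z. z \<in> carrier R \<Longrightarrow> z \<otimes> x = x \<otimes> z \<Longrightarrow> z \<otimes> s = s \<otimes> z"
    using sqrt_one_minus_exists[OF x] by blast
  have "\<one> \<ominus> x = c \<cdot> a" unfolding x_def using smul_closed[OF a(1), of c] by algebra
  then have s3: "s \<otimes> s = c \<cdot> a" using s by simp
  define d where "d = complex_of_real (sqrt t)"
  have d: "d * (d * c) = 1" using t unfolding d_def c_def
    by (metis mult.assoc nonzero_mult_div_cancel_left of_real_1 of_real_mult order_less_imp_not_eq2
        real_sqrt_mult_self abs_of_pos times_divide_eq_right mult_1_right)
  show thesis
  proof
    have "d \<cdot> \<one> \<ominus> d \<cdot> s = d \<cdot> (\<one> \<ominus> s)" using s by (simp add: smul_diff)
    then have "nrm (d \<cdot> \<one> \<ominus> d \<cdot> s) \<le> sqrt t"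
      using s t by (simp add: nrm_smul d_def)
    then show "pos (d \<cdot> s)" unfolding pos_def using s t
      by (auto simp: star_smul d_def intro!: exI[of _ "sqrt t"])
    show "(d \<cdot> s) \<otimes> (d \<cdot> s) = a"
      using s(1) a d by (simp add: smul_mult_left smul_mult_right s3 smul_smul)
    fix z assume z: "z \<in> carrier R" "z \<otimes> a = a \<otimes> z"
    have "z \<otimes> x = x \<otimes> z" unfolding x_def
      using z a by (intro commute_one_diff) (simp_all add: smul_mult_left smul_mult_right)
    then have "z \<otimes> s = s \<otimes> z" using s(5) z by blast
    then show "z \<otimes> (d \<cdot> s) = (d \<cdot> s) \<otimes> z" using z s by (simp add: smul_mult_left smul_mult_right)
  qed
qed

lemma pos_add: "pos a \<Longrightarrow> pos b \<Longrightarrow> pos (a \<oplus> b)"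
proof -
  assume ab: "pos a" "pos b"
  then obtain s t where s: "s > 0" "nrm (complex_of_real s \<cdot> \<one> \<ominus> a) \<le> s"
    and t: "t > 0" "nrm (complex_of_real t \<cdot> \<one> \<ominus> b) \<le> t" by (auto simp: pos_def)
  have c: "a \<in> carrier R" "b \<in> carrier R" using ab by auto
  have "complex_of_real (s + t) \<cdot> \<one> \<ominus> (a \<oplus> b) =
      (complex_of_real s \<cdot> \<one> \<oplus> complex_of_real t \<cdot> \<one>) \<ominus> (a \<oplus> b)"
    by (simp add: add_smul)
  also have "\<dots> = (complex_of_real s \<cdot> \<one> \<ominus> a) \<oplus> (complex_of_real t \<cdot> \<one> \<ominus> b)"
    using c smul_closed[OF one_closed, of s] smul_closed[OF one_closed, of t] by algebra
  finally have "nrm (complex_of_real (s + t) \<cdot> \<one> \<ominus> (a \<oplus> b)) \<le> s + t"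
    using nrm_triangle[of "complex_of_real s \<cdot> \<one> \<ominus> a" "complex_of_real t \<cdot> \<one> \<ominus> b"] s t c by simp
  then show ?thesis using ab s t unfolding pos_def
    by (auto simp: star_add intro!: exI[of _ "s + t"])
qed

text \<open>With a = s^2 and -a = r^2, r commutes with a and hence with s. So |s|^2 is bounded by
  the norm of s^2 + r^2 = 0.\<close>

lemma pos_antisym:
  assumes "pos a" "pos (\<ominus> a)"
  shows "a = \<zero>"
proof -
  have a: "a \<in> carrier R" using assms by auto
  obtain s where ps: "pos s" "s \<otimes> s = a"
    and cs: "\<And>z. z \<in> carrier R \<Longrightarrow> z \<otimes> a = a \<otimes> z \<Longrightarrow> z \<otimes> s = s \<otimes> z"
    using pos_sqrt_exists[OF assms(1)] by blast
  then have s: "s \<in> carrier R" "star s = s" "s \<otimes> s = a" by (simp_all add: pos_def)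
  obtain r where r: "r \<in> carrier R" "star r = r" "r \<otimes> r = \<ominus> a"
    using pos_sqrt_exists[OF assms(2)] by (metis pos_def)
  have "a = \<ominus> (r \<otimes> r)" using r a by simp
  then have "r \<otimes> a = a \<otimes> r" using r(1) by (simp add: r_minus l_minus m_assoc)
  then have "s \<otimes> r = r \<otimes> s" using cs[of r] r by simp
  then have "(nrm s)\<^sup>2 \<le> nrm (s \<otimes> s \<oplus> r \<otimes> r)"
    using commuting_nrm_le[of s r] s r by simp
  also have "s \<otimes> s \<oplus> r \<otimes> r = \<zero>" using s r a by (simp add: r_neg)
  finally have "nrm s = 0" by simp
  then have "s = \<zero>" using s nrm_zeroD by simp
  then show ?thesis using s by simp
qed

text \<open>This is the identity \<open>2 (c\<^sup>* c + c c\<^sup>*) = (c + c\<^sup>*)\<^sup>2 + (i (c - c\<^sup>*))\<^sup>2\<close>.\<close>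

lemma pos_star_mult_add:
  assumes c: "c \<in> carrier R"
  shows "pos (star c \<otimes> c \<oplus> c \<otimes> star c)"
proof -
  define u where "u = (1/2) \<cdot> (c \<oplus> star c)"
  define v where "v = (\<i>/2) \<cdot> (c \<ominus> star c)"
  have u: "u \<in> carrier R" "star u = u" using c by (simp_all add: u_def star_smul star_add a_comm)
  have v: "v \<in> carrier R" using c by (simp add: v_def)
  have "star v = (- (\<i>/2)) \<cdot> (star c \<ominus> c)" using c by (simp add: v_def star_smul star_diff)
  also have "\<dots> = (\<i>/2) \<cdot> (\<ominus> (star c \<ominus> c))" using c by (simp add: smul_minus smul_minus_right)
  also have "\<ominus> (star c \<ominus> c) = c \<ominus> star c" using c star_closed[OF c] by algebra
  finally have sv: "star v = v" by (simp add: v_def)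
  let ?p = "(c \<oplus> star c) \<otimes> (c \<oplus> star c)" and ?q = "(c \<ominus> star c) \<otimes> (c \<ominus> star c)"
  let ?w = "star c \<otimes> c \<oplus> c \<otimes> star c"
  have uu: "u \<otimes> u = (1/4) \<cdot> ?p"
    using c by (simp add: u_def smul_mult_left smul_mult_right smul_smul)
  have vv: "v \<otimes> v = \<ominus> ((1/4) \<cdot> ?q)"
    using c by (simp add: v_def smul_mult_left smul_mult_right smul_smul smul_minus)
  have "u \<otimes> u \<oplus> v \<otimes> v = (1/4) \<cdot> (?p \<ominus> ?q)"
    unfolding uu vv using c by (simp add: smul_diff minus_eq[of "_ \<cdot> _"])
  also have "?p \<ominus> ?q = ?w \<oplus> ?w"
    using c star_closed[OF c] by algebra
  also have "\<dots> = 2 \<cdot> ?w" using add_smul[of ?w 1 1] c by simp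
  finally have e: "u \<otimes> u \<oplus> v \<otimes> v = (1/2) \<cdot> ?w" using c by (simp add: smul_smul)
  have "?w = (1/2) \<cdot> ?w \<oplus> (1/2) \<cdot> ?w" using add_smul[of ?w "1/2" "1/2"] c by simp
  then show ?thesis unfolding e[symmetric]
    using pos_add pos_square u v sv by metis
qed

text \<open>Replaces the usual comparison of the spectra of c* c and c c*. Let r be a root of y, c'
  = c r and z = c c*. Then c'* c' = -y^2 and c' c'* = -z^2; their sum is positive by
  \<open>pos_star_mult_add\<close>, and adding z^2 shows that -y^2 is positive, which forces y^2 =
  0.\<close>

lemma star_mult_neg_imp_zero:
  assumes c: "c \<in> carrier R" and y: "pos y" "star c \<otimes> c = \<ominus> y"
  shows "y = \<zero>"
proof -
  have yc: "y \<in> carrier R" using y by auto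
  define z where "z = c \<otimes> star c"
  have zc: "z \<in> carrier R" using c by (simp add: z_def)
  have "z = (star c \<otimes> c \<oplus> c \<otimes> star c) \<oplus> y"
    unfolding y(2) z_def[symmetric] using yc zc by algebra
  then have "pos z" using pos_star_mult_add[OF c] pos_add y by metis
  then have sz: "star z = z" by (simp add: pos_def)
  obtain r where r: "r \<in> carrier R" "star r = r" "r \<otimes> r = y"
    using pos_sqrt_exists[OF y(1)] by (metis pos_def)
  define c' where "c' = c \<otimes> r"
  have c': "c' \<in> carrier R" using c r by (simp add: c'_def)
  have sc': "star c' = r \<otimes> star c" using c r by (simp add: c'_def star_mult)
  have "star c' \<otimes> c' = r \<otimes> (star c \<otimes> c) \<otimes> r"
    unfolding sc' unfolding c'_def using c r(1) by (simp add: m_assoc)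
  also have "\<dots> = \<ominus> ((r \<otimes> r) \<otimes> (r \<otimes> r))"
    unfolding y(2) r(3)[symmetric] using r(1) by algebra
  finally have 1: "star c' \<otimes> c' = \<ominus> (y \<otimes> y)" using r by simp
  have "c' \<otimes> star c' = c \<otimes> y \<otimes> star c"
    unfolding sc' unfolding c'_def r(3)[symmetric] using c r(1) by (simp add: m_assoc)
  also have "\<dots> = \<ominus> (c \<otimes> (\<ominus> y) \<otimes> star c)" using c yc star_closed[OF c] by algebra
  also have "\<dots> = \<ominus> (z \<otimes> z)"
    unfolding y(2)[symmetric] z_def using c by (simp add: m_assoc)
  finally have 2: "c' \<otimes> star c' = \<ominus> (z \<otimes> z)" .
  have sy: "star y = y" using y by (simp add: pos_def)
  have p: "pos (\<ominus> (y \<otimes> y) \<oplus> \<ominus> (z \<otimes> z))"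
    using pos_star_mult_add[OF c'] 1 2 by simp
  have e: "(\<ominus> (y \<otimes> y) \<oplus> \<ominus> (z \<otimes> z)) \<oplus> z \<otimes> z = \<ominus> (y \<otimes> y)"
    using yc zc by algebra
  have "pos (\<ominus> (y \<otimes> y))"
    using pos_add[OF p pos_square[OF zc sz]] unfolding e .
  then have "y \<otimes> y = \<zero>" using pos_antisym pos_square[OF yc sy] by blast
  then have "nrm y = 0" using nrm_square[OF yc sy] by simp
  then show ?thesis using nrm_zeroD yc by blast
qed

text \<open>Let q be the root of h^2, that is the absolute value of h = b* b, and d = q - h, twice
  the negative part of h. Since h d = -q d, the element u = b d satisfies u* u = -(r d)^2 with r a
  root of q. The previous lemma makes this vanish; then d = 0 and h = q is positive.\<close>

theorem pos_star_mult:
  assumes b: "b \<in> carrier R"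
  shows "pos (star b \<otimes> b)"
proof -
  define h where "h = star b \<otimes> b"
  have h: "h \<in> carrier R" "star h = h" using b by (simp_all add: h_def star_mult)
  obtain q where pq: "pos q" and qq: "q \<otimes> q = h \<otimes> h"
    and cq: "\<And>z. z \<in> carrier R \<Longrightarrow> z \<otimes> (h \<otimes> h) = (h \<otimes> h) \<otimes> z \<Longrightarrow> z \<otimes> q = q \<otimes> z"
    using pos_sqrt_exists[OF pos_square[OF h]] by blast
  have q: "q \<in> carrier R" "star q = q" using pq by (simp_all add: pos_def)
  have hq: "h \<otimes> q = q \<otimes> h" using cq[of h] h by (simp add: m_assoc)
  obtain r where pr: "pos r" and rr: "r \<otimes> r = q"
    and cr: "\<And>z. z \<in> carrier R \<Longrightarrow> z \<otimes> q = q \<otimes> z \<Longrightarrow> z \<otimes> r = r \<otimes> z"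
    using pos_sqrt_exists[OF pq] by blast
  have r: "r \<in> carrier R" "star r = r" using pr by (simp_all add: pos_def)
  define d where "d = q \<ominus> h"
  have d: "d \<in> carrier R" "star d = d" using q h by (simp_all add: d_def star_diff)
  have dq: "d \<otimes> q = q \<otimes> d"
  proof -
    have "d \<otimes> q = q \<otimes> q \<ominus> h \<otimes> q" unfolding d_def using q(1) h(1) by algebra
    also have "\<dots> = q \<otimes> d" unfolding hq d_def using q(1) h(1) by algebra
    finally show ?thesis .
  qed
  then have dr: "d \<otimes> r = r \<otimes> d" using cr d by simp
  have hd: "h \<otimes> d = \<ominus> (q \<otimes> d)"
  proof -
    have "h \<otimes> d = h \<otimes> q \<ominus> h \<otimes> h" unfolding d_def using q(1) h(1) by algebra
    also have "\<dots> = q \<otimes> h \<ominus> q \<otimes> q" unfolding hq qq ..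
    also have "\<dots> = \<ominus> (q \<otimes> d)" unfolding d_def using q(1) h(1) by algebra
    finally show ?thesis .
  qed
  define y where "y = (r \<otimes> d) \<otimes> (r \<otimes> d)"
  have rd: "r \<otimes> d \<in> carrier R" "star (r \<otimes> d) = r \<otimes> d" using r d dr by (simp_all add: star_mult)
  have "star (b \<otimes> d) \<otimes> (b \<otimes> d) = d \<otimes> (h \<otimes> d)"
    using b d by (simp add: star_mult m_assoc h_def)
  also have "\<dots> = \<ominus> (d \<otimes> (r \<otimes> r) \<otimes> d)" unfolding hd rr using d(1) q(1) by algebra
  also have "d \<otimes> (r \<otimes> r) \<otimes> d = (d \<otimes> r) \<otimes> (r \<otimes> d)" using d r by (simp add: m_assoc)
  finally have "star (b \<otimes> d) \<otimes> (b \<otimes> d) = \<ominus> y" unfolding y_def dr .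
  then have "y = \<zero>"
    using star_mult_neg_imp_zero[of "b \<otimes> d" y] pos_square[OF rd] b d y_def by simp
  then have "nrm (r \<otimes> d) = 0" using nrm_square[OF rd] unfolding y_def by simp
  then have "r \<otimes> d = \<zero>" using nrm_zeroD rd by blast
  then have qd: "q \<otimes> d = \<zero>" unfolding rr[symmetric] using r d by (simp add: m_assoc)
  \<comment> \<open>Both q d and h d = -q d vanish, so d^2 = q d - h d = 0.\<close>
  then have "d \<otimes> d = \<zero>" using hd q h d unfolding d_def
    by (metis l_distr minus_eq add.inv_closed l_minus minus_zero r_zero zero_closed l_zero)
  then have "nrm d = 0" using nrm_square[OF d] by simp
  then have "q = h" using diff_zeroD q h d_def by blast
  then show ?thesis using pq h_def by simp
qed

end

section \<open>The convolution algebra\<close>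

lemma summable_convolution:
  fixes A B :: "int \<Rightarrow> real"
  assumes "A summable_on UNIV" "B summable_on UNIV" "\<And>k. 0 \<le> A k" "\<And>k. 0 \<le> B k"
  shows "(\<lambda>(k, n). A k * B (n - k)) summable_on UNIV \<times> UNIV"
proof (rule summable_on_SigmaI)
  fix k :: int
  have "(B has_sum infsum B UNIV) UNIV" using assms by simp
  moreover have "((\<lambda>n. B (n - k)) has_sum infsum B UNIV) UNIV \<longleftrightarrow> (B has_sum infsum B UNIV) UNIV"
    by (rule has_sum_reindex_bij_witness[where i = "\<lambda>n. n + k" and j = "\<lambda>n. n - k"]) auto
  ultimately have "((\<lambda>n. B (n - k)) has_sum infsum B UNIV) UNIV" by simp
  then show "((\<lambda>n. case (k, n) of (k, n) \<Rightarrow> A k * B (n - k)) has_sum A k * infsum B UNIV) UNIV"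
    by (simp add: has_sum_cmult_right)
  show "(\<lambda>k. A k * infsum B UNIV) summable_on UNIV"
    using assms by (intro summable_on_cmult_left) auto
qed (use assms in auto)

text \<open>The space is the whole type and therefore non-empty, as suprema over it require.\<close>

locale dynamical_system =
  fixes \<sigma> :: "'a::t2_space \<Rightarrow> 'a"
  assumes compact_space: "compact (UNIV :: 'a set)"
    and homeo: "\<exists>\<tau>. homeomorphism UNIV UNIV \<sigma> \<tau>"
begin

abbreviation "unrm \<equiv> unorm \<sigma>"
abbreviation "cls \<equiv> cs_cls \<sigma>"
abbreviation "cauchy \<equiv> cs_cauchy \<sigma>"
abbreviation "mul1 \<equiv> l1_mult \<sigma>"
abbreviation "star1 \<equiv> l1_star \<sigma>"
abbreviation "csnorm \<equiv> cs_norm \<sigma>"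
abbreviation "csmul \<equiv> cs_mult \<sigma>"
abbreviation "csadd \<equiv> cs_add \<sigma>"
abbreviation "cssmul \<equiv> cs_smult \<sigma>"
abbreviation "csstar \<equiv> cs_star \<sigma>"

section \<open>Integer powers of the homeomorphism\<close>

lemma bij_sigma: "bij \<sigma>"
  using homeo unfolding homeomorphism_def by (metis UNIV_I bijI' )

lemma spow_0 [simp]: "spow \<sigma> 0 x = x"
  by (simp add: spow_def)

lemma inv_sigma [simp]: "\<sigma> (inv_into UNIV \<sigma> x) = x" "inv_into UNIV \<sigma> (\<sigma> x) = x"
  using bij_sigma by (simp_all add: bij_is_surj surj_f_inv_f bij_is_inj)

lemma spow_Suc: "spow \<sigma> (k + 1) x = \<sigma> (spow \<sigma> k x)"
proof (cases "k \<ge> 0")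
  case True
  then have "nat (k + 1) = Suc (nat k)" by simp
  then show ?thesis using True by (simp add: spow_def)
next
  case False
  define m where "m = nat (- k - 1)"
  have "nat (- k) = Suc m" using False by (simp add: m_def)
  moreover have "spow \<sigma> (k + 1) x = (inv_into UNIV \<sigma> ^^ m) x"
    using False by (cases "k = -1") (auto simp: spow_def m_def)
  ultimately show ?thesis using False by (simp add: spow_def)
qed

lemma spow_pred: "spow \<sigma> (k - 1) x = inv_into UNIV \<sigma> (spow \<sigma> k x)"
  using spow_Suc[of "k - 1" x] by (metis add.commute diff_add_cancel inv_sigma(2))

lemma spow_add: "spow \<sigma> (j + k) x = spow \<sigma> j (spow \<sigma> k x)"
proof (induction j rule: int_induct[where k = 0])
  case (step1 i)
  then show ?case using spow_Suc[of "i + k" x] spow_Suc[of i "spow \<sigma> k x"] by (simp add: ac_simps)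
next
  case (step2 i)
  then show ?case using spow_pred[of "i + k" x] spow_pred[of i "spow \<sigma> k x"]
    by (simp add: algebra_simps)
qed simp

lemma spow_cancel [simp]: "spow \<sigma> (- k) (spow \<sigma> k x) = x" "spow \<sigma> k (spow \<sigma> (- k) x) = x"
  using spow_add[of "-k" k x] spow_add[of k "-k" x] by simp_all

lemma continuous_spow: "continuous_on UNIV (spow \<sigma> k)"
proof -
  obtain \<tau> where \<tau>: "homeomorphism UNIV UNIV \<sigma> \<tau>" using homeo by blast
  have "inv_into UNIV \<sigma> = \<tau>"
    using \<tau> bij_sigma unfolding homeomorphism_def by (metis UNIV_I ext inv_sigma(1))
  then have c: "continuous_on UNIV \<sigma>" "continuous_on UNIV (inv_into UNIV \<sigma>)"
    using \<tau> unfolding homeomorphism_def by auto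
  have "continuous_on UNIV (f ^^ n)" if "continuous_on UNIV f" for f :: "'a \<Rightarrow> 'a" and n
  proof (induction n)
    case (Suc n)
    then show ?case
      using continuous_on_compose[of UNIV "f ^^ n" f] that continuous_on_subset by auto
  qed (simp add: id_def)
  then show ?thesis using c by (simp add: spow_def)
qed

section \<open>The sup norm and membership in l1\<close>

lemma CX_bdd: "f \<in> CX \<Longrightarrow> bdd_above (range (\<lambda>x::'a. cmod (f x)))"
  unfolding CX_def using compact_space
  by (auto intro!: bounded_imp_bdd_above compact_imp_bounded compact_continuous_image continuous_intros)

lemma supn_ge: "f \<in> CX \<Longrightarrow> cmod (f (x::'a)) \<le> supn f"
  unfolding supn_def using CX_bdd by (auto intro: cSUP_upper2)

lemma supn_le: "(\<And>x::'a. cmod (f x) \<le> B) \<Longrightarrow> supn f \<le> B"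
  unfolding supn_def by (rule cSUP_least) auto

lemma supn_nonneg: "f \<in> CX \<Longrightarrow> 0 \<le> supn (f :: 'a \<Rightarrow> complex)"
  using supn_ge norm_ge_zero order_trans by blast

lemma supn_zero [simp]: "supn (\<lambda>x::'a. 0) = 0"
  by (simp add: supn_def)

lemma CX_intros:
  "(\<lambda>x. c) \<in> CX"
  "f \<in> CX \<Longrightarrow> g \<in> CX \<Longrightarrow> (\<lambda>x. f x + g x) \<in> CX"
  "f \<in> CX \<Longrightarrow> g \<in> CX \<Longrightarrow> (\<lambda>x. f x - g x) \<in> CX"
  "f \<in> CX \<Longrightarrow> g \<in> CX \<Longrightarrow> (\<lambda>x. f x * g x) \<in> CX"
  "f \<in> CX \<Longrightarrow> (\<lambda>x. cnj (f x)) \<in> CX"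
  by (auto simp: CX_def intro!: continuous_intros)

lemma CX_spow: "f \<in> CX \<Longrightarrow> (\<lambda>x. f (spow \<sigma> k x)) \<in> CX"
  unfolding CX_def using continuous_on_compose[OF continuous_spow, of k f]
  by (auto simp: o_def intro: continuous_on_subset)

lemma l1D: "a \<in> l1 \<Longrightarrow> a k \<in> CX" "a \<in> l1 \<Longrightarrow> (\<lambda>k. supn (a k)) summable_on UNIV"
  by (auto simp: l1_def)

lemma l1I:
  assumes "\<And>k. a k \<in> CX" "M summable_on UNIV" "\<And>k (x::'a). cmod (a k x) \<le> M k"
  shows "a \<in> l1"
proof -
  have "(\<lambda>k. supn (a k)) summable_on UNIV"
    by (rule summable_on_comparison_test[OF assms(2)]) (use assms in \<open>auto intro: supn_le supn_nonneg\<close>)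
  then show ?thesis using assms by (simp add: l1_def)
qed

lemma l1_norm_le:
  assumes "a \<in> l1" "M summable_on UNIV" "\<And>k (x::'a). cmod (a k x) \<le> M k"
  shows "l1_norm a \<le> (\<Sum>\<^sub>\<infinity>k. M k)"
  unfolding l1_norm_def
  by (rule infsum_mono) (use assms in \<open>auto intro: supn_le l1D\<close>)

lemma l1_norm_nonneg: "(a :: 'a l1elt) \<in> l1 \<Longrightarrow> 0 \<le> l1_norm a"
  unfolding l1_norm_def by (rule infsum_nonneg) (auto intro: supn_nonneg l1D)

lemma l1_ge: "(a :: 'a l1elt) \<in> l1 \<Longrightarrow> cmod (a k x) \<le> supn (a k)"
  by (simp add: l1D supn_ge)

lemma l1_supn_nonneg [simp]: "(a :: 'a l1elt) \<in> l1 \<Longrightarrow> 0 \<le> supn (a k)"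
  by (simp add: l1D supn_nonneg)

lemma l1_add:
  assumes a: "(a :: 'a l1elt) \<in> l1" and b: "b \<in> l1"
  shows "l1_add a b \<in> l1"
  unfolding l1_add_def
  by (rule l1I[where M = "\<lambda>k. supn (a k) + supn (b k)"])
    (use l1D[OF a] l1D[OF b] l1_ge[OF a] l1_ge[OF b] in
     \<open>auto intro!: CX_intros summable_on_add order_trans[OF norm_triangle_ineq] add_mono\<close>)

lemma l1_sub:
  assumes a: "(a :: 'a l1elt) \<in> l1" and b: "b \<in> l1"
  shows "l1_sub a b \<in> l1"
  unfolding l1_sub_def
  by (rule l1I[where M = "\<lambda>k. supn (a k) + supn (b k)"])
    (use l1D[OF a] l1D[OF b] l1_ge[OF a] l1_ge[OF b] in
     \<open>auto intro!: CX_intros summable_on_add order_trans[OF norm_triangle_ineq4] add_mono\<close>)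

lemma l1_smult:
  assumes a: "(a :: 'a l1elt) \<in> l1"
  shows "l1_smult c a \<in> l1"
  unfolding l1_smult_def
  by (rule l1I[where M = "\<lambda>k. cmod c * supn (a k)"])
    (use l1D[OF a] l1_ge[OF a] in
     \<open>auto intro!: CX_intros summable_on_cmult_right mult_left_mono simp: norm_mult\<close>)

lemma summable_uminus_int: "(M :: int \<Rightarrow> real) summable_on UNIV \<Longrightarrow> (\<lambda>k. M (- k)) summable_on UNIV"
  by (rule summable_on_reindex_bij_witness[THEN iffD1, of UNIV uminus uminus UNIV "\<lambda>k. M (- k)" M]) auto

lemma l1_star:
  assumes a: "a \<in> l1"
  shows "star1 a \<in> l1"
  unfolding l1_star_def alpha_pow_def o_def
  by (rule l1I[where M = "\<lambda>k. supn (a (- k))"])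
    (use l1D[OF a] l1_ge[OF a] in
     \<open>auto intro!: CX_intros CX_spow summable_uminus_int[of "\<lambda>k. supn (a k)"]\<close>)

lemma cx_in_c00: "f \<in> CX \<Longrightarrow> cx (f :: 'a \<Rightarrow> complex) \<in> c00"
proof -
  assume f: "f \<in> CX"
  have "(\<lambda>k::int. if k = 0 then supn f else 0) summable_on UNIV"
    by (rule finite_nonzero_values_imp_summable_on) auto
  then have "cx f \<in> l1" using f
    by (intro l1I[where M = "\<lambda>k. if k = 0 then supn f else 0"]) (auto simp: cx_def CX_intros supn_ge)
  moreover have "finite {k. cx f k \<noteq> (\<lambda>x. 0)}"
    by (rule finite_subset[of _ "{0}"]) (auto simp: cx_def)
  ultimately show ?thesis by (simp add: c00_def)
qed

lemma c00_l1: "a \<in> c00 \<Longrightarrow> a \<in> l1"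
  by (simp add: c00_def)

lemma cx_in_l1: "f \<in> CX \<Longrightarrow> cx (f :: 'a \<Rightarrow> complex) \<in> l1"
  by (simp add: c00_l1 cx_in_c00)

section \<open>Twisted convolution and involution\<close>

lemma l1_mult_alt: "mul1 a b n x = (\<Sum>\<^sub>\<infinity>k. a k x * b (n - k) (spow \<sigma> (- k) x))"
  by (simp add: l1_mult_def alpha_pow_def)

lemma l1_convolution_summable:
  assumes "(a :: 'a l1elt) \<in> l1" "(b :: 'a l1elt) \<in> l1"
  shows "(\<lambda>(k, n). supn (a k) * supn (b (n - k))) summable_on UNIV \<times> UNIV"
    and "(\<lambda>k. supn (a k) * supn (b (n - k))) summable_on UNIV"
    and "(\<lambda>n. \<Sum>\<^sub>\<infinity>k. supn (a k) * supn (b (n - k))) summable_on UNIV"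
proof -
  let ?f = "\<lambda>k n. supn (a k) * supn (b (n - k))"
  show 1: "(\<lambda>(k, n). ?f k n) summable_on UNIV \<times> UNIV"
    by (rule summable_convolution) (use assms in \<open>auto simp: l1D\<close>)
  then have 2: "(\<lambda>(n, k). ?f k n) summable_on UNIV \<times> UNIV"
    using summable_on_swap[of "\<lambda>(k, n). ?f k n" UNIV UNIV] by simp
  then show 3: "(\<lambda>k. ?f k n) summable_on UNIV" for n
    using summable_on_SigmaD1[of "\<lambda>n k. ?f k n" UNIV "\<lambda>_. UNIV" n] by simp
  show "(\<lambda>n. \<Sum>\<^sub>\<infinity>k. ?f k n) summable_on UNIV"
    using summable_on_SigmaD[OF 2] 3 by simp
qed

lemma mult_term_le:
  assumes "(a :: 'a l1elt) \<in> l1" "(b :: 'a l1elt) \<in> l1"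
  shows "cmod (a k x * b j y) \<le> supn (a k) * supn (b j)"
  unfolding norm_mult using assms by (intro mult_mono l1_ge) auto

lemma l1_mult_summable:
  assumes "a \<in> l1" "b \<in> l1"
  shows "(\<lambda>k. norm (a k x * b (n - k) (spow \<sigma> (- k) x))) summable_on UNIV"
  by (rule Infinite_Sum.abs_summable_on_comparison_test'[OF l1_convolution_summable(2)[OF assms, of n]])
    (rule mult_term_le[OF assms])

lemma l1_mult:
  assumes "a \<in> l1" "b \<in> l1"
  shows "mul1 a b \<in> l1"
proof (rule l1I)
  show "(\<lambda>n. \<Sum>\<^sub>\<infinity>k. supn (a k) * supn (b (n - k))) summable_on UNIV"
    by (rule l1_convolution_summable(3)[OF assms])
  show "cmod (mul1 a b n x) \<le> (\<Sum>\<^sub>\<infinity>k. supn (a k) * supn (b (n - k)))" for n x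
    unfolding l1_mult_alt
    by (rule norm_infsum_le[OF has_sum_infsum has_sum_infsum])
      (use mult_term_le[OF assms] l1_mult_summable[OF assms] l1_convolution_summable(2)[OF assms]
       in \<open>auto intro: abs_summable_summable\<close>)
  fix n
  \<comment> \<open>A coefficient of the product is an infinite sum of continuous functions; the
    summable majorant makes it converge uniformly, so the limit is continuous.\<close>
  have "uniform_limit UNIV (\<lambda>X y. \<Sum>k\<in>X. a k y * b (n - k) (spow \<sigma> (- k) y)) (mul1 a b n)
    (finite_subsets_at_top UNIV)"
    unfolding l1_mult_alt[abs_def]
    by (rule Weierstrass_m_test_general[OF _ l1_convolution_summable(2)[OF assms]])
      (rule mult_term_le[OF assms])
  then have "continuous_on UNIV (mul1 a b n)"
  proof (rule uniform_limit_theorem[rotated])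
    show "\<forall>\<^sub>F X in finite_subsets_at_top UNIV.
        continuous_on UNIV (\<lambda>y. \<Sum>k\<in>X. a k y * b (n - k) (spow \<sigma> (- k) y))"
    proof (intro always_eventually allI continuous_on_sum)
      fix k :: int
      show "continuous_on UNIV (\<lambda>y. a k y * b (n - k) (spow \<sigma> (- k) y))"
        using CX_intros(4)[OF l1D(1)[OF assms(1)] CX_spow[OF l1D(1)[OF assms(2)]], of k "n - k" "- k"]
        by (simp add: CX_def)
    qed
  qed simp
  then show "mul1 a b n \<in> CX" by (simp add: CX_def)
qed

lemma l1_mult_assoc:
  assumes "a \<in> l1" "b \<in> l1" "c \<in> l1"
  shows "mul1 (mul1 a b) c = mul1 a (mul1 b c)"
proof (intro ext)
  fix n x
  let ?f = "\<lambda>j k. a j x * b (k - j) (spow \<sigma> (- j) x) * c (n - k) (spow \<sigma> (- k) x)"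
  \<comment> \<open>Bounding all values of c by this constant leaves the convolution majorant of a
    and b, which justifies exchanging the two sums.\<close>
  define C where "C = l1_norm c"
  have cC: "cmod (c k y) \<le> C" for k y
  proof -
    have "(\<Sum>k\<in>{k}. supn (c k)) \<le> (\<Sum>\<^sub>\<infinity>k. supn (c k))"
      by (rule finite_sum_le_infsum) (use assms in \<open>auto simp: l1D\<close>)
    then show ?thesis using l1_ge[OF assms(3), of k y] by (simp add: C_def l1_norm_def)
  qed
  have "(\<lambda>p. C * (\<lambda>(k, n). supn (a k) * supn (b (n - k))) p) summable_on UNIV \<times> UNIV"
    by (rule summable_on_cmult_right[OF l1_convolution_summable(1)[OF assms(1,2)]])
  then have "(\<lambda>p. norm ((\<lambda>(j, k). ?f j k) p)) summable_on UNIV \<times> UNIV"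
  proof (rule Infinite_Sum.abs_summable_on_comparison_test')
    fix p :: "int \<times> int"
    obtain j k where p: "p = (j, k)" by (cases p)
    have "norm (?f j k) \<le> (supn (a j) * supn (b (k - j))) * C"
      unfolding norm_mult[of "a j x * _"]
      using mult_term_le[OF assms(1,2)] cC assms by (intro mult_mono) auto
    then show "norm ((\<lambda>(j, k). ?f j k) p) \<le> C * (\<lambda>(k, n). supn (a k) * supn (b (n - k))) p"
      by (simp add: p mult.commute)
  qed
  then have s: "(\<lambda>(j, k). ?f j k) summable_on UNIV \<times> UNIV" by (rule abs_summable_summable)
  have "mul1 (mul1 a b) c n x = (\<Sum>\<^sub>\<infinity>k. \<Sum>\<^sub>\<infinity>j. ?f j k)"
    unfolding l1_mult_alt by (simp only: infsum_cmult_left')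
  also have "\<dots> = (\<Sum>\<^sub>\<infinity>j. \<Sum>\<^sub>\<infinity>k. ?f j k)"
    by (rule infsum_swap_banach[OF s, symmetric])
  also have "\<dots> = (\<Sum>\<^sub>\<infinity>j. a j x * (\<Sum>\<^sub>\<infinity>i. b i (spow \<sigma> (- j) x) * c (n - j - i) (spow \<sigma> (- i) (spow \<sigma> (- j) x))))"
  proof (rule infsum_cong)
    fix j
    have "(\<Sum>\<^sub>\<infinity>k. ?f j k) = (\<Sum>\<^sub>\<infinity>i. ?f j (i + j))"
      by (rule infsum_reindex_bij_witness[of _ "\<lambda>i. i + j" "\<lambda>k. k - j"]) auto
    also have "\<dots> = (\<Sum>\<^sub>\<infinity>i. a j x * (b i (spow \<sigma> (- j) x) * c (n - j - i) (spow \<sigma> (- i) (spow \<sigma> (- j) x))))"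
      by (rule infsum_cong) (simp add: spow_add[symmetric] algebra_simps)
    finally show "(\<Sum>\<^sub>\<infinity>k. ?f j k) = a j x * (\<Sum>\<^sub>\<infinity>i. b i (spow \<sigma> (- j) x) * c (n - j - i) (spow \<sigma> (- i) (spow \<sigma> (- j) x)))"
      by (simp only: infsum_cmult_right')
  qed
  also have "\<dots> = mul1 a (mul1 b c) n x"
    unfolding l1_mult_alt ..
  finally show "mul1 (mul1 a b) c n x = mul1 a (mul1 b c) n x" .
qed

lemma l1_mult_add_left:
  assumes "a \<in> l1" "b \<in> l1" "c \<in> l1"
  shows "mul1 (l1_add a b) c = l1_add (mul1 a c) (mul1 b c)"
  using abs_summable_summable[OF l1_mult_summable[OF assms(1,3)]]
    abs_summable_summable[OF l1_mult_summable[OF assms(2,3)]]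
  by (intro ext) (simp add: l1_mult_alt l1_add_def distrib_right infsum_add)

lemma l1_mult_add_right:
  assumes "a \<in> l1" "b \<in> l1" "c \<in> l1"
  shows "mul1 a (l1_add b c) = l1_add (mul1 a b) (mul1 a c)"
  using abs_summable_summable[OF l1_mult_summable[OF assms(1,2)]]
    abs_summable_summable[OF l1_mult_summable[OF assms(1,3)]]
  by (intro ext) (simp add: l1_mult_alt l1_add_def distrib_left infsum_add)

lemma l1_mult_smult_left: "mul1 (l1_smult c a) b = l1_smult c (mul1 a b)"
  by (intro ext) (simp add: l1_mult_alt l1_smult_def mult.assoc infsum_cmult_right')

lemma l1_mult_smult_right: "mul1 a (l1_smult c b) = l1_smult c (mul1 a b)"
  by (intro ext) (simp add: l1_mult_alt l1_smult_def mult.left_commute infsum_cmult_right')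

lemma infsum_single:
  fixes f :: "int \<Rightarrow> complex"
  assumes "\<And>k. k \<noteq> j \<Longrightarrow> f k = 0"
  shows "(\<Sum>\<^sub>\<infinity>k. f k) = f j"
proof -
  have "(\<Sum>\<^sub>\<infinity>k. f k) = (\<Sum>\<^sub>\<infinity>k\<in>{j}. f k)"
    by (rule infsum_cong_neutral) (use assms in auto)
  then show ?thesis by simp
qed

lemma cx_mult: "mul1 (cx f) a n x = f x * a n x"
  unfolding l1_mult_alt by (subst infsum_single[of 0]) (auto simp: cx_def)

lemma mult_cx: "mul1 a (cx f) n x = a n x * f (spow \<sigma> (- n) x)"
  unfolding l1_mult_alt by (subst infsum_single[of n]) (auto simp: cx_def)

lemma l1_star_alt: "star1 a n x = cnj (a (- n) (spow \<sigma> (- n) x))"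
  by (simp add: l1_star_def alpha_pow_def)

lemma l1_star_star [simp]: "star1 (star1 a) = a"
  by (intro ext) (simp add: l1_star_alt spow_cancel(2)[of "-_", simplified])

lemma l1_star_add: "star1 (l1_add a b) = l1_add (star1 a) (star1 b)"
  by (intro ext) (simp add: l1_star_alt l1_add_def)

lemma l1_star_sub: "star1 (l1_sub a b) = l1_sub (star1 a) (star1 b)"
  by (intro ext) (simp add: l1_star_alt l1_sub_def)

lemma l1_star_smult: "star1 (l1_smult c a) = l1_smult (cnj c) (star1 a)"
  by (intro ext) (simp add: l1_star_alt l1_smult_def)

lemma l1_star_mult: "star1 (mul1 a b) = mul1 (star1 b) (star1 a)"
proof (intro ext)
  fix n x
  have "star1 (mul1 a b) n x =
      (\<Sum>\<^sub>\<infinity>k. cnj (a k (spow \<sigma> (- n) x) * b (- n - k) (spow \<sigma> (- k) (spow \<sigma> (- n) x))))"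
    by (simp only: l1_star_alt l1_mult_alt infsum_cnj[symmetric])
  also have "\<dots> = (\<Sum>\<^sub>\<infinity>k. star1 b k x * star1 a (n - k) (spow \<sigma> (- k) x))"
    by (rule infsum_reindex_bij_witness[of _ "\<lambda>k. k - n" "\<lambda>k. n + k"])
      (auto simp: l1_star_alt spow_add[symmetric] minus_diff_commute add.commute mult.commute)
  also have "\<dots> = mul1 (star1 b) (star1 a) n x"
    by (simp only: l1_mult_alt)
  finally show "star1 (mul1 a b) n x = mul1 (star1 b) (star1 a) n x" .
qed

end

section \<open>The enveloping C*-algebra\<close>

context dynamical_system
begin

section \<open>The universal C*-seminorm\<close>

lemma cstar_seminormD:
  assumes "cstar_seminorm \<sigma> p" "a \<in> l1"
  shows "0 \<le> p a" "b \<in> l1 \<Longrightarrow> p (l1_add a b) \<le> p a + p b" "p (l1_smult c a) = cmod c * p a"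
    "b \<in> l1 \<Longrightarrow> p (mul1 a b) \<le> p a * p b" "p (mul1 (star1 a) a) = (p a)\<^sup>2"
    "p a \<le> l1_norm a"
  using assms(1)[unfolded cstar_seminorm_def, rule_format, OF assms(2), of a]
    assms(1)[unfolded cstar_seminorm_def, rule_format, OF assms(2), of b]
    assms(1)[unfolded cstar_seminorm_def, rule_format, OF assms(2), of a c] assms(2)
  by simp_all

text \<open>Makes the set under the supremum in \<open>unorm\<close> non-empty and gives its
  non-negativity.\<close>

lemma cstar_seminorm_zero: "cstar_seminorm \<sigma> (\<lambda>a. 0)"
  by (simp add: cstar_seminorm_def l1_norm_nonneg)

lemma unorm_le:
  assumes "\<And>p. cstar_seminorm \<sigma> p \<Longrightarrow> p a \<le> B"
  shows "unrm a \<le> B"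
  unfolding unorm_def by (rule cSUP_least) (use cstar_seminorm_zero assms in auto)

lemma unorm_ge:
  assumes "cstar_seminorm \<sigma> p" "a \<in> l1"
  shows "p a \<le> unrm a"
  unfolding unorm_def
proof (rule cSUP_upper)
  show "bdd_above ((\<lambda>p. p a) ` {p. cstar_seminorm \<sigma> p})"
    by (rule bdd_aboveI[of _ "l1_norm a"]) (use assms cstar_seminormD(6) in auto)
qed (use assms in auto)

lemma unorm_nonneg [simp]: "a \<in> l1 \<Longrightarrow> 0 \<le> unrm a"
  using unorm_ge[OF cstar_seminorm_zero] .

lemma unorm_le_l1_norm: "a \<in> l1 \<Longrightarrow> unrm a \<le> l1_norm a"
  by (rule unorm_le) (rule cstar_seminormD(6))

lemma unorm_add:
  assumes "a \<in> l1" "b \<in> l1"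
  shows "unrm (l1_add a b) \<le> unrm a + unrm b"
proof (rule unorm_le)
  fix p assume p: "cstar_seminorm \<sigma> p"
  show "p (l1_add a b) \<le> unrm a + unrm b"
    using cstar_seminormD(2)[OF p assms] unorm_ge[OF p assms(1)] unorm_ge[OF p assms(2)] by linarith
qed

lemma unorm_mult:
  assumes "a \<in> l1" "b \<in> l1"
  shows "unrm (mul1 a b) \<le> unrm a * unrm b"
proof (rule unorm_le)
  fix p assume p: "cstar_seminorm \<sigma> p"
  have "p (mul1 a b) \<le> p a * p b" by (rule cstar_seminormD(4)[OF p assms])
  also have "\<dots> \<le> unrm a * unrm b"
    using assms by (intro mult_mono unorm_ge[OF p] unorm_nonneg cstar_seminormD(1)[OF p])
  finally show "p (mul1 a b) \<le> unrm a * unrm b" .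
qed

lemma unorm_smult_le:
  assumes "a \<in> l1"
  shows "unrm (l1_smult c a) \<le> cmod c * unrm a"
proof (rule unorm_le)
  fix p assume p: "cstar_seminorm \<sigma> p"
  show "p (l1_smult c a) \<le> cmod c * unrm a"
    unfolding cstar_seminormD(3)[OF p assms] by (intro mult_left_mono unorm_ge[OF p assms]) simp
qed

lemma unorm_smult: assumes a: "a \<in> l1" shows "unrm (l1_smult c a) = cmod c * unrm a"
proof (cases "c = 0")
  case True
  then show ?thesis using unorm_smult_le[OF a, of c] unorm_nonneg[OF l1_smult[OF a], of c] by simp
next
  case False
  have "a = l1_smult (1 / c) (l1_smult c a)" using False by (simp add: l1_smult_def)
  then have "unrm a \<le> cmod (1 / c) * unrm (l1_smult c a)"
    using unorm_smult_le[OF l1_smult[OF a], of "1 / c" c] by simp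
  then have "cmod c * unrm a \<le> unrm (l1_smult c a)"
    using False by (simp add: norm_divide field_simps)
  then show ?thesis using unorm_smult_le[OF a, of c] by simp
qed

lemma unorm_cstar: assumes a: "a \<in> l1" shows "unrm (mul1 (star1 a) a) = (unrm a)\<^sup>2"
proof (rule order_antisym)
  show "unrm (mul1 (star1 a) a) \<le> (unrm a)\<^sup>2"
    by (rule unorm_le) (use a in \<open>simp add: cstar_seminormD unorm_ge power_mono\<close>)
  \<comment> \<open>The root is taken so that the supremum is compared with p a itself rather than
    with its square.\<close>
  have "unrm a \<le> sqrt (unrm (mul1 (star1 a) a))"
  proof (rule unorm_le)
    fix p assume p: "cstar_seminorm \<sigma> p"
    show "p a \<le> sqrt (unrm (mul1 (star1 a) a))"
      using unorm_ge[OF p l1_mult[OF l1_star[OF a] a]] cstar_seminormD(5)[OF p a]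
      by (simp add: real_le_rsqrt)
  qed
  then have "(unrm a)\<^sup>2 \<le> (sqrt (unrm (mul1 (star1 a) a)))\<^sup>2"
    using a by (intro power_mono) auto
  then show "(unrm a)\<^sup>2 \<le> unrm (mul1 (star1 a) a)"
    using unorm_nonneg[OF l1_mult[OF l1_star[OF a] a]] by simp
qed

lemma unorm_star_le: assumes a: "a \<in> l1" shows "unrm a \<le> unrm (star1 a)"
proof -
  have "unrm a * unrm a \<le> unrm (star1 a) * unrm a"
    using unorm_mult[OF l1_star[OF a] a] unorm_cstar[OF a] by (simp add: power2_eq_square)
  then show ?thesis
    using unorm_nonneg[OF a] unorm_nonneg[OF l1_star[OF a]] by (smt (verit) mult_le_cancel_right)
qed

lemma unorm_star: "a \<in> l1 \<Longrightarrow> unrm (star1 a) = unrm a"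
  using unorm_star_le[of a] unorm_star_le[of "star1 a"] l1_star by fastforce

lemma l1_sub_eq: "l1_sub a b = l1_add a (l1_smult (- 1) b)"
  by (simp add: l1_sub_def l1_add_def l1_smult_def)

lemma l1_sub_commute: "l1_sub b a = l1_smult (- 1) (l1_sub a b)"
  by (simp add: l1_sub_def l1_smult_def)

lemma unorm_sub_commute: "a \<in> l1 \<Longrightarrow> b \<in> l1 \<Longrightarrow> unrm (l1_sub a b) = unrm (l1_sub b a)"
  by (subst l1_sub_commute) (simp add: unorm_smult l1_sub)

lemma unorm_sub_trans:
  assumes "a \<in> l1" "b \<in> l1" "c \<in> l1"
  shows "unrm (l1_sub a c) \<le> unrm (l1_sub a b) + unrm (l1_sub b c)"
proof -
  have "l1_sub a c = l1_add (l1_sub a b) (l1_sub b c)" by (simp add: l1_sub_def l1_add_def algebra_simps)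
  then show ?thesis using unorm_add[OF l1_sub l1_sub] assms by metis
qed

lemma unorm_le_sub:
  assumes "a \<in> l1" "b \<in> l1"
  shows "unrm a \<le> unrm b + unrm (l1_sub a b)"
proof -
  have "a = l1_add b (l1_sub a b)" by (simp add: l1_sub_def l1_add_def algebra_simps)
  then show ?thesis using unorm_add[OF assms(2) l1_sub[OF assms]] by simp
qed

lemma unorm_abs_diff:
  assumes "a \<in> l1" "b \<in> l1"
  shows "\<bar>unrm a - unrm b\<bar> \<le> unrm (l1_sub a b)"
  using unorm_le_sub[OF assms] unorm_le_sub[OF assms(2,1)] unorm_sub_commute[OF assms] by simp

lemma zero_in_l1 [simp]: "(\<lambda>k (x::'a). 0) \<in> l1"
  by (rule l1I[where M = "\<lambda>_. 0"]) (auto simp: CX_intros)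

lemma unorm_zero [simp]: "unrm (\<lambda>k x. 0) = 0"
  using unorm_smult[OF zero_in_l1, of 0] by (simp add: l1_smult_def)

lemma l1_sub_self [simp]: "l1_sub a a = (\<lambda>k x. 0)"
  by (simp add: l1_sub_def)

lemma unorm_mult_sub:
  assumes "a \<in> l1" "b \<in> l1" "c \<in> l1" "d \<in> l1"
  shows "unrm (l1_sub (mul1 a b) (mul1 c d))
    \<le> unrm a * unrm (l1_sub b d) + unrm (l1_sub a c) * unrm d"
proof -
  have "l1_sub (mul1 a b) (mul1 c d) =
      l1_add (mul1 a (l1_sub b d)) (mul1 (l1_sub a c) d)"
    using assms unfolding l1_sub_eq
    by (simp add: l1_mult_add_left l1_mult_add_right l1_smult l1_mult_smult_left l1_mult_smult_right)
      (simp add: l1_add_def l1_smult_def)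
  then show ?thesis
    using assms unorm_add[OF l1_mult l1_mult, of a "l1_sub b d" "l1_sub a c" d]
      unorm_mult[of a "l1_sub b d"] unorm_mult[of "l1_sub a c" d] l1_sub by fastforce
qed

section \<open>Cauchy sequences and their classes\<close>

lemma cs_cauchyD: "cauchy s \<Longrightarrow> s n \<in> l1"
  by (simp add: cs_cauchy_def)

lemma cs_cauchy_const: "a \<in> l1 \<Longrightarrow> cauchy (\<lambda>n. a)"
  by (simp add: cs_cauchy_def)

lemma cs_cauchy_norm:
  assumes s: "cauchy s"
  shows "convergent (\<lambda>n. unrm (s n))"
proof (rule real_Cauchy_convergent, rule metric_CauchyI)
  fix e :: real assume "e > 0"
  then obtain N where "\<forall>m\<ge>N. \<forall>n\<ge>N. unrm (l1_sub (s m) (s n)) < e"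
    using s unfolding cs_cauchy_def by blast
  then show "\<exists>N. \<forall>m\<ge>N. \<forall>n\<ge>N. dist (unrm (s m)) (unrm (s n)) < e"
    unfolding dist_real_def using unorm_abs_diff cs_cauchyD[OF s] by (meson le_less_trans)
qed

lemma cs_cauchy_bounded:
  assumes "cauchy s"
  shows "\<exists>K>0. \<forall>n. unrm (s n) \<le> K"
proof -
  have "Bseq (\<lambda>n. unrm (s n))" using cs_cauchy_norm[OF assms] by (rule convergent_imp_Bseq)
  then obtain K where "K > 0" "\<forall>n. norm (unrm (s n)) \<le> K" by (auto elim: BseqE)
  then show ?thesis by (intro exI[of _ K]) (auto dest: spec intro: order_trans[OF abs_ge_self])
qed

definition null_diff :: "(nat \<Rightarrow> 'a l1elt) \<Rightarrow> (nat \<Rightarrow> 'a l1elt) \<Rightarrow> bool" where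
  "null_diff s t \<longleftrightarrow> (\<lambda>n. unrm (l1_sub (s n) (t n))) \<longlonglongrightarrow> 0"

lemma null_diffI:
  assumes "f \<longlonglongrightarrow> 0" "\<And>n. unrm (l1_sub (s n) (t n)) \<le> f n" "\<And>n. s n \<in> l1" "\<And>n. t n \<in> l1"
  shows "null_diff s t"
  unfolding null_diff_def
  by (rule tendsto_sandwich[OF _ _ tendsto_const assms(1)]) (use assms l1_sub in auto)

lemma null_diff_sym:
  assumes "null_diff s t" "\<And>n. s n \<in> l1" "\<And>n. t n \<in> l1"
  shows "null_diff t s"
  using assms unorm_sub_commute unfolding null_diff_def by simp

lemma null_diff_trans:
  assumes "null_diff s t" "null_diff t u" "\<And>n. s n \<in> l1" "\<And>n. t n \<in> l1" "\<And>n. u n \<in> l1"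
  shows "null_diff s u"
proof (rule null_diffI)
  show "(\<lambda>n. unrm (l1_sub (s n) (t n)) + unrm (l1_sub (t n) (u n))) \<longlonglongrightarrow> 0"
    using tendsto_add[OF assms(1,2)[unfolded null_diff_def]] by simp
qed (use assms unorm_sub_trans in auto)

lemma cs_cls_eq_iff:
  assumes "cauchy s" "cauchy t"
  shows "cls s = cls t \<longleftrightarrow> null_diff s t"
proof
  assume eq: "cls s = cls t"
  have "t \<in> cls s" unfolding eq using assms by (simp add: cs_cls_def)
  then show "null_diff s t" by (simp add: cs_cls_def null_diff_def)
next
  assume st: "null_diff s t"
  have "null_diff s u \<longleftrightarrow> null_diff t u" if u: "cauchy u" for u
  proof -
    note l = cs_cauchyD[OF u] cs_cauchyD[OF assms(1)] cs_cauchyD[OF assms(2)]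
    have ts: "null_diff t s" by (rule null_diff_sym[OF st]) (fact l)+
    show ?thesis
    proof
      assume "null_diff s u"
      then show "null_diff t u" by (rule null_diff_trans[OF ts]) (fact l)+
    next
      assume "null_diff t u"
      then show "null_diff s u" by (rule null_diff_trans[OF st]) (fact l)+
    qed
  qed
  then show "cls s = cls t" unfolding cs_cls_def null_diff_def by blast
qed

lemma rep_cs_cls:
  assumes "cauchy s"
  shows "cauchy (rep (cls s))" "null_diff s (rep (cls s))"
proof -
  have "s \<in> cls s" using assms by (simp add: cs_cls_def)
  then have "rep (cls s) \<in> cls s" unfolding rep_def by (rule someI[where P = "\<lambda>u. u \<in> cls s"])
  then show "cauchy (rep (cls s))" "null_diff s (rep (cls s))"
    by (auto simp: cs_cls_def null_diff_def)
qed

lemma cs_cls_in_Cstar: "cauchy s \<Longrightarrow> cls s \<in> Cstar \<sigma>"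
  by (auto simp: Cstar_def)

lemma CstarE:
  assumes "A \<in> Cstar \<sigma>"
  obtains s where "cauchy s" "A = cls s"
  using assms by (auto simp: Cstar_def)

lemma cs_cauchy_map:
  assumes s: "cauchy s" and F: "\<And>a. a \<in> l1 \<Longrightarrow> F a \<in> l1"
    "\<And>a b. a \<in> l1 \<Longrightarrow> b \<in> l1 \<Longrightarrow> unrm (l1_sub (F a) (F b)) \<le> K * unrm (l1_sub a b)"
  shows "cauchy (\<lambda>n. F (s n))"
  unfolding cs_cauchy_def
proof (intro conjI allI impI)
  fix e :: real assume e: "e > 0"
  \<comment> \<open>The constant K may be 0 or negative; the maximum with 1 allows division by
    it.\<close>
  define K' where "K' = max K 1"
  have K': "K' > 0" "K \<le> K'" by (auto simp: K'_def)
  obtain N where N: "\<forall>m\<ge>N. \<forall>n\<ge>N. unrm (l1_sub (s m) (s n)) < e / K'"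
    using s e K' unfolding cs_cauchy_def by (meson divide_pos_pos)
  have "unrm (l1_sub (F (s m)) (F (s n))) < e" if "m \<ge> N" "n \<ge> N" for m n
  proof -
    have "unrm (l1_sub (F (s m)) (F (s n))) \<le> K * unrm (l1_sub (s m) (s n))"
      using F(2) cs_cauchyD[OF s] by blast
    also have "\<dots> \<le> K' * unrm (l1_sub (s m) (s n))"
      using K' cs_cauchyD[OF s] l1_sub by (intro mult_right_mono) auto
    also have "\<dots> < e" using N that K' by (simp add: field_simps)
    finally show ?thesis .
  qed
  then show "\<exists>N. \<forall>m\<ge>N. \<forall>n\<ge>N. unrm (l1_sub (F (s m)) (F (s n))) < e" by blast
qed (use s F cs_cauchyD in blast)

text \<open>Operations on classes are defined through a chosen representative; Lipschitz dependence
  makes the choice immaterial.\<close>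

lemma cs_cls_map:
  assumes s: "cauchy s" and F: "\<And>a. a \<in> l1 \<Longrightarrow> F a \<in> l1"
    "\<And>a b. a \<in> l1 \<Longrightarrow> b \<in> l1 \<Longrightarrow> unrm (l1_sub (F a) (F b)) \<le> K * unrm (l1_sub a b)"
  shows "cls (\<lambda>n. F (rep (cls s) n)) = cls (\<lambda>n. F (s n))"
proof -
  let ?r = "rep (cls s)"
  note r = rep_cs_cls[OF s]
  have "null_diff (\<lambda>n. F (s n)) (\<lambda>n. F (?r n))"
  proof (rule null_diffI)
    show "(\<lambda>n. K * unrm (l1_sub (s n) (?r n))) \<longlonglongrightarrow> 0"
      using tendsto_mult_left[OF r(2)[unfolded null_diff_def], of K] by simp
  qed (use F cs_cauchyD[OF s] cs_cauchyD[OF r(1)] in auto)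
  then show ?thesis
    using cs_cls_eq_iff cs_cauchy_map[OF s F] cs_cauchy_map[OF r(1) F] by metis
qed

lemma cs_cauchy_add:
  assumes s: "cauchy s" and t: "cauchy t"
  shows "cauchy (\<lambda>n. l1_add (s n) (t n))"
  unfolding cs_cauchy_def
proof (intro conjI allI impI)
  fix e :: real assume e: "e > 0"
  obtain N where N: "\<forall>m\<ge>N. \<forall>n\<ge>N. unrm (l1_sub (s m) (s n)) < e / 2"
    using s e unfolding cs_cauchy_def by (meson half_gt_zero)
  obtain M where M: "\<forall>m\<ge>M. \<forall>n\<ge>M. unrm (l1_sub (t m) (t n)) < e / 2"
    using t e unfolding cs_cauchy_def by (meson half_gt_zero)
  have "unrm (l1_sub (l1_add (s m) (t m)) (l1_add (s n) (t n))) < e" if "m \<ge> max N M" "n \<ge> max N M" for m n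
  proof -
    have eq: "l1_sub (l1_add (s m) (t m)) (l1_add (s n) (t n)) = l1_add (l1_sub (s m) (s n)) (l1_sub (t m) (t n))"
      by (simp add: l1_sub_def l1_add_def algebra_simps)
    have "unrm (l1_sub (s m) (s n)) < e / 2" "unrm (l1_sub (t m) (t n)) < e / 2"
      using N M that by auto
    then show ?thesis unfolding eq
      using unorm_add[OF l1_sub l1_sub, of "s m" "s n" "t m" "t n"] cs_cauchyD[OF s] cs_cauchyD[OF t] by auto
  qed
  then show "\<exists>N. \<forall>m\<ge>N. \<forall>n\<ge>N. unrm (l1_sub (l1_add (s m) (t m)) (l1_add (s n) (t n))) < e" by blast
qed (use s t cs_cauchyD l1_add in blast)

lemma cs_cauchy_mult:
  assumes s: "cauchy s" and t: "cauchy t"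
  shows "cauchy (\<lambda>n. mul1 (s n) (t n))"
  unfolding cs_cauchy_def
proof (intro conjI allI impI)
  fix e :: real assume e: "e > 0"
  obtain K where K: "K > 0" "\<And>n. unrm (s n) \<le> K" using cs_cauchy_bounded[OF s] by blast
  obtain L where L: "L > 0" "\<And>n. unrm (t n) \<le> L" using cs_cauchy_bounded[OF t] by blast
  obtain N where N: "\<forall>m\<ge>N. \<forall>n\<ge>N. unrm (l1_sub (s m) (s n)) < e / (2 * L)"
    using s e L unfolding cs_cauchy_def by (meson divide_pos_pos mult_pos_pos zero_less_numeral)
  obtain M where M: "\<forall>m\<ge>M. \<forall>n\<ge>M. unrm (l1_sub (t m) (t n)) < e / (2 * K)"
    using t e K unfolding cs_cauchy_def by (meson divide_pos_pos mult_pos_pos zero_less_numeral)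
  have "unrm (l1_sub (mul1 (s m) (t m)) (mul1 (s n) (t n))) < e"
    if "m \<ge> max N M" "n \<ge> max N M" for m n
  proof -
    have "unrm (l1_sub (mul1 (s m) (t m)) (mul1 (s n) (t n)))
      \<le> unrm (s m) * unrm (l1_sub (t m) (t n)) + unrm (l1_sub (s m) (s n)) * unrm (t n)"
      using cs_cauchyD[OF s] cs_cauchyD[OF t] by (intro unorm_mult_sub) auto
    also have "\<dots> \<le> K * unrm (l1_sub (t m) (t n)) + unrm (l1_sub (s m) (s n)) * L"
      using K L cs_cauchyD[OF s] cs_cauchyD[OF t] l1_sub by (intro add_mono mult_mono) auto
    also have "\<dots> < K * (e / (2 * K)) + e / (2 * L) * L"
      using K L N M that by (intro add_strict_mono mult_strict_left_mono mult_strict_right_mono) auto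
    also have "\<dots> = e" using K L by (simp add: field_simps)
    finally show ?thesis .
  qed
  then show "\<exists>N. \<forall>m\<ge>N. \<forall>n\<ge>N. unrm (l1_sub (mul1 (s m) (t m)) (mul1 (s n) (t n))) < e" by blast
qed (use s t cs_cauchyD l1_mult in blast)

lemma cs_add_cls:
  assumes s: "cauchy s" and t: "cauchy t"
  shows "csadd (cls s) (cls t) = cls (\<lambda>n. l1_add (s n) (t n))"
proof -
  let ?s = "rep (cls s)" and ?t = "rep (cls t)"
  note rs = rep_cs_cls[OF s] and rt = rep_cs_cls[OF t]
  have "null_diff (\<lambda>n. l1_add (s n) (t n)) (\<lambda>n. l1_add (?s n) (?t n))"
  proof (rule null_diffI)
    show "(\<lambda>n. unrm (l1_sub (s n) (?s n)) + unrm (l1_sub (t n) (?t n))) \<longlonglongrightarrow> 0"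
      using tendsto_add[OF rs(2)[unfolded null_diff_def] rt(2)[unfolded null_diff_def]] by simp
    have "l1_sub (l1_add (s n) (t n)) (l1_add (?s n) (?t n)) = l1_add (l1_sub (s n) (?s n)) (l1_sub (t n) (?t n))" for n
      by (simp add: l1_sub_def l1_add_def algebra_simps)
    then show "unrm (l1_sub (l1_add (s n) (t n)) (l1_add (?s n) (?t n)))
        \<le> unrm (l1_sub (s n) (?s n)) + unrm (l1_sub (t n) (?t n))" for n
      using unorm_add[OF l1_sub l1_sub] cs_cauchyD s t rs(1) rt(1) by metis
  qed (use cs_cauchyD s t rs(1) rt(1) l1_add in blast)+
  then show ?thesis unfolding cs_add_def
    using cs_cls_eq_iff cs_cauchy_add[OF s t] cs_cauchy_add[OF rs(1) rt(1)] by metis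
qed

lemma cs_mult_cls:
  assumes s: "cauchy s" and t: "cauchy t"
  shows "csmul (cls s) (cls t) = cls (\<lambda>n. mul1 (s n) (t n))"
proof -
  let ?s = "rep (cls s)" and ?t = "rep (cls t)"
  note rs = rep_cs_cls[OF s] and rt = rep_cs_cls[OF t]
  obtain K where K: "K > 0" "\<And>n. unrm (s n) \<le> K" using cs_cauchy_bounded[OF s] by blast
  obtain L where L: "L > 0" "\<And>n. unrm (?t n) \<le> L" using cs_cauchy_bounded[OF rt(1)] by blast
  have "null_diff (\<lambda>n. mul1 (s n) (t n)) (\<lambda>n. mul1 (?s n) (?t n))"
  proof (rule null_diffI)
    show "(\<lambda>n. K * unrm (l1_sub (t n) (?t n)) + unrm (l1_sub (s n) (?s n)) * L) \<longlonglongrightarrow> 0"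
      using rs(2) rt(2) unfolding null_diff_def by (auto intro!: tendsto_eq_intros)
    fix n
    have "unrm (l1_sub (mul1 (s n) (t n)) (mul1 (?s n) (?t n)))
      \<le> unrm (s n) * unrm (l1_sub (t n) (?t n)) + unrm (l1_sub (s n) (?s n)) * unrm (?t n)"
      using cs_cauchyD s t rs(1) rt(1) by (intro unorm_mult_sub) auto
    also have "\<dots> \<le> K * unrm (l1_sub (t n) (?t n)) + unrm (l1_sub (s n) (?s n)) * L"
      using K L cs_cauchyD s t rs(1) rt(1) l1_sub by (intro add_mono mult_mono) auto
    finally show "unrm (l1_sub (mul1 (s n) (t n)) (mul1 (?s n) (?t n)))
      \<le> K * unrm (l1_sub (t n) (?t n)) + unrm (l1_sub (s n) (?s n)) * L" .
  qed (use cs_cauchyD s t rs(1) rt(1) l1_mult in blast)+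
  then show ?thesis unfolding cs_mult_def
    using cs_cls_eq_iff cs_cauchy_mult[OF s t] cs_cauchy_mult[OF rs(1) rt(1)] by metis
qed

lemma smult_Lipschitz:
  assumes ab: "a \<in> l1" "b \<in> l1"
  shows "unrm (l1_sub (l1_smult c a) (l1_smult c b)) \<le> cmod c * unrm (l1_sub a b)"
proof -
  have "l1_sub (l1_smult c a) (l1_smult c b) = l1_smult c (l1_sub a b)"
    by (simp add: l1_sub_def l1_smult_def algebra_simps)
  then show ?thesis using unorm_smult_le[OF l1_sub[OF ab]] by simp
qed

lemma star_Lipschitz:
  assumes "a \<in> l1" "b \<in> l1"
  shows "unrm (l1_sub (star1 a) (star1 b)) \<le> 1 * unrm (l1_sub a b)"
  using unorm_star[OF l1_sub[OF assms]] by (simp add: l1_star_sub)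

lemma cs_cauchy_smult: "cauchy s \<Longrightarrow> cauchy (\<lambda>n. l1_smult c (s n))"
  by (rule cs_cauchy_map[where F = "l1_smult c", OF _ l1_smult smult_Lipschitz])

lemma cs_cauchy_star: "cauchy s \<Longrightarrow> cauchy (\<lambda>n. star1 (s n))"
  by (rule cs_cauchy_map[where F = "star1", OF _ l1_star star_Lipschitz])

lemma cs_smult_cls:
  "cauchy s \<Longrightarrow> cssmul c (cls s) = cls (\<lambda>n. l1_smult c (s n))"
  unfolding cs_smult_def by (rule cs_cls_map[where F = "l1_smult c", OF _ l1_smult smult_Lipschitz])

lemma cs_star_cls:
  "cauchy s \<Longrightarrow> csstar (cls s) = cls (\<lambda>n. star1 (s n))"
  unfolding cs_star_def by (rule cs_cls_map[where F = "star1", OF _ l1_star star_Lipschitz])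

lemma cs_norm_cls:
  assumes s: "cauchy s"
  shows "(\<lambda>n. unrm (s n)) \<longlonglongrightarrow> csnorm (cls s)"
proof -
  let ?r = "rep (cls s)"
  note r = rep_cs_cls[OF s]
  have r1: "(\<lambda>n. unrm (?r n)) \<longlonglongrightarrow> csnorm (cls s)"
    unfolding cs_norm_def using cs_cauchy_norm[OF r(1)] by (simp add: convergent_LIMSEQ_iff)
  have "(\<lambda>n. unrm (s n) - unrm (?r n)) \<longlonglongrightarrow> 0"
    by (rule Lim_null_comparison[OF _ r(2)[unfolded null_diff_def]])
      (use unorm_abs_diff cs_cauchyD[OF s] cs_cauchyD[OF r(1)] in auto)
  then show ?thesis using tendsto_add[OF r1] by fastforce
qed

end

context dynamical_system
begin

section \<open>The completion as a C*-algebra\<close>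

abbreviation Cs :: "'a cselt set" where "Cs \<equiv> Cstar \<sigma>"

lemma cs_add_closed: "A \<in> Cs \<Longrightarrow> B \<in> Cs \<Longrightarrow> csadd A B \<in> Cs"
  by (elim CstarE) (simp add: cs_add_cls cs_cauchy_add cs_cls_in_Cstar)

lemma cs_mult_closed: "A \<in> Cs \<Longrightarrow> B \<in> Cs \<Longrightarrow> csmul A B \<in> Cs"
  by (elim CstarE) (simp add: cs_mult_cls cs_cauchy_mult cs_cls_in_Cstar)

lemma cs_smult_closed: "A \<in> Cs \<Longrightarrow> cssmul c A \<in> Cs"
  by (elim CstarE) (simp add: cs_smult_cls cs_cauchy_smult cs_cls_in_Cstar)

lemma cs_star_closed: "A \<in> Cs \<Longrightarrow> csstar A \<in> Cs"
  by (elim CstarE) (simp add: cs_star_cls cs_cauchy_star cs_cls_in_Cstar)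

lemma emb_closed: "a \<in> l1 \<Longrightarrow> emb \<sigma> a \<in> Cs"
  unfolding emb_def by (simp add: cs_cauchy_const cs_cls_in_Cstar)

lemma cs_zero_eq: "cs_zero \<sigma> = cls (\<lambda>n k x. 0)"
  by (simp add: cs_zero_def emb_def)

lemma cs_cauchy_zero: "cauchy (\<lambda>n k x. 0)"
  by (rule cs_cauchy_const) simp

lemma emb_add: "a \<in> l1 \<Longrightarrow> b \<in> l1 \<Longrightarrow> emb \<sigma> (l1_add a b) = csadd (emb \<sigma> a) (emb \<sigma> b)"
  by (simp add: emb_def cs_add_cls cs_cauchy_const)

lemma emb_mult: "a \<in> l1 \<Longrightarrow> b \<in> l1 \<Longrightarrow> emb \<sigma> (mul1 a b) = csmul (emb \<sigma> a) (emb \<sigma> b)"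
  by (simp add: emb_def cs_mult_cls cs_cauchy_const)

lemma emb_smult: "a \<in> l1 \<Longrightarrow> emb \<sigma> (l1_smult c a) = cssmul c (emb \<sigma> a)"
  by (simp add: emb_def cs_smult_cls cs_cauchy_const)

lemma cs_norm_emb: "a \<in> l1 \<Longrightarrow> csnorm (emb \<sigma> a) = unrm a"
  using cs_norm_cls[OF cs_cauchy_const, of a] by (simp add: emb_def LIMSEQ_const_iff)

definition cs_one :: "'a cselt" where "cs_one = emb \<sigma> (cx (\<lambda>x. 1))"

lemma cx_one_in_l1: "cx (\<lambda>x::'a. 1) \<in> l1"
  by (simp add: cx_in_l1 CX_intros)

lemma cs_one_closed: "cs_one \<in> Cs"
  unfolding cs_one_def by (rule emb_closed[OF cx_one_in_l1])

lemma cs_diff_cls: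
  assumes "cauchy s" "cauchy t"
  shows "csadd (cls s) (cssmul (- 1) (cls t)) = cls (\<lambda>n. l1_sub (s n) (t n))"
    and "cauchy (\<lambda>n. l1_sub (s n) (t n))"
  using assms by (simp_all add: cs_smult_cls cs_add_cls cs_cauchy_smult cs_cauchy_add l1_sub_eq)

text \<open>The difference is spelled with the scalar -1, as in the completeness axiom of
  \<open>cstar_algebra\<close>, so that it is available before the ring structure is
  established.\<close>

definition cs_dist :: "'a cselt \<Rightarrow> 'a cselt \<Rightarrow> real" where
  "cs_dist A B = csnorm (csadd A (cssmul (- 1) B))"

lemma cs_dist_cls:
  assumes "cauchy s" "cauchy t"
  shows "(\<lambda>n. unrm (l1_sub (s n) (t n))) \<longlonglongrightarrow> cs_dist (cls s) (cls t)"
  unfolding cs_dist_def cs_diff_cls(1)[OF assms] by (rule cs_norm_cls[OF cs_diff_cls(2)[OF assms]])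

lemma cs_norm_triangle:
  assumes "A \<in> Cs" "B \<in> Cs"
  shows "csnorm (csadd A B) \<le> csnorm A + csnorm B"
proof -
  obtain s t where s: "cauchy s" "A = cls s" and t: "cauchy t" "B = cls t"
    using assms by (meson CstarE)
  have "(\<lambda>n. unrm (l1_add (s n) (t n))) \<longlonglongrightarrow> csnorm (csadd A B)"
    using cs_norm_cls[OF cs_cauchy_add[OF s(1) t(1)]] s t by (simp add: cs_add_cls)
  moreover have "(\<lambda>n. unrm (s n) + unrm (t n)) \<longlonglongrightarrow> csnorm A + csnorm B"
    unfolding s(2) t(2) by (intro tendsto_add cs_norm_cls s t)
  ultimately show ?thesis
    by (rule LIMSEQ_le) (use unorm_add cs_cauchyD[OF s(1)] cs_cauchyD[OF t(1)] in blast)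
qed

lemma cs_norm_mult:
  assumes "A \<in> Cs" "B \<in> Cs"
  shows "csnorm (csmul A B) \<le> csnorm A * csnorm B"
proof -
  obtain s t where s: "cauchy s" "A = cls s" and t: "cauchy t" "B = cls t"
    using assms by (meson CstarE)
  have "(\<lambda>n. unrm (mul1 (s n) (t n))) \<longlonglongrightarrow> csnorm (csmul A B)"
    using cs_norm_cls[OF cs_cauchy_mult[OF s(1) t(1)]] s t by (simp add: cs_mult_cls)
  moreover have "(\<lambda>n. unrm (s n) * unrm (t n)) \<longlonglongrightarrow> csnorm A * csnorm B"
    unfolding s(2) t(2) by (intro tendsto_mult cs_norm_cls s t)
  ultimately show ?thesis
    by (rule LIMSEQ_le) (use unorm_mult cs_cauchyD[OF s(1)] cs_cauchyD[OF t(1)] in blast)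
qed

lemma cs_norm_smult:
  assumes "A \<in> Cs"
  shows "csnorm (cssmul c A) = cmod c * csnorm A"
proof -
  obtain s where s: "cauchy s" "A = cls s" using assms by (meson CstarE)
  have "(\<lambda>n. unrm (l1_smult c (s n))) \<longlonglongrightarrow> csnorm (cssmul c A)"
    using cs_norm_cls[OF cs_cauchy_smult[OF s(1)]] s by (simp add: cs_smult_cls)
  moreover have "(\<lambda>n. cmod c * unrm (s n)) \<longlonglongrightarrow> cmod c * csnorm A"
    unfolding s(2) by (intro tendsto_mult_left cs_norm_cls s)
  ultimately show ?thesis
    using unorm_smult[OF cs_cauchyD[OF s(1)]] LIMSEQ_unique by auto
qed

lemma cs_norm_star_mult:
  assumes "A \<in> Cs"
  shows "csnorm (csmul (csstar A) A) = (csnorm A)\<^sup>2"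
proof -
  obtain s where s: "cauchy s" "A = cls s" using assms by (meson CstarE)
  have "(\<lambda>n. unrm (mul1 (star1 (s n)) (s n))) \<longlonglongrightarrow> csnorm (csmul (csstar A) A)"
    using cs_norm_cls[OF cs_cauchy_mult[OF cs_cauchy_star[OF s(1)] s(1)]] s
    by (simp add: cs_mult_cls cs_star_cls cs_cauchy_star)
  moreover have "(\<lambda>n. (unrm (s n))\<^sup>2) \<longlonglongrightarrow> (csnorm A)\<^sup>2"
    unfolding s(2) by (intro tendsto_power cs_norm_cls s)
  ultimately show ?thesis
    using unorm_cstar[OF cs_cauchyD[OF s(1)]] LIMSEQ_unique by auto
qed

lemma cs_norm_nonneg:
  assumes "A \<in> Cs"
  shows "0 \<le> csnorm A"
proof -
  obtain s where s: "cauchy s" "A = cls s" using assms by (meson CstarE)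
  show ?thesis unfolding s(2)
    by (rule LIMSEQ_le_const[OF cs_norm_cls[OF s(1)]]) (use cs_cauchyD[OF s(1)] in auto)
qed

lemma cs_norm_zeroD:
  assumes "A \<in> Cs" "csnorm A = 0"
  shows "A = cs_zero \<sigma>"
proof -
  obtain s where s: "cauchy s" "A = cls s" using assms by (meson CstarE)
  have "null_diff s (\<lambda>n k x. 0)"
    using cs_norm_cls[OF s(1)] assms s by (simp add: null_diff_def l1_sub_def)
  then show ?thesis unfolding s(2) cs_zero_eq using cs_cls_eq_iff[OF s(1) cs_cauchy_zero] by simp
qed

lemma cs_dist_trans:
  assumes "A \<in> Cs" "B \<in> Cs" "C \<in> Cs"
  shows "cs_dist A C \<le> cs_dist A B + cs_dist B C"
proof -
  obtain s t u where s: "cauchy s" "A = cls s" and t: "cauchy t" "B = cls t"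
    and u: "cauchy u" "C = cls u"
    using assms by (meson CstarE)
  show ?thesis unfolding s(2) t(2) u(2)
    by (rule LIMSEQ_le[OF cs_dist_cls[OF s(1) u(1)] tendsto_add[OF cs_dist_cls[OF s(1) t(1)] cs_dist_cls[OF t(1) u(1)]]])
      (use unorm_sub_trans cs_cauchyD[OF s(1)] cs_cauchyD[OF t(1)] cs_cauchyD[OF u(1)] in blast)
qed

lemma cs_dist_commute:
  assumes "A \<in> Cs" "B \<in> Cs"
  shows "cs_dist A B = cs_dist B A"
proof -
  obtain s t where s: "cauchy s" "A = cls s" and t: "cauchy t" "B = cls t"
    using assms by (meson CstarE)
  have "(\<lambda>n. unrm (l1_sub (s n) (t n))) = (\<lambda>n. unrm (l1_sub (t n) (s n)))"
    using unorm_sub_commute cs_cauchyD[OF s(1)] cs_cauchyD[OF t(1)] by blast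
  then show ?thesis unfolding s(2) t(2)
    using cs_dist_cls[OF s(1) t(1)] cs_dist_cls[OF t(1) s(1)] LIMSEQ_unique by metis
qed

lemma cs_dist_emb: "a \<in> l1 \<Longrightarrow> b \<in> l1 \<Longrightarrow> cs_dist (emb \<sigma> a) (emb \<sigma> b) = unrm (l1_sub a b)"
  using cs_dist_cls[OF cs_cauchy_const cs_cauchy_const, of a b] by (simp add: emb_def LIMSEQ_const_iff)

lemma cs_dist_nonneg: "A \<in> Cs \<Longrightarrow> B \<in> Cs \<Longrightarrow> 0 \<le> cs_dist A B"
  unfolding cs_dist_def by (intro cs_norm_nonneg cs_add_closed cs_smult_closed)

lemma l1_dense:
  assumes "A \<in> Cs" "e > 0"
  shows "\<exists>a\<in>l1. cs_dist A (emb \<sigma> a) < e"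
proof -
  obtain s where s: "cauchy s" "A = cls s" using assms by (meson CstarE)
  obtain N where N: "\<forall>m\<ge>N. \<forall>n\<ge>N. unrm (l1_sub (s m) (s n)) < e / 2"
    using s(1) assms(2) unfolding cs_cauchy_def by (meson half_gt_zero)
  have "cs_dist A (emb \<sigma> (s N)) \<le> e / 2"
    unfolding s(2) emb_def
    by (rule LIMSEQ_le_const2[OF cs_dist_cls[OF s(1) cs_cauchy_const[OF cs_cauchyD[OF s(1)]]]])
      (use N in \<open>auto intro!: exI[of _ N] less_imp_le\<close>)
  then show ?thesis using cs_cauchyD[OF s(1)] assms(2) by (intro bexI[of _ "s N"]) auto
qed

lemma cs_dist_emb_lim:
  assumes s: "cauchy s"
  shows "(\<lambda>n. cs_dist (emb \<sigma> (s n)) (cls s)) \<longlonglongrightarrow> 0"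
proof (rule LIMSEQ_I)
  fix e :: real assume e: "e > 0"
  obtain N where N: "\<forall>m\<ge>N. \<forall>n\<ge>N. unrm (l1_sub (s m) (s n)) < e / 2"
    using s e unfolding cs_cauchy_def by (meson half_gt_zero)
  have "cs_dist (emb \<sigma> (s n)) (cls s) \<le> e / 2" if "n \<ge> N" for n
    unfolding emb_def
    by (rule LIMSEQ_le_const2[OF cs_dist_cls[OF cs_cauchy_const[OF cs_cauchyD[OF s]] s]])
      (use N that in \<open>auto intro!: exI[of _ N] less_imp_le\<close>)
  moreover have "0 \<le> cs_dist (emb \<sigma> (s n)) (cls s)" for n
    using cs_cauchyD[OF s] cs_cls_in_Cstar[OF s] by (intro cs_dist_nonneg emb_closed)
  ultimately show "\<exists>no. \<forall>n\<ge>no. norm (cs_dist (emb \<sigma> (s n)) (cls s) - 0) < e"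
    using e by (intro exI[of _ N]) fastforce
qed

text \<open>The n-th term is approximated by an element of l1 within 1 / (n + 1); the approximants
  form a Cauchy sequence, and its class is the limit.\<close>

lemma cs_complete:
  assumes S: "\<And>n. S n \<in> Cs" and C: "\<forall>e>0. \<exists>N. \<forall>m\<ge>N. \<forall>n\<ge>N. cs_dist (S m) (S n) < e"
  shows "\<exists>L\<in>Cs. (\<lambda>n. cs_dist (S n) L) \<longlonglongrightarrow> 0"
proof -
  have "\<forall>n. \<exists>a\<in>l1. cs_dist (S n) (emb \<sigma> a) < 1 / real (Suc n)"
    using l1_dense S by simp
  then obtain b where b: "\<And>n. b n \<in> l1" "\<And>n. cs_dist (S n) (emb \<sigma> (b n)) < 1 / real (Suc n)"
    by metis
  have eb: "emb \<sigma> (b n) \<in> Cs" for n using b emb_closed by simp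
  have lim: "(\<lambda>n. cs_dist (S n) (emb \<sigma> (b n))) \<longlonglongrightarrow> 0"
    by (rule tendsto_sandwich[OF _ _ tendsto_const LIMSEQ_inverse_real_of_nat])
      (use b cs_dist_nonneg[OF S eb] in \<open>auto intro!: always_eventually less_imp_le simp: inverse_eq_divide\<close>)
  have cb: "cauchy b"
    unfolding cs_cauchy_def
  proof (intro conjI allI impI)
    fix e :: real assume e: "e > 0"
    then obtain N where N: "\<forall>m\<ge>N. \<forall>n\<ge>N. cs_dist (S m) (S n) < e / 3" using C by (meson divide_pos_pos zero_less_numeral)
    obtain M where M: "\<And>n. n \<ge> M \<Longrightarrow> cs_dist (S n) (emb \<sigma> (b n)) < e / 3"
      using LIMSEQ_D[OF lim, of "e / 3"] e by fastforce
    have "unrm (l1_sub (b m) (b n)) < e" if "m \<ge> max N M" "n \<ge> max N M" for m n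
    proof -
      have "unrm (l1_sub (b m) (b n)) = cs_dist (emb \<sigma> (b m)) (emb \<sigma> (b n))"
        using b by (simp add: cs_dist_emb)
      also have "\<dots> \<le> cs_dist (emb \<sigma> (b m)) (S m) + (cs_dist (S m) (S n) + cs_dist (S n) (emb \<sigma> (b n)))"
        by (intro order_trans[OF cs_dist_trans[OF eb S[of m] eb]] add_left_mono cs_dist_trans S eb)
      also have "\<dots> < e / 3 + (e / 3 + e / 3)"
        using M[of m] M[of n] N that cs_dist_commute[OF eb S, of m m] by (intro add_strict_mono) auto
      finally show ?thesis by simp
    qed
    then show "\<exists>N. \<forall>m\<ge>N. \<forall>n\<ge>N. unrm (l1_sub (b m) (b n)) < e" by blast
  qed (use b in auto)
  have L: "cls b \<in> Cs" using cs_cls_in_Cstar[OF cb] .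
  have "(\<lambda>n. cs_dist (S n) (cls b)) \<longlonglongrightarrow> 0"
  proof (rule tendsto_sandwich[OF _ _ tendsto_const])
    show "(\<lambda>n. cs_dist (S n) (emb \<sigma> (b n)) + cs_dist (emb \<sigma> (b n)) (cls b)) \<longlonglongrightarrow> 0"
      using tendsto_add[OF lim cs_dist_emb_lim[OF cb]] by simp
  qed (use cs_dist_nonneg[OF S L] cs_dist_trans[OF S eb L] in auto)
  then show ?thesis using L by blast
qed

definition cs_ring :: "'a cselt ring" where
  "cs_ring = \<lparr>carrier = Cs, monoid.mult = csmul, one = cs_one, zero = cs_zero \<sigma>, add = csadd\<rparr>"

lemma cs_ring_simps [simp]:
  "carrier cs_ring = Cs" "monoid.mult cs_ring = csmul" "one cs_ring = cs_one"
  "zero cs_ring = cs_zero \<sigma>" "add cs_ring = csadd"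
  by (simp_all add: cs_ring_def)

lemma cs_add_comm: "A \<in> Cs \<Longrightarrow> B \<in> Cs \<Longrightarrow> csadd A B = csadd B A"
  by (elim CstarE) (simp add: cs_add_cls l1_add_def add.commute)

lemma cs_add_assoc: "A \<in> Cs \<Longrightarrow> B \<in> Cs \<Longrightarrow> C \<in> Cs \<Longrightarrow>
    csadd (csadd A B) C = csadd A (csadd B C)"
  by (elim CstarE) (simp add: cs_add_cls cs_cauchy_add, simp add: l1_add_def add.assoc)

lemma cs_zero_add: "A \<in> Cs \<Longrightarrow> csadd (cs_zero \<sigma>) A = A"
  by (elim CstarE) (simp add: cs_zero_eq cs_add_cls cs_cauchy_zero, simp add: l1_add_def)

lemma cs_neg_add: "A \<in> Cs \<Longrightarrow> csadd (cssmul (- 1) A) A = cs_zero \<sigma>"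
  by (elim CstarE) (simp add: cs_smult_cls cs_add_cls cs_cauchy_smult cs_zero_eq,
      simp add: l1_add_def l1_smult_def)

lemma cs_mult_assoc: "A \<in> Cs \<Longrightarrow> B \<in> Cs \<Longrightarrow> C \<in> Cs \<Longrightarrow>
    csmul (csmul A B) C = csmul A (csmul B C)"
  by (elim CstarE) (simp add: cs_mult_cls cs_cauchy_mult l1_mult_assoc cs_cauchyD)

lemma cs_one_cls: "cs_one = cls (\<lambda>n. cx (\<lambda>x. 1))" "cauchy (\<lambda>n. cx (\<lambda>x. 1))"
  by (simp_all add: cs_one_def emb_def cs_cauchy_const cx_one_in_l1)

lemma one_mult_l1: "mul1 (cx (\<lambda>x. 1)) a = a" "mul1 a (cx (\<lambda>x. 1)) = a"
  by (intro ext, simp add: cx_mult mult_cx)+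

lemma cs_one_mult: "A \<in> Cs \<Longrightarrow> csmul cs_one A = A" "A \<in> Cs \<Longrightarrow> csmul A cs_one = A"
  by (elim CstarE, simp add: cs_one_cls cs_mult_cls one_mult_l1)+

lemma cs_distrib_left: "A \<in> Cs \<Longrightarrow> B \<in> Cs \<Longrightarrow> C \<in> Cs \<Longrightarrow>
    csmul (csadd A B) C = csadd (csmul A C) (csmul B C)"
  by (elim CstarE) (simp add: cs_mult_cls cs_cauchy_mult cs_add_cls cs_cauchy_add l1_mult_add_left cs_cauchyD)

lemma cs_distrib_right: "A \<in> Cs \<Longrightarrow> B \<in> Cs \<Longrightarrow> C \<in> Cs \<Longrightarrow>
    csmul C (csadd A B) = csadd (csmul C A) (csmul C B)"
  by (elim CstarE) (simp add: cs_mult_cls cs_cauchy_mult cs_add_cls cs_cauchy_add l1_mult_add_right cs_cauchyD)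

lemma ring_cs_ring: "ring cs_ring"
proof (rule ringI)
  show "abelian_group cs_ring"
  proof (rule abelian_groupI, unfold cs_ring_simps)
    show "cs_zero \<sigma> \<in> Cs" by (simp add: cs_zero_def emb_closed)
    show "\<exists>B\<in>Cs. csadd B A = cs_zero \<sigma>" if "A \<in> Cs" for A
      using cs_neg_add[OF that] cs_smult_closed[OF that] by blast
    fix A B C
    assume A: "A \<in> Cs" and B: "B \<in> Cs"
    show "csadd A B \<in> Cs" using A B by (rule cs_add_closed)
    show "csadd A B = csadd B A" using A B by (rule cs_add_comm)
    show "csadd (cs_zero \<sigma>) A = A" using A by (rule cs_zero_add)
    assume C: "C \<in> Cs"
    show "csadd (csadd A B) C = csadd A (csadd B C)" using A B C by (rule cs_add_assoc)
  qed
  show "Group.monoid cs_ring"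
    by (rule monoidI) (simp_all add: cs_mult_closed cs_mult_assoc cs_one_mult cs_one_closed)
qed (auto simp: cs_distrib_left cs_distrib_right)

text \<open>From here on the abstract square roots and the positive cone are available in
  C*(Sigma).\<close>

sublocale cs: cstar_algebra cs_ring "cssmul" "csstar" "csnorm"
proof (intro cstar_algebra.intro ring_cs_ring cstar_algebra_axioms.intro, unfold cs_ring_simps)
  fix A B c d
  assume A: "A \<in> Cs"
  obtain s where s: "cauchy s" "A = cls s" using A by (meson CstarE)
  show "cssmul c A \<in> Cs" "csstar A \<in> Cs" "0 \<le> csnorm A"
    using A by (simp_all add: cs_smult_closed cs_star_closed cs_norm_nonneg)
  show "cssmul (c + d) A = csadd (cssmul c A) (cssmul d A)"
    using s by (simp add: cs_smult_cls cs_cauchy_smult cs_add_cls)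
      (simp add: l1_smult_def l1_add_def algebra_simps)
  show "cssmul c (cssmul d A) = cssmul (c * d) A" "cssmul 1 A = A"
    using s by (simp_all add: cs_smult_cls cs_cauchy_smult) (simp_all add: l1_smult_def mult.assoc)
  show "csstar (csstar A) = A"
    using s by (simp add: cs_star_cls cs_cauchy_star)
  show "csstar (cssmul c A) = cssmul (cnj c) (csstar A)"
    using s by (simp add: cs_smult_cls cs_star_cls cs_cauchy_smult cs_cauchy_star l1_star_smult)
  show "csnorm (cssmul c A) = cmod c * csnorm A" using A by (rule cs_norm_smult)
  show "csnorm (csmul (csstar A) A) = (csnorm A)\<^sup>2" using A by (rule cs_norm_star_mult)
  show "csnorm A = 0 \<Longrightarrow> A = cs_zero \<sigma>" using A by (rule cs_norm_zeroD)
  assume B: "B \<in> Cs"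
  obtain t where t: "cauchy t" "B = cls t" using B by (meson CstarE)
  show "cssmul c (csadd A B) = csadd (cssmul c A) (cssmul c B)"
    using s t by (simp add: cs_smult_cls cs_cauchy_smult cs_add_cls cs_cauchy_add)
      (simp add: l1_smult_def l1_add_def algebra_simps)
  show "csmul (cssmul c A) B = cssmul c (csmul A B)"
    using s t by (simp add: cs_smult_cls cs_cauchy_smult cs_mult_cls cs_cauchy_mult l1_mult_smult_left)
  show "csmul A (cssmul c B) = cssmul c (csmul A B)"
    using s t by (simp add: cs_smult_cls cs_cauchy_smult cs_mult_cls cs_cauchy_mult l1_mult_smult_right)
  show "csstar (csadd A B) = csadd (csstar A) (csstar B)"
    using s t by (simp add: cs_star_cls cs_cauchy_star cs_add_cls cs_cauchy_add l1_star_add)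
  show "csstar (csmul A B) = csmul (csstar B) (csstar A)"
    using s t by (simp add: cs_star_cls cs_cauchy_star cs_mult_cls cs_cauchy_mult l1_star_mult)
  show "csnorm (csadd A B) \<le> csnorm A + csnorm B" using A B by (rule cs_norm_triangle)
  show "csnorm (csmul A B) \<le> csnorm A * csnorm B" using A B by (rule cs_norm_mult)
next
  fix S :: "nat \<Rightarrow> 'a cselt"
  assume "\<And>n. S n \<in> Cs"
    "\<forall>e>0. \<exists>N. \<forall>m\<ge>N. \<forall>n\<ge>N. csnorm (csadd (S m) (cssmul (- 1) (S n))) < e"
  then show "\<exists>l\<in>Cs. (\<lambda>n. csnorm (csadd (S n) (cssmul (- 1) l))) \<longlonglongrightarrow> 0"
    using cs_complete[of S] unfolding cs_dist_def by blast
qed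

end

section \<open>The regular representation\<close>

lemma has_sum_norm_le:
  fixes f :: "'i \<Rightarrow> 'b::real_normed_vector"
  assumes "(f has_sum S) A" "\<And>L. finite L \<Longrightarrow> L \<subseteq> A \<Longrightarrow> norm (sum f L) \<le> C"
  shows "norm S \<le> C"
proof (rule tendsto_upperbound)
  show "((\<lambda>L. norm (sum f L)) \<longlongrightarrow> norm S) (finite_subsets_at_top A)"
    using assms(1) unfolding has_sum_def by (rule tendsto_norm)
  show "\<forall>\<^sub>F L in finite_subsets_at_top A. norm (sum f L) \<le> C"
    using assms(2) by (intro eventually_finite_subsets_at_top_weakI) auto
qed simp

lemma has_sum_finite_sum:
  fixes f :: "'i \<Rightarrow> 'j \<Rightarrow> 'b::real_normed_vector"
  assumes "finite F" "\<And>n. n \<in> F \<Longrightarrow> ((\<lambda>l. f n l) has_sum S n) A"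
  shows "((\<lambda>l. \<Sum>n\<in>F. f n l) has_sum (\<Sum>n\<in>F. S n)) A"
  using assms by (induction F) (auto intro: has_sum_add)

lemma cnj_mult_self: "cnj z * z = complex_of_real ((cmod z)\<^sup>2)"
  by (metis complex_norm_square mult.commute of_real_power)

lemma norm_sum_mult_le_L2_set:
  fixes u v :: "'i \<Rightarrow> complex"
  shows "cmod (\<Sum>l\<in>L. u l * v l) \<le> L2_set (\<lambda>l. cmod (u l)) L * L2_set (\<lambda>l. cmod (v l)) L"
proof -
  have "cmod (\<Sum>l\<in>L. u l * v l) \<le> (\<Sum>l\<in>L. \<bar>cmod (u l)\<bar> * \<bar>cmod (v l)\<bar>)"
    by (rule order_trans[OF norm_sum]) (simp add: norm_mult)
  also have "\<dots> \<le> L2_set (\<lambda>l. cmod (u l)) L * L2_set (\<lambda>l. cmod (v l)) L"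
    by (rule L2_set_mult_ineq)
  finally show ?thesis .
qed

context dynamical_system
begin

text \<open>The matrix of the regular representation of \<open>\<ell>\<^sup>1(\<Sigma>)\<close> on \<open>\<ell>\<^sup>2(\<int>)\<close> over the orbit of \<open>x\<close>; its operator norm is
  expressed through finitely supported vectors only.\<close>

definition orbit_mat :: "'a \<Rightarrow> 'a l1elt \<Rightarrow> int \<Rightarrow> int \<Rightarrow> complex" where
  "orbit_mat x a n m = a (n - m) (spow \<sigma> n x)"

definition orbit_form :: "'a \<Rightarrow> 'a l1elt \<Rightarrow> int set \<Rightarrow> int set \<Rightarrow> (int \<Rightarrow> complex) \<Rightarrow> (int \<Rightarrow> complex) \<Rightarrow> complex" where
  "orbit_form x a F G \<eta> \<xi> = (\<Sum>n\<in>F. \<Sum>m\<in>G. cnj (\<eta> n) * orbit_mat x a n m * \<xi> m)"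

abbreviation l2 :: "(int \<Rightarrow> complex) \<Rightarrow> int set \<Rightarrow> real" where
  "l2 \<xi> F \<equiv> L2_set (\<lambda>n. cmod (\<xi> n)) F"

definition orbit_norm :: "'a \<Rightarrow> 'a l1elt \<Rightarrow> real" where
  "orbit_norm x a = (SUP (F, G, \<eta>, \<xi>) \<in> {(F, G, \<eta>, \<xi>). finite F \<and> finite G \<and> l2 \<eta> F \<le> 1 \<and> l2 \<xi> G \<le> 1}.
     cmod (orbit_form x a F G \<eta> \<xi>))"

lemma l2_square: "(l2 \<xi> F)\<^sup>2 = (\<Sum>n\<in>F. (cmod (\<xi> n))\<^sup>2)"
  by (simp add: L2_set_def sum_nonneg)

lemma sum_supn_le:
  assumes a: "(a :: 'a l1elt) \<in> l1" and "inj_on g G" "finite G"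
  shows "(\<Sum>m\<in>G. supn (a (g m))) \<le> l1_norm a"
proof -
  have "(\<Sum>m\<in>G. supn (a (g m))) = (\<Sum>k\<in>g ` G. supn (a k))"
    using assms by (simp add: sum.reindex)
  also have "\<dots> \<le> l1_norm a"
    unfolding l1_norm_def by (rule finite_sum_le_infsum) (use assms in \<open>auto simp: l1D\<close>)
  finally show ?thesis .
qed

text \<open>Schur's test: the product of two vector entries is at most half the sum of their
  squares, after which each row sum and each column sum of the matrix is bounded by the l1
  norm.\<close>

lemma orbit_form_le_l1_norm:
  assumes a: "a \<in> l1" and fin: "finite F" "finite G" and le: "l2 \<eta> F \<le> 1" "l2 \<xi> G \<le> 1"
  shows "cmod (orbit_form x a F G \<eta> \<xi>) \<le> l1_norm a"
proof -
  let ?A = "\<lambda>k. supn (a k)"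
  have "cmod (orbit_form x a F G \<eta> \<xi>) \<le> (\<Sum>n\<in>F. \<Sum>m\<in>G. cmod (cnj (\<eta> n) * orbit_mat x a n m * \<xi> m))"
    unfolding orbit_form_def by (intro order_trans[OF norm_sum] sum_mono norm_sum)
  also have "\<dots> \<le> (\<Sum>n\<in>F. \<Sum>m\<in>G. (cmod (\<eta> n))\<^sup>2 / 2 * ?A (n - m) + (cmod (\<xi> m))\<^sup>2 / 2 * ?A (n - m))"
  proof (intro sum_mono)
    fix n m
    have "cmod (cnj (\<eta> n) * orbit_mat x a n m * \<xi> m) = (cmod (\<eta> n) * cmod (\<xi> m)) * cmod (orbit_mat x a n m)"
      by (simp add: norm_mult)
    also have "\<dots> \<le> ((cmod (\<eta> n))\<^sup>2 / 2 + (cmod (\<xi> m))\<^sup>2 / 2) * ?A (n - m)"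
    proof (intro mult_mono)
      show "cmod (\<eta> n) * cmod (\<xi> m) \<le> (cmod (\<eta> n))\<^sup>2 / 2 + (cmod (\<xi> m))\<^sup>2 / 2"
        using sum_squares_bound[of "cmod (\<eta> n)" "cmod (\<xi> m)"] by simp
      show "cmod (orbit_mat x a n m) \<le> ?A (n - m)" unfolding orbit_mat_def by (rule l1_ge[OF a])
    qed auto
    finally show "cmod (cnj (\<eta> n) * orbit_mat x a n m * \<xi> m)
      \<le> (cmod (\<eta> n))\<^sup>2 / 2 * ?A (n - m) + (cmod (\<xi> m))\<^sup>2 / 2 * ?A (n - m)"
      by (simp add: distrib_right)
  qed
  also have "\<dots> = (\<Sum>n\<in>F. (cmod (\<eta> n))\<^sup>2 / 2 * (\<Sum>m\<in>G. ?A (n - m)))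
      + (\<Sum>m\<in>G. (cmod (\<xi> m))\<^sup>2 / 2 * (\<Sum>n\<in>F. ?A (n - m)))"
    by (simp add: sum.distrib sum_distrib_left) (rule sum.swap)
  also have "\<dots> \<le> (\<Sum>n\<in>F. (cmod (\<eta> n))\<^sup>2 / 2 * l1_norm a) + (\<Sum>m\<in>G. (cmod (\<xi> m))\<^sup>2 / 2 * l1_norm a)"
    using fin by (intro add_mono sum_mono mult_left_mono sum_supn_le[OF a]) (auto simp: inj_on_def)
  also have "\<dots> = ((l2 \<eta> F)\<^sup>2 / 2 + (l2 \<xi> G)\<^sup>2 / 2) * l1_norm a"
    by (simp add: l2_square sum_distrib_right sum_divide_distrib distrib_right)
  also have "\<dots> \<le> 1 * l1_norm a"
  proof (rule mult_right_mono)
    have "(l2 \<eta> F)\<^sup>2 \<le> 1" "(l2 \<xi> G)\<^sup>2 \<le> 1" using le by (simp_all add: power_le_one)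
    then show "(l2 \<eta> F)\<^sup>2 / 2 + (l2 \<xi> G)\<^sup>2 / 2 \<le> 1" by simp
  qed (rule l1_norm_nonneg[OF a])
  finally show ?thesis by simp
qed

lemma orbit_norm_ge:
  assumes "a \<in> l1" "finite F" "finite G" "l2 \<eta> F \<le> 1" "l2 \<xi> G \<le> 1"
  shows "cmod (orbit_form x a F G \<eta> \<xi>) \<le> orbit_norm x a"
proof -
  let ?D = "{(F, G, \<eta>, \<xi>). finite F \<and> finite G \<and> l2 \<eta> F \<le> 1 \<and> l2 \<xi> G \<le> 1}"
  let ?f = "\<lambda>(F, G, \<eta>, \<xi>). cmod (orbit_form x a F G \<eta> \<xi>)"
  have "bdd_above (?f ` ?D)"
    by (rule bdd_aboveI[of _ "l1_norm a"]) (auto intro: orbit_form_le_l1_norm[OF assms(1)])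
  then have "?f (F, G, \<eta>, \<xi>) \<le> (SUP p\<in>?D. ?f p)"
    by (rule cSUP_upper[rotated]) (use assms in auto)
  then show ?thesis by (simp add: orbit_norm_def)
qed

lemma orbit_norm_le:
  assumes "\<And>F G \<eta> \<xi>. finite F \<Longrightarrow> finite G \<Longrightarrow> l2 \<eta> F \<le> 1 \<Longrightarrow> l2 \<xi> G \<le> 1 \<Longrightarrow>
    cmod (orbit_form x a F G \<eta> \<xi>) \<le> C"
  shows "orbit_norm x a \<le> C"
  unfolding orbit_norm_def
proof (rule cSUP_least)
  have "({}, {}, \<lambda>_. 0, \<lambda>_. 0) \<in> {(F, G, \<eta>, \<xi>). finite F \<and> finite G \<and> l2 \<eta> F \<le> 1 \<and> l2 \<xi> G \<le> 1}" by simp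
  then show "{(F, G, \<eta>, \<xi>). finite F \<and> finite G \<and> l2 \<eta> F \<le> 1 \<and> l2 \<xi> G \<le> 1} \<noteq> {}"
    by (metis (no_types, lifting) emptyE)
qed (use assms in auto)

lemma orbit_norm_nonneg: "a \<in> l1 \<Longrightarrow> 0 \<le> orbit_norm x a"
  using orbit_norm_ge[of a "{}" "{}" "\<lambda>_. 0" "\<lambda>_. 0" x] by (simp add: orbit_form_def)

lemma orbit_form_smult:
  "orbit_form x (l1_smult c a) F G \<eta> \<xi> = c * orbit_form x a F G \<eta> \<xi>"
  "orbit_form x a F G (\<lambda>n. c * \<eta> n) \<xi> = cnj c * orbit_form x a F G \<eta> \<xi>"
  "orbit_form x a F G \<eta> (\<lambda>n. c * \<xi> n) = c * orbit_form x a F G \<eta> \<xi>"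
  by (simp_all add: orbit_form_def orbit_mat_def l1_smult_def sum_distrib_left algebra_simps)

lemma l2_zeroD: "finite F \<Longrightarrow> l2 \<eta> F = 0 \<Longrightarrow> n \<in> F \<Longrightarrow> \<eta> n = 0"
  by (simp add: L2_set_eq_0_iff)

lemma l2_normalise:
  assumes "l2 \<eta> F \<noteq> 0"
  shows "l2 (\<lambda>n. complex_of_real (1 / l2 \<eta> F) * \<eta> n) F \<le> 1"
proof -
  have "l2 (\<lambda>n. complex_of_real (1 / l2 \<eta> F) * \<eta> n) F = L2_set (\<lambda>n. (1 / l2 \<eta> F) * cmod (\<eta> n)) F"
    by (simp only: norm_mult norm_of_real) simp
  also have "\<dots> = (1 / l2 \<eta> F) * l2 \<eta> F"
    by (rule L2_set_right_distrib[symmetric]) simp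
  finally show ?thesis using assms by simp
qed

lemma orbit_form_bound:
  assumes a: "a \<in> l1" and fin: "finite F" "finite G"
  shows "cmod (orbit_form x a F G \<eta> \<xi>) \<le> orbit_norm x a * l2 \<eta> F * l2 \<xi> G"
proof (cases "l2 \<eta> F = 0 \<or> l2 \<xi> G = 0")
  case True
  then have "orbit_form x a F G \<eta> \<xi> = 0"
    unfolding orbit_form_def using l2_zeroD fin by (auto intro!: sum.neutral)
  then show ?thesis using True by auto
next
  case False
  let ?c = "complex_of_real (1 / l2 \<eta> F)" and ?d = "complex_of_real (1 / l2 \<xi> G)"
  have pos: "l2 \<eta> F > 0" "l2 \<xi> G > 0" using False L2_set_nonneg by (metis order_le_less)+
  have "cmod (orbit_form x a F G (\<lambda>n. ?c * \<eta> n) (\<lambda>n. ?d * \<xi> n)) \<le> orbit_norm x a"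
    by (rule orbit_norm_ge[OF a fin]) (use l2_normalise False in auto)
  then have "cmod (orbit_form x a F G \<eta> \<xi>) / (l2 \<eta> F * l2 \<xi> G) \<le> orbit_norm x a"
    unfolding orbit_form_smult using pos by (simp add: norm_mult norm_divide)
  then show ?thesis using pos by (simp add: field_simps)
qed

text \<open>The shift \<alpha>^k evaluated at \<sigma>^n x moves the point to \<sigma>^l x with l =
  n - k, so the twisted convolution becomes the product of matrices.\<close>

lemma orbit_mat_mult:
  assumes "a \<in> l1" "b \<in> l1"
  shows "((\<lambda>l. orbit_mat x a n l * orbit_mat x b l m) has_sum orbit_mat x (mul1 a b) n m) UNIV"
proof -
  have "((\<lambda>k. a k (spow \<sigma> n x) * b (n - m - k) (spow \<sigma> (- k) (spow \<sigma> n x))) has_sum orbit_mat x (mul1 a b) n m) UNIV"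
    unfolding orbit_mat_def l1_mult_alt
    by (rule has_sum_infsum) (rule abs_summable_summable[OF l1_mult_summable[OF assms]])
  moreover have "((\<lambda>k. a k (spow \<sigma> n x) * b (n - m - k) (spow \<sigma> (- k) (spow \<sigma> n x))) has_sum orbit_mat x (mul1 a b) n m) UNIV
     \<longleftrightarrow> ((\<lambda>l. orbit_mat x a n l * orbit_mat x b l m) has_sum orbit_mat x (mul1 a b) n m) UNIV"
    by (rule has_sum_reindex_bij_witness[where i = "\<lambda>l. n - l" and j = "\<lambda>k. n - k"])
      (auto simp: orbit_mat_def spow_add[symmetric] diff_diff_eq2 algebra_simps)
  ultimately show ?thesis by simp
qed

text \<open>The image of a finitely supported vector need not be finitely supported, so it is kept
  as a function on the integers and measured on finite windows only.\<close>

definition orbit_app :: "'a \<Rightarrow> 'a l1elt \<Rightarrow> int set \<Rightarrow> (int \<Rightarrow> complex) \<Rightarrow> int \<Rightarrow> complex" where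
  "orbit_app x b G \<xi> l = (\<Sum>m\<in>G. orbit_mat x b l m * \<xi> m)"

definition orbit_coapp :: "'a \<Rightarrow> 'a l1elt \<Rightarrow> int set \<Rightarrow> (int \<Rightarrow> complex) \<Rightarrow> int \<Rightarrow> complex" where
  "orbit_coapp x a F \<eta> l = (\<Sum>n\<in>F. cnj (\<eta> n) * orbit_mat x a n l)"

lemma orbit_form_mult:
  assumes "a \<in> l1" "b \<in> l1" "finite F" "finite G"
  shows "((\<lambda>l. orbit_coapp x a F \<eta> l * orbit_app x b G \<xi> l) has_sum orbit_form x (mul1 a b) F G \<eta> \<xi>) UNIV"
proof -
  have "((\<lambda>l. \<Sum>n\<in>F. \<Sum>m\<in>G. cnj (\<eta> n) * (orbit_mat x a n l * orbit_mat x b l m) * \<xi> m)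
      has_sum orbit_form x (mul1 a b) F G \<eta> \<xi>) UNIV"
    unfolding orbit_form_def
    by (intro has_sum_finite_sum has_sum_cmult_left has_sum_cmult_right orbit_mat_mult assms)
  moreover have "(\<Sum>n\<in>F. \<Sum>m\<in>G. cnj (\<eta> n) * (orbit_mat x a n l * orbit_mat x b l m) * \<xi> m)
      = orbit_coapp x a F \<eta> l * orbit_app x b G \<xi> l" for l
    unfolding orbit_coapp_def orbit_app_def sum_product by (simp add: mult.assoc)
  ultimately show ?thesis by simp
qed

text \<open>Testing the form against the image vector itself gives the square of its norm; one
  factor is then cancelled.\<close>

lemma orbit_app_le:
  assumes b: "b \<in> l1" and fin: "finite L" "finite G"
  shows "l2 (orbit_app x b G \<xi>) L \<le> orbit_norm x b * l2 \<xi> G"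
proof (cases "l2 (orbit_app x b G \<xi>) L = 0")
  case True
  then show ?thesis using orbit_norm_nonneg[OF b] by simp
next
  case False
  let ?v = "orbit_app x b G \<xi>"
  have "orbit_form x b L G ?v \<xi> = (\<Sum>l\<in>L. cnj (?v l) * ?v l)"
    by (simp add: orbit_form_def orbit_app_def sum_distrib_left mult.assoc)
  also have "\<dots> = complex_of_real ((l2 ?v L)\<^sup>2)"
    unfolding l2_square by (simp only: cnj_mult_self of_real_sum)
  finally have "(l2 ?v L)\<^sup>2 \<le> orbit_norm x b * l2 ?v L * l2 \<xi> G"
    using orbit_form_bound[OF b fin, of x ?v \<xi>] by (simp only: norm_of_real abs_power2)
  then have "l2 ?v L * l2 ?v L \<le> (orbit_norm x b * l2 \<xi> G) * l2 ?v L"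
    by (simp add: power2_eq_square mult.commute mult.left_commute)
  moreover have "l2 ?v L > 0" using False by (simp add: less_le)
  ultimately show ?thesis by (rule mult_right_le_imp_le)
qed

lemma orbit_mat_star: "orbit_mat x (star1 a) n m = cnj (orbit_mat x a m n)"
  by (simp add: orbit_mat_def l1_star_alt spow_add[symmetric])

lemma orbit_form_star: "orbit_form x (star1 a) F G \<eta> \<xi> = cnj (orbit_form x a G F \<xi> \<eta>)"
  unfolding orbit_form_def orbit_mat_star by (subst sum.swap) (simp add: mult.commute mult.left_commute)

lemma orbit_norm_star_le: "a \<in> l1 \<Longrightarrow> orbit_norm x (star1 a) \<le> orbit_norm x a"
  by (rule orbit_norm_le) (simp add: orbit_form_star orbit_norm_ge)

lemma orbit_coapp_eq: "orbit_coapp x a F \<eta> l = cnj (orbit_app x (star1 a) F \<eta> l)"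
  by (simp add: orbit_coapp_def orbit_app_def orbit_mat_star mult.commute)

text \<open>The form of a product is an infinite sum over the intermediate index; Cauchy-Schwarz
  bounds every finite part of it uniformly, and the bound passes to the sum.\<close>

lemma orbit_norm_mult:
  assumes "a \<in> l1" "b \<in> l1"
  shows "orbit_norm x (mul1 a b) \<le> orbit_norm x a * orbit_norm x b"
proof (rule orbit_norm_le)
  fix F G :: "int set" and \<eta> \<xi>
  assume fin: "finite F" "finite G" and le: "l2 \<eta> F \<le> 1" "l2 \<xi> G \<le> 1"
  show "cmod (orbit_form x (mul1 a b) F G \<eta> \<xi>) \<le> orbit_norm x a * orbit_norm x b"
  proof (rule has_sum_norm_le[OF orbit_form_mult[OF assms fin]])
    fix L :: "int set" assume L: "finite L"
    have "cmod (\<Sum>l\<in>L. orbit_coapp x a F \<eta> l * orbit_app x b G \<xi> l)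
        \<le> l2 (orbit_coapp x a F \<eta>) L * l2 (orbit_app x b G \<xi>) L"
      by (rule norm_sum_mult_le_L2_set)
    also have "\<dots> \<le> orbit_norm x a * orbit_norm x b"
    proof (rule mult_mono)
      have "l2 (orbit_coapp x a F \<eta>) L \<le> orbit_norm x (star1 a) * l2 \<eta> F"
        using orbit_app_le[OF l1_star[OF assms(1)] L fin(1), of x \<eta>] by (simp add: orbit_coapp_eq)
      also have "\<dots> \<le> orbit_norm x a * 1"
        using orbit_norm_star_le[OF assms(1)] orbit_norm_nonneg[OF assms(1)] le by (intro mult_mono) auto
      finally show "l2 (orbit_coapp x a F \<eta>) L \<le> orbit_norm x a" by simp
      have "l2 (orbit_app x b G \<xi>) L \<le> orbit_norm x b * l2 \<xi> G"
        by (rule orbit_app_le[OF assms(2) L fin(2)])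
      also have "\<dots> \<le> orbit_norm x b * 1"
        using orbit_norm_nonneg[OF assms(2)] le by (intro mult_mono) auto
      finally show "l2 (orbit_app x b G \<xi>) L \<le> orbit_norm x b" by simp
    qed (use orbit_norm_nonneg[OF assms(1)] in auto)
    finally show "cmod (\<Sum>l\<in>L. orbit_coapp x a F \<eta> l * orbit_app x b G \<xi> l) \<le> orbit_norm x a * orbit_norm x b" .
  qed
qed

text \<open>The non-trivial direction: the form of a* a at a vector is the full sum of squares of
  the image under a, which dominates the sum over any finite window. Cauchy-Schwarz then bounds the
  form of a.\<close>

lemma orbit_norm_cstar:
  assumes a: "a \<in> l1"
  shows "orbit_norm x (mul1 (star1 a) a) = (orbit_norm x a)\<^sup>2"
proof (rule order_antisym)
  have "orbit_norm x (mul1 (star1 a) a) \<le> orbit_norm x (star1 a) * orbit_norm x a"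
    by (rule orbit_norm_mult[OF l1_star[OF a] a])
  also have "\<dots> \<le> (orbit_norm x a)\<^sup>2"
    unfolding power2_eq_square using orbit_norm_star_le[OF a] orbit_norm_nonneg[OF a] by (intro mult_right_mono)
  finally show "orbit_norm x (mul1 (star1 a) a) \<le> (orbit_norm x a)\<^sup>2" .
  let ?p = "orbit_norm x (mul1 (star1 a) a)"
  have p: "0 \<le> ?p" by (intro orbit_norm_nonneg l1_mult l1_star a)
  have "orbit_norm x a \<le> sqrt ?p"
  proof (rule orbit_norm_le)
    fix F G :: "int set" and \<eta> \<xi>
    assume fin: "finite F" "finite G" and le: "l2 \<eta> F \<le> 1" "l2 \<xi> G \<le> 1"
    let ?v = "orbit_app x a G \<xi>" and ?S = "orbit_form x (mul1 (star1 a) a) G G \<xi> \<xi>"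
    have "((\<lambda>l. cnj (?v l) * ?v l) has_sum ?S) UNIV"
      using orbit_form_mult[OF l1_star[OF a] a fin(2) fin(2), of x \<xi> \<xi>] by (simp add: orbit_coapp_eq)
    then have "((\<lambda>l. Re (cnj (?v l) * ?v l)) has_sum Re ?S) UNIV" by (rule has_sum_Re)
    then have "((\<lambda>l. (cmod (?v l))\<^sup>2) has_sum Re ?S) UNIV" by (simp only: cnj_mult_self Re_complex_of_real)
    then have "(\<Sum>l\<in>F. (cmod (?v l))\<^sup>2) \<le> Re ?S"
      by (rule finite_sum_le_has_sum) (use fin in auto)
    also have "\<dots> \<le> cmod ?S" by (rule complex_Re_le_cmod)
    also have "\<dots> \<le> ?p" by (rule orbit_norm_ge[OF l1_mult[OF l1_star[OF a] a] fin(2) fin(2) le(2) le(2)])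
    finally have v: "l2 ?v F \<le> sqrt ?p" by (simp add: L2_set_def)
    have "orbit_form x a F G \<eta> \<xi> = (\<Sum>n\<in>F. cnj (\<eta> n) * ?v n)"
      by (simp add: orbit_form_def orbit_app_def sum_distrib_left mult.assoc)
    then have "cmod (orbit_form x a F G \<eta> \<xi>) \<le> l2 \<eta> F * l2 ?v F"
      using norm_sum_mult_le_L2_set[of "\<lambda>n. cnj (\<eta> n)" ?v F] by simp
    also have "\<dots> \<le> 1 * sqrt ?p" using le v by (intro mult_mono) auto
    finally show "cmod (orbit_form x a F G \<eta> \<xi>) \<le> sqrt ?p" by simp
  qed
  then have "(orbit_norm x a)\<^sup>2 \<le> (sqrt ?p)\<^sup>2" using orbit_norm_nonneg[OF a] by (intro power_mono)
  then show "(orbit_norm x a)\<^sup>2 \<le> ?p" using p by simp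
qed

lemma orbit_norm_smult_le: "a \<in> l1 \<Longrightarrow> orbit_norm x (l1_smult c a) \<le> cmod c * orbit_norm x a"
  by (rule orbit_norm_le) (simp add: orbit_form_smult norm_mult mult_left_mono orbit_norm_ge)

lemma orbit_norm_smult:
  assumes a: "a \<in> l1"
  shows "orbit_norm x (l1_smult c a) = cmod c * orbit_norm x a"
proof (cases "c = 0")
  case True
  then show ?thesis
    using orbit_norm_smult_le[OF a, of x c] orbit_norm_nonneg[OF l1_smult[OF a], of x c] by simp
next
  case False
  have "a = l1_smult (1 / c) (l1_smult c a)" using False by (simp add: l1_smult_def)
  then have "orbit_norm x a \<le> cmod (1 / c) * orbit_norm x (l1_smult c a)"
    using orbit_norm_smult_le[OF l1_smult[OF a], of x "1 / c" c] by simp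
  then have "cmod c * orbit_norm x a \<le> orbit_norm x (l1_smult c a)"
    using False by (simp add: norm_divide field_simps)
  then show ?thesis using orbit_norm_smult_le[OF a, of x c] by simp
qed

lemma orbit_norm_add:
  assumes "a \<in> l1" "b \<in> l1"
  shows "orbit_norm x (l1_add a b) \<le> orbit_norm x a + orbit_norm x b"
proof (rule orbit_norm_le)
  fix F G :: "int set" and \<eta> \<xi>
  assume fin: "finite F" "finite G" and le: "l2 \<eta> F \<le> 1" "l2 \<xi> G \<le> 1"
  have "orbit_form x (l1_add a b) F G \<eta> \<xi> = orbit_form x a F G \<eta> \<xi> + orbit_form x b F G \<eta> \<xi>"
    by (simp add: orbit_form_def orbit_mat_def l1_add_def algebra_simps sum.distrib)
  then show "cmod (orbit_form x (l1_add a b) F G \<eta> \<xi>) \<le> orbit_norm x a + orbit_norm x b"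
    using norm_triangle_ineq[of "orbit_form x a F G \<eta> \<xi>" "orbit_form x b F G \<eta> \<xi>"]
      orbit_norm_ge[OF assms(1) fin le, of x] orbit_norm_ge[OF assms(2) fin le, of x] by simp
qed

lemma cstar_seminorm_orbit_norm: "cstar_seminorm \<sigma> (orbit_norm x)"
  unfolding cstar_seminorm_def
proof (intro ballI allI conjI)
  fix a b :: "'a l1elt" and c
  assume ab: "a \<in> l1" "b \<in> l1"
  show "orbit_norm x a \<le> l1_norm a"
    by (rule orbit_norm_le) (rule orbit_form_le_l1_norm[OF ab(1)])
  show "0 \<le> orbit_norm x a" using ab(1) by (rule orbit_norm_nonneg)
  show "orbit_norm x (l1_add a b) \<le> orbit_norm x a + orbit_norm x b" using ab by (rule orbit_norm_add)
  show "orbit_norm x (l1_smult c a) = cmod c * orbit_norm x a" using ab(1) by (rule orbit_norm_smult)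
  show "orbit_norm x (mul1 a b) \<le> orbit_norm x a * orbit_norm x b" using ab by (rule orbit_norm_mult)
  show "orbit_norm x (mul1 (star1 a) a) = (orbit_norm x a)\<^sup>2" using ab(1) by (rule orbit_norm_cstar)
qed

text \<open>The value a_k(x) is the matrix entry in row 0 and column -k over the orbit of x. All
  that the sequel takes from the regular representation is this estimate.\<close>

lemma coeff_le_unorm:
  assumes a: "a \<in> l1"
  shows "cmod (a k x) \<le> unrm a"
proof -
  have "cmod (orbit_form x a {0} {- k} (\<lambda>_. 1) (\<lambda>_. 1)) \<le> orbit_norm x a"
    by (rule orbit_norm_ge[OF a]) (simp_all add: L2_set_def)
  then have "cmod (a k x) \<le> orbit_norm x a" by (simp add: orbit_form_def orbit_mat_def)
  also have "\<dots> \<le> unrm a" by (rule unorm_ge[OF cstar_seminorm_orbit_norm a])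
  finally show ?thesis .
qed

end

section \<open>Multipliers\<close>

text \<open>A geometric sum. Letting t run up to a multiple M of m, rather than m itself, allows one
  M to serve points of different period.\<close>

lemma sum_roots_of_unity:
  fixes k :: int and m M :: nat
  assumes "m > 0" "m dvd M"
  shows "(\<Sum>t<M. cis (2 * pi * real t / real m) powi k) = (if int m dvd k then of_nat M else 0)"
proof -
  define z where "z = cis (2 * pi * of_int k / real m)"
  have zt: "cis (2 * pi * real t / real m) powi k = z ^ t" for t
    by (simp add: z_def cis_power_int Complex.DeMoivre algebra_simps)
  have z1: "z = 1 \<longleftrightarrow> int m dvd k"
  proof -
    have "z = 1 \<longleftrightarrow> (\<exists>n::int. 2 * pi * of_int k / real m = of_int (2 * n) * pi)"
      by (simp add: z_def cis_conv_exp exp_eq_1)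
    also have "\<dots> \<longleftrightarrow> (\<exists>n::int. real_of_int k = real_of_int (int m * n))"
      using assms(1) by (simp add: field_simps)
    also have "\<dots> \<longleftrightarrow> int m dvd k" unfolding of_int_eq_iff by (auto simp: dvd_def)
    finally show ?thesis .
  qed
  obtain q where q: "M = m * q" using assms(2) by (elim dvdE)
  have "real M * (2 * pi * of_int k / real m) = 2 * pi * of_int (k * int q)"
    using assms(1) by (simp add: q)
  then have "z ^ M = cis (2 * pi * of_int (k * int q))"
    by (simp only: z_def Complex.DeMoivre)
  also have "\<dots> = 1" by (rule cis_multiple_2pi) simp
  finally have zM: "z ^ M = 1" .
  show ?thesis
  proof (cases "z = 1")
    case True
    then show ?thesis using z1 unfolding zt by simp
  next
    case False
    then show ?thesis using z1 zM geometric_sum[of z M] unfolding zt by simp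
  qed
qed

context dynamical_system
begin

text \<open>Invariance under \<sigma> makes w a central unitary; this is what makes
  \<open>twist w\<close> multiplicative.\<close>

definition unimodular :: "('a \<Rightarrow> complex) \<Rightarrow> bool" where
  "unimodular w \<longleftrightarrow> w \<in> CX \<and> (\<forall>x. cmod (w x) = 1) \<and> (\<forall>x. w (\<sigma> x) = w x)"

text \<open>For constant \<open>w\<close> this is the dual action of the circle.\<close>

definition twist :: "('a \<Rightarrow> complex) \<Rightarrow> 'a l1elt \<Rightarrow> 'a l1elt" where
  "twist w a = (\<lambda>k x. w x powi k * a k x)"

lemma unimodular_spow:
  assumes "unimodular w"
  shows "w (spow \<sigma> k x) = w x"
proof (induction k rule: int_induct[where k = 0])
  case (step1 i)
  then show ?case using assms by (simp add: spow_Suc unimodular_def)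
next
  case (step2 i)
  then show ?case using assms spow_Suc[of "i - 1" x] by (simp add: unimodular_def)
qed simp

lemma cmod_twist: "unimodular w \<Longrightarrow> cmod (twist w a k x) = cmod (a k x)"
  by (simp add: twist_def unimodular_def norm_mult norm_power_int)

lemma CX_powi: "unimodular w \<Longrightarrow> (\<lambda>x. w x powi k) \<in> CX"
proof -
  assume w: "unimodular w"
  then have "w x \<noteq> 0" for x by (metis norm_zero unimodular_def zero_neq_one)
  then show ?thesis using w by (auto simp: unimodular_def CX_def intro!: continuous_intros)
qed

lemma twist_l1:
  assumes "unimodular w" "a \<in> l1"
  shows "twist w a \<in> l1"
proof (rule l1I)
  show "twist w a k \<in> CX" for k
    unfolding twist_def by (intro CX_intros(4) CX_powi assms(1) l1D(1)[OF assms(2)])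
  show "cmod (twist w a k x) \<le> supn (a k)" for k x
    by (simp add: cmod_twist[OF assms(1)] l1_ge[OF assms(2)])
qed (rule l1D(2)[OF assms(2)])

lemma twist_mult:
  assumes w: "unimodular w"
  shows "twist w (mul1 a b) = mul1 (twist w a) (twist w b)"
proof (intro ext)
  fix n x
  have nz: "w x \<noteq> 0" using w by (metis norm_zero unimodular_def zero_neq_one)
  have "w x powi n * (a k x * b (n - k) y) = w x powi k * a k x * (w x powi (n - k) * b (n - k) y)" for k y
  proof -
    have "w x powi n = w x powi k * w x powi (n - k)"
      using power_int_add[of "w x" k "n - k"] nz by simp
    then show ?thesis by simp
  qed
  then show "twist w (mul1 a b) n x = mul1 (twist w a) (twist w b) n x"
    unfolding twist_def l1_mult_alt unimodular_spow[OF w]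
    by (subst infsum_cmult_right'[symmetric]) (rule infsum_cong)
qed

lemma twist_star:
  assumes w: "unimodular w"
  shows "twist w (star1 a) = star1 (twist w a)"
proof (intro ext)
  fix n x
  have "cmod (w x) = 1" using w by (simp add: unimodular_def)
  then have "w x * cnj (w x) = 1" using complex_norm_square[of "w x"] by simp
  then have "inverse (w x) = cnj (w x)" by (rule inverse_unique)
  then have "cnj (w x powi (- n)) = w x powi n"
    by (metis complex_cnj_cnj complex_cnj_power_int inverse_inverse_eq power_int_inverse power_int_minus)
  then show "twist w (star1 a) n x = star1 (twist w a) n x"
    by (simp add: twist_def l1_star_alt unimodular_spow[OF w])
qed

lemma twist_linear:
  "twist w (l1_add a b) = l1_add (twist w a) (twist w b)"
  "twist w (l1_smult c a) = l1_smult c (twist w a)"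
  by (simp_all add: twist_def l1_add_def l1_smult_def algebra_simps)

text \<open>Twisting is a *-endomorphism that preserves absolute values of coefficients, so
  composing with it respects every clause, including the l1 bound. Consequently the supremum
  \<open>unorm\<close> cannot grow under a twist.\<close>

lemma cstar_seminorm_twist:
  assumes w: "unimodular w" and p: "cstar_seminorm \<sigma> p"
  shows "cstar_seminorm \<sigma> (\<lambda>a. p (twist w a))"
  unfolding cstar_seminorm_def
proof (intro ballI allI conjI)
  fix a b :: "'a l1elt" and c
  assume ab: "a \<in> l1" "b \<in> l1"
  note t = twist_l1[OF w ab(1)] twist_l1[OF w ab(2)]
  note D = cstar_seminormD[OF p t(1)]
  show "0 \<le> p (twist w a)" by (rule D)
  show "p (twist w (l1_add a b)) \<le> p (twist w a) + p (twist w b)"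
    unfolding twist_linear by (rule D(2)[OF t(2)])
  show "p (twist w (l1_smult c a)) = cmod c * p (twist w a)"
    unfolding twist_linear by (rule D)
  show "p (twist w (mul1 a b)) \<le> p (twist w a) * p (twist w b)"
    unfolding twist_mult[OF w] by (rule D(4)[OF t(2)])
  show "p (twist w (mul1 (star1 a) a)) = (p (twist w a))\<^sup>2"
    unfolding twist_mult[OF w] twist_star[OF w] by (rule D)
  have "l1_norm (twist w a) \<le> l1_norm a"
    unfolding l1_norm_def[of a]
    by (rule l1_norm_le[OF t(1) l1D(2)[OF ab(1)]]) (simp add: cmod_twist[OF w] l1_ge[OF ab(1)])
  then show "p (twist w a) \<le> l1_norm a" using D(6) by simp
qed

lemma unorm_twist_le:
  assumes "unimodular w" "a \<in> l1"
  shows "unrm (twist w a) \<le> unrm a"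
  by (rule unorm_le) (rule unorm_ge[OF cstar_seminorm_twist[OF assms(1)] assms(2)])

text \<open>The source of the contractivity of both \<open>fejer\<close> and \<open>proj\<close>: it
  suffices to write their multipliers as averages of powers of unimodular functions. Membership and
  bound are proved together because the induction needs the former for the latter.\<close>

lemma unorm_average_le:
  assumes a: "a \<in> l1" and T: "finite T" and W: "\<And>t. t \<in> T \<Longrightarrow> unimodular (W t)" "\<And>t. t \<in> T \<Longrightarrow> 0 \<le> r t"
  shows "(\<lambda>k x. (\<Sum>t\<in>T. complex_of_real (r t) * W t x powi k) * a k x) \<in> l1 \<and>
    unrm (\<lambda>k x. (\<Sum>t\<in>T. complex_of_real (r t) * W t x powi k) * a k x) \<le> sum r T * unrm a"
  using T W
proof (induction T)
  case (insert t T)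
  let ?S = "\<lambda>k x. (\<Sum>t\<in>T. complex_of_real (r t) * W t x powi k) * a k x"
  have IH: "?S \<in> l1" "unrm ?S \<le> sum r T * unrm a" using insert by auto
  have eq: "(\<lambda>k x. (\<Sum>t\<in>insert t T. complex_of_real (r t) * W t x powi k) * a k x)
      = l1_add (l1_smult (complex_of_real (r t)) (twist (W t) a)) ?S"
    using insert by (simp add: l1_add_def l1_smult_def twist_def algebra_simps)
  have w: "unimodular (W t)" "0 \<le> r t" using insert by auto
  have t: "twist (W t) a \<in> l1" by (rule twist_l1[OF w(1) a])
  have "unrm (l1_smult (complex_of_real (r t)) (twist (W t) a)) \<le> r t * unrm a"
    using unorm_smult[OF t, of "complex_of_real (r t)"] unorm_twist_le[OF w(1) a] w(2)
    by (simp add: mult_left_mono)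
  then show ?case unfolding eq
    using unorm_add[OF l1_smult[OF t] IH(1), of "complex_of_real (r t)"] IH l1_add[OF l1_smult[OF t] IH(1)] insert(1,2)
    by (simp add: distrib_right)
qed simp

lemma unorm_finite_support_le:
  assumes a: "a \<in> l1" and F: "finite F" "\<And>k. k \<notin> F \<Longrightarrow> a k = (\<lambda>x. 0)"
  shows "unrm a \<le> (\<Sum>k\<in>F. supn (a k))"
proof -
  have "l1_norm a = infsum (\<lambda>k. supn (a k)) F"
    unfolding l1_norm_def by (rule infsum_cong_neutral) (use F in auto)
  then show ?thesis using unorm_le_l1_norm[OF a] F by simp
qed

section \<open>Truncation and density of the finite sums\<close>

definition trunc :: "nat \<Rightarrow> 'a l1elt \<Rightarrow> 'a l1elt" where
  "trunc D a = (\<lambda>k x. if \<bar>k\<bar> \<le> int D then a k x else 0)"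

lemma c00I:
  assumes "a \<in> l1" "\<And>k. \<bar>k\<bar> > int D \<Longrightarrow> a k = (\<lambda>x. 0)"
  shows "a \<in> c00"
proof -
  have "{k. a k \<noteq> (\<lambda>x. 0)} \<subseteq> {- int D..int D}" using assms(2) by force
  then show ?thesis using assms(1) finite_subset unfolding c00_def by blast
qed

lemma c00E:
  assumes "a \<in> c00"
  obtains D :: nat where "\<And>k. \<bar>k\<bar> > int D \<Longrightarrow> a k = (\<lambda>x::'a. 0)"
proof -
  define S where "S = (\<lambda>k. nat \<bar>k\<bar>) ` {k. a k \<noteq> (\<lambda>x. 0)}"
  have "finite S" using assms by (simp add: S_def c00_def)
  \<comment> \<open>If S is empty, \<open>Max S\<close> is an unspecified number, but then all
    coefficients vanish and any bound will do.\<close>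
  then have "\<forall>d\<in>S. d \<le> Max S" by simp
  then have "a k = (\<lambda>x. 0)" if "\<bar>k\<bar> > int (Max S)" for k
    using that unfolding S_def by force
  then show thesis by (rule that)
qed

lemma trunc_l1: assumes a: "a \<in> l1" shows "trunc D a \<in> l1"
proof (rule l1I)
  show "trunc D a k \<in> CX" for k
    using l1D(1)[OF a, of k] by (cases "\<bar>k\<bar> \<le> int D") (simp_all add: trunc_def CX_intros)
  show "cmod (trunc D a k x) \<le> supn (a k)" for k x
    using l1_ge[OF a, of k x] a by (simp add: trunc_def)
qed (rule l1D(2)[OF a])

lemma trunc_c00: "a \<in> l1 \<Longrightarrow> trunc D a \<in> c00"
  by (rule c00I[where D = D], rule trunc_l1) (auto simp: trunc_def)

lemma trunc_approx:
  assumes a: "a \<in> l1" and e: "e > 0"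
  shows "\<exists>D. l1_norm (l1_sub a (trunc D a)) < e"
proof -
  let ?A = "\<lambda>k. supn (a k)"
  have "(sum ?A \<longlongrightarrow> l1_norm a) (finite_subsets_at_top UNIV)"
    using has_sum_infsum[OF l1D(2)[OF a]] unfolding has_sum_def l1_norm_def .
  then have "\<forall>\<^sub>F F in finite_subsets_at_top UNIV. dist (sum ?A F) (l1_norm a) < e"
    using e by (rule tendstoD)
  then obtain X where X: "finite X" "\<And>Y. finite Y \<Longrightarrow> X \<subseteq> Y \<Longrightarrow> dist (sum ?A Y) (l1_norm a) < e"
    unfolding eventually_finite_subsets_at_top by auto
  \<comment> \<open>Inserting 0 keeps the maximum meaningful when X is empty.\<close>
  define D where "D = Max (insert 0 ((\<lambda>k. nat \<bar>k\<bar>) ` X))"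
  have XD: "X \<subseteq> {- int D..int D}"
  proof
    fix k assume "k \<in> X"
    then have "nat \<bar>k\<bar> \<le> D" using X(1) by (simp add: D_def)
    then show "k \<in> {- int D..int D}" by auto
  qed
  let ?F = "{- int D..int D}"
  have "l1_norm (l1_sub a (trunc D a)) = infsum ?A (UNIV - ?F)"
    unfolding l1_norm_def
  proof (rule infsum_cong_neutral)
    fix k :: int assume "k \<in> UNIV - (UNIV - ?F)"
    then have "l1_sub a (trunc D a) k = (\<lambda>x. 0)" by (auto simp: l1_sub_def trunc_def)
    then show "supn (l1_sub a (trunc D a) k) = 0" by simp
  next
    fix k :: int assume "k \<in> UNIV \<inter> (UNIV - ?F)"
    then have "l1_sub a (trunc D a) k = a k" by (auto simp: l1_sub_def trunc_def)
    then show "supn (l1_sub a (trunc D a) k) = supn (a k)" by simp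
  qed auto
  also have "\<dots> = l1_norm a - sum ?A ?F"
    unfolding l1_norm_def using infsum_Diff[OF l1D(2)[OF a], of ?F] by simp
  also have "\<dots> < e" using X(2)[OF _ XD] by (simp add: dist_real_def)
  finally show ?thesis by blast
qed

text \<open>A multiplier bounded by 1 is contractive for the l1 norm, so it keeps the tail beyond a
  long truncation small in the universal norm. This matters because the averages realising the
  multipliers depend on the support of the element.\<close>

lemma contractive_multiplier:
  assumes \<phi>: "\<And>a. a \<in> l1 \<Longrightarrow> (\<lambda>k x. \<phi> k x * a k x) \<in> l1" "\<And>k x. cmod (\<phi> k x) \<le> 1"
    and c: "\<And>a. a \<in> c00 \<Longrightarrow> unrm (\<lambda>k x. \<phi> k x * a k x) \<le> unrm a"
    and a: "a \<in> l1"
  shows "unrm (\<lambda>k x. \<phi> k x * a k x) \<le> unrm a"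
proof (rule field_le_epsilon)
  fix e :: real assume "e > 0"
  then obtain D where D: "l1_norm (l1_sub a (trunc D a)) < e / 2"
    using trunc_approx[OF a, of "e / 2"] by auto
  let ?t = "trunc D a"
  let ?d = "l1_sub a ?t"
  let ?\<Phi> = "\<lambda>a k x. \<phi> k x * a k x"
  have t: "?t \<in> l1" "?t \<in> c00" using trunc_l1[OF a] trunc_c00[OF a] by auto
  have d: "?d \<in> l1" using l1_sub[OF a t(1)] .
  have eq: "?\<Phi> a = l1_add (?\<Phi> ?t) (?\<Phi> ?d)"
    by (simp add: l1_add_def l1_sub_def algebra_simps)
  have "l1_norm (?\<Phi> ?d) \<le> l1_norm ?d"
    unfolding l1_norm_def[of ?d]
  proof (rule l1_norm_le[OF \<phi>(1)[OF d] l1D(2)[OF d]])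
    show "cmod (\<phi> k x * ?d k x) \<le> supn (?d k)" for k x
      using mult_mono[OF \<phi>(2)[of k x] l1_ge[OF d, of k x]] by (simp add: norm_mult)
  qed
  then have "unrm (?\<Phi> ?d) < e / 2" using unorm_le_l1_norm[OF \<phi>(1)[OF d]] D by linarith
  moreover have "unrm ?t \<le> unrm a + e / 2"
    using unorm_le_sub[OF t(1) a] unorm_sub_commute[OF t(1) a] unorm_le_l1_norm[OF d] D by simp
  moreover have "unrm (?\<Phi> a) \<le> unrm (?\<Phi> ?t) + unrm (?\<Phi> ?d)"
    unfolding eq by (rule unorm_add[OF \<phi>(1)[OF t(1)] \<phi>(1)[OF d]])
  ultimately show "unrm (?\<Phi> a) \<le> unrm a + e" using c[OF t(2)] by linarith
qed

section \<open>Fejer means\<close>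

definition fejer :: "nat \<Rightarrow> int \<Rightarrow> real" where
  "fejer N k = max 0 (1 - \<bar>real_of_int k\<bar> / real N)"

lemma fejer_bounds: "0 \<le> fejer N k" "fejer N k \<le> 1"
  by (simp_all add: fejer_def)

text \<open>The squared modulus of the sum of z^i over 0 \<le> i < N expands into powers z^(i - j);
  counting the pairs that cancel a given z^k identifies the triangular weight.\<close>

lemma fejer_count:
  assumes "N > 0"
  shows "(\<Sum>i\<in>{0..<int N}. \<Sum>j\<in>{0..<int N}. if i - j + k = 0 then 1 else 0 :: real) = real N * fejer N k"
proof -
  have "(\<Sum>i\<in>{0..<int N}. \<Sum>j\<in>{0..<int N}. if i - j + k = 0 then 1 else 0 :: real)
      = (\<Sum>i\<in>{0..<int N}. if i + k \<in> {0..<int N} then 1 else 0)"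
  proof (rule sum.cong[OF refl])
    fix i
    have "(\<Sum>j\<in>{0..<int N}. if i - j + k = 0 then 1 else 0 :: real) = (\<Sum>j\<in>{0..<int N}. if j = i + k then 1 else 0)"
      by (rule sum.cong) auto
    then show "(\<Sum>j\<in>{0..<int N}. if i - j + k = 0 then 1 else 0 :: real) = (if i + k \<in> {0..<int N} then 1 else 0)"
      by simp
  qed
  also have "\<dots> = real (card ({0..<int N} \<inter> {i. i + k \<in> {0..<int N}}))"
    by (simp add: sum.If_cases)
  also have "{0..<int N} \<inter> {i. i + k \<in> {0..<int N}} = {max 0 (- k)..<min (int N) (int N - k)}"
    by auto
  also have "real (card \<dots>) = real N * fejer N k"
    using assms by (auto simp: fejer_def max_def min_def field_simps of_nat_nat)
  finally show ?thesis .
qed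

lemma unimodular_const: "cmod c = 1 \<Longrightarrow> unimodular (\<lambda>x. c)"
  by (simp add: unimodular_def CX_intros)

lemma fejer_contractive_c00:
  assumes a: "a \<in> c00" and N: "N > 0"
  shows "unrm (\<lambda>k x. complex_of_real (fejer N k) * a k x) \<le> unrm a"
proof -
  obtain D :: nat where D: "\<And>k. \<bar>k\<bar> > int D \<Longrightarrow> a k = (\<lambda>x. 0)" using c00E[OF a] by blast
  \<comment> \<open>For |k| \<le> D and 0 \<le> i, j < N the exponent i - j + k is smaller than M in
    modulus, so M divides it only when it is 0. Summing over M-th roots of unity thus replaces the
    integral over the circle exactly.\<close>
  define M where "M = N + D"
  have M: "M > 0" using N by (simp add: M_def)
  define z where "z t = cis (2 * pi * real t / real M)" for t :: nat
  \<comment> \<open>The values of the Fejer kernel at the M-th roots of unity, divided by M; they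
    are non-negative as squared moduli.\<close>
  define r where "r t = (cmod (\<Sum>i\<in>{0..<int N}. z t powi i))\<^sup>2 / (real M * real N)" for t
  have zc: "cnj (z t) = inverse (z t)" for t by (simp add: z_def cis_cnj)
  have zn: "z t \<noteq> 0" for t by (simp add: z_def)
  have r: "complex_of_real (r t) * z t powi k =
      (\<Sum>i\<in>{0..<int N}. \<Sum>j\<in>{0..<int N}. z t powi (i - j + k)) / (of_nat M * of_nat N)" for t k
  proof -
    let ?s = "\<Sum>i\<in>{0..<int N}. z t powi i"
    have "complex_of_real ((cmod ?s)\<^sup>2) = ?s * cnj ?s" by (rule complex_norm_square)
    also have "\<dots> = (\<Sum>i\<in>{0..<int N}. \<Sum>j\<in>{0..<int N}. z t powi i * inverse (z t) powi j)"
      by (simp add: sum_product zc complex_cnj_power_int)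
    finally have "complex_of_real ((cmod ?s)\<^sup>2) * z t powi k =
        (\<Sum>i\<in>{0..<int N}. \<Sum>j\<in>{0..<int N}. z t powi (i - j + k))"
      using zn[of t] by (simp add: sum_distrib_right power_int_add power_int_diff power_int_inverse divide_inverse)
    then show ?thesis by (simp add: r_def)
  qed
  have sum: "(\<Sum>t<M. complex_of_real (r t) * z t powi k) = complex_of_real (fejer N k)" if k: "\<bar>k\<bar> \<le> int D" for k
  proof -
    have "(\<Sum>t<M. complex_of_real (r t) * z t powi k) =
        (\<Sum>t<M. \<Sum>i\<in>{0..<int N}. \<Sum>j\<in>{0..<int N}. z t powi (i - j + k)) / (of_nat M * of_nat N)"
      unfolding r by (simp add: sum_divide_distrib)
    also have "(\<Sum>t<M. \<Sum>i\<in>{0..<int N}. \<Sum>j\<in>{0..<int N}. z t powi (i - j + k)) =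
        (\<Sum>i\<in>{0..<int N}. \<Sum>j\<in>{0..<int N}. \<Sum>t<M. z t powi (i - j + k))"
      by (subst sum.swap) (intro sum.cong refl sum.swap)
    also have "\<dots> = (\<Sum>i\<in>{0..<int N}. \<Sum>j\<in>{0..<int N}. of_nat M * complex_of_real (if i - j + k = 0 then 1 else 0))"
    proof (intro sum.cong refl)
      fix i j assume ij: "i \<in> {0..<int N}" "j \<in> {0..<int N}"
      have "\<bar>i - j + k\<bar> < int M" using ij k unfolding M_def by auto
      then have "int M dvd (i - j + k) \<longleftrightarrow> i - j + k = 0" using zdvd_not_zless dvd_imp_le_int by force
      then show "(\<Sum>t<M. z t powi (i - j + k)) = of_nat M * complex_of_real (if i - j + k = 0 then 1 else 0)"
        unfolding z_def sum_roots_of_unity[OF M dvd_refl] by simp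
    qed
    also have "\<dots> = of_nat M * complex_of_real (real N * fejer N k)"
      unfolding fejer_count[OF N, of k, symmetric] by (simp only: of_real_sum sum_distrib_left)
    finally show ?thesis using M N by simp
  qed
  have "(\<lambda>k x. complex_of_real (fejer N k) * a k x) = (\<lambda>k x. (\<Sum>t<M. complex_of_real (r t) * z t powi k) * a k x)"
  proof (intro ext)
    fix k x
    show "complex_of_real (fejer N k) * a k x = (\<Sum>t<M. complex_of_real (r t) * z t powi k) * a k x"
      using sum[of k] D[of k] by (cases "\<bar>k\<bar> \<le> int D") auto
  qed
  moreover have "sum r {..<M} = 1"
  proof -
    have "complex_of_real (sum r {..<M}) = complex_of_real (fejer N 0)" using sum[of 0] by simp
    then have "sum r {..<M} = fejer N 0" by (simp only: of_real_eq_iff)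
    then show ?thesis by (simp add: fejer_def)
  qed
  moreover have "unrm (\<lambda>k x. (\<Sum>t<M. complex_of_real (r t) * (\<lambda>t x. z t) t x powi k) * a k x) \<le> sum r {..<M} * unrm a"
    using unorm_average_le[OF c00_l1[OF a], of "{..<M}" "\<lambda>t x. z t" r]
    by (simp add: unimodular_const z_def r_def)
  ultimately show ?thesis by simp
qed

lemma fejer_l1:
  assumes a: "(a :: 'a l1elt) \<in> l1"
  shows "(\<lambda>k x. complex_of_real (fejer N k) * a k x) \<in> l1"
proof (rule l1I[where M = "\<lambda>k. supn (a k)"])
  show "(\<lambda>x. complex_of_real (fejer N k) * a k x) \<in> CX" for k
    by (intro CX_intros l1D(1)[OF a])
  show "cmod (complex_of_real (fejer N k) * a k x) \<le> supn (a k)" for k x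
    using mult_mono[OF fejer_bounds(2)[of N k] l1_ge[OF a, of k x]] fejer_bounds(1)[of N k] by (simp add: norm_mult)
qed (rule l1D(2)[OF a])

lemma fejer_contractive:
  assumes "a \<in> l1" "N > 0"
  shows "unrm (\<lambda>k x. complex_of_real (fejer N k) * a k x) \<le> unrm a"
  by (rule contractive_multiplier[OF fejer_l1 _ fejer_contractive_c00[OF _ assms(2)] assms(1)])
    (use fejer_bounds in auto)

text \<open>An element of the completion is determined by its coefficients. All late terms are close
  to one finitely supported b, which is close to its Fejer mean; by contractivity that mean is close
  to the Fejer mean of \<open>s n\<close>, and the latter involves only finitely many coefficients,
  all tending to 0.\<close>

theorem coeffs_null_imp_norm_null:
  assumes s: "cauchy s" and z: "\<And>k. (\<lambda>n. supn (s n k)) \<longlonglongrightarrow> 0"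
  shows "(\<lambda>n. unrm (s n)) \<longlonglongrightarrow> 0"
proof (rule LIMSEQ_I)
  fix e :: real assume e: "e > 0"
  note sl = cs_cauchyD[OF s]
  obtain N0 where N0: "\<forall>m\<ge>N0. \<forall>n\<ge>N0. unrm (l1_sub (s m) (s n)) < e / 8"
    using s e unfolding cs_cauchy_def by (meson divide_pos_pos zero_less_numeral)
  obtain D where D: "l1_norm (l1_sub (s N0) (trunc D (s N0))) < e / 8"
    using trunc_approx[OF sl, of "e / 8"] e by auto
  \<comment> \<open>Two errors of e / 8, from the Cauchy condition and from truncation, place all
    late terms within e / 4 of b.\<close>
  define b where "b = trunc D (s N0)"
  have b: "b \<in> l1" unfolding b_def by (rule trunc_l1[OF sl])
  have sb: "unrm (l1_sub (s n) b) < e / 4" if "n \<ge> N0" for n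
  proof -
    have "unrm (l1_sub (s N0) b) < e / 8"
      using unorm_le_l1_norm[OF l1_sub[OF sl b]] D unfolding b_def by (meson le_less_trans)
    moreover have "unrm (l1_sub (s n) (s N0)) < e / 8" using N0 that by blast
    ultimately show ?thesis using unorm_sub_trans[OF sl[of n] sl[of N0] b] by simp
  qed
  \<comment> \<open>On [-D, D] the Fejer weight differs from 1 by at most D / N, so this N keeps the
    mean of b within e / 4 of b.\<close>
  obtain N :: nat where N: "real N > 4 * (real D * l1_norm b) / e" "N > 0"
    by (metis gr0I less_nat_zero_code linorder_not_less of_nat_0 of_nat_less_iff reals_Archimedean2 order_less_trans zero_less_one of_nat_1 max_less_iff_conj)
  let ?f = "\<lambda>a k x. complex_of_real (fejer N k) * a k x"
  have fb: "unrm (l1_sub b (?f b)) \<le> e / 4"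
  proof -
    have "l1_norm (l1_sub b (?f b)) \<le> (\<Sum>\<^sub>\<infinity>k. real D / real N * supn (b k))"
    proof (rule l1_norm_le[OF l1_sub[OF b fejer_l1[OF b]]])
      show "(\<lambda>k. real D / real N * supn (b k)) summable_on UNIV"
        by (intro summable_on_cmult_right l1D(2)[OF b])
      fix k x
      show "cmod (l1_sub b (?f b) k x) \<le> real D / real N * supn (b k)"
      proof (cases "\<bar>k\<bar> \<le> int D")
        case False
        then show ?thesis using b by (simp add: l1_sub_def b_def trunc_def)
      next
        case True
        have "l1_sub b (?f b) k x = complex_of_real (1 - fejer N k) * b k x"
          by (simp add: l1_sub_def algebra_simps)
        moreover have "1 - fejer N k \<le> real D / real N"
        proof -
          have "1 - fejer N k \<le> \<bar>real_of_int k\<bar> / real N" by (simp add: fejer_def)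
          also have "\<dots> \<le> real D / real N" using True N by (intro divide_right_mono) linarith+
          finally show ?thesis .
        qed
        moreover have "0 \<le> 1 - fejer N k" using fejer_bounds by simp
        ultimately show ?thesis using l1_ge[OF b, of k x]
          by (simp only: norm_mult norm_of_real abs_of_nonneg) (intro mult_mono, auto)
      qed
    qed
    also have "\<dots> = real D / real N * l1_norm b"
      unfolding l1_norm_def by (rule infsum_cmult_right') 
    also have "\<dots> \<le> e / 4" using N e by (simp add: field_simps)
    finally show ?thesis using unorm_le_l1_norm[OF l1_sub[OF b fejer_l1[OF b]]] by (meson order_trans)
  qed
  let ?F = "{- int N..int N}"
  have "(\<lambda>n. \<Sum>k\<in>?F. supn (s n k)) \<longlonglongrightarrow> (\<Sum>k\<in>?F. 0)" by (intro tendsto_sum z)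
  then obtain N1 where N1: "\<And>n. n \<ge> N1 \<Longrightarrow> (\<Sum>k\<in>?F. supn (s n k)) < e / 4"
    using LIMSEQ_D[of "\<lambda>n. \<Sum>k\<in>?F. supn (s n k)" 0 "e / 4"] e by fastforce
  have "unrm (s n) < e" if n: "n \<ge> max N0 N1" for n
  proof -
    have d: "l1_sub b (s n) \<in> l1" by (rule l1_sub[OF b sl])
    have "?f (s n) \<in> l1" by (rule fejer_l1[OF sl])
    then have "unrm (?f (s n)) \<le> (\<Sum>k\<in>?F. supn (?f (s n) k))"
    proof (rule unorm_finite_support_le)
      fix k assume k: "k \<notin> ?F"
      then have "\<bar>real_of_int k\<bar> \<ge> real N" by auto
      then have "fejer N k = 0" using N(2) by (simp add: fejer_def field_simps)
      then show "?f (s n) k = (\<lambda>x. 0)" by simp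
    qed simp
    also have "\<dots> \<le> (\<Sum>k\<in>?F. supn (s n k))"
    proof (intro sum_mono supn_le)
      show "cmod (?f (s n) k x) \<le> supn (s n k)" for k x
        using mult_mono[OF fejer_bounds(2)[of N k] l1_ge[OF sl, of n k x]] fejer_bounds(1)[of N k] by (simp add: norm_mult)
    qed
    also have "\<dots> < e / 4" using N1 n by simp
    finally have 1: "unrm (?f (s n)) < e / 4" .
    have 2: "unrm (?f (l1_sub b (s n))) < e / 4"
      using fejer_contractive[OF d N(2)] sb[of n] n unorm_sub_commute[OF b sl, of n] by simp
    have eq: "l1_sub (?f b) (?f (s n)) = ?f (l1_sub b (s n))"
      by (simp add: l1_sub_def algebra_simps)
    have "unrm (s n) \<le> unrm b + unrm (l1_sub (s n) b)" by (rule unorm_le_sub[OF sl b])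
    moreover have "unrm b \<le> unrm (?f b) + unrm (l1_sub b (?f b))"
      by (rule unorm_le_sub[OF b fejer_l1[OF b]])
    moreover have "unrm (?f b) \<le> unrm (?f (s n)) + unrm (?f (l1_sub b (s n)))"
      using unorm_le_sub[OF fejer_l1[OF b] fejer_l1[OF sl], of N N n] unfolding eq .
    ultimately show ?thesis using 1 2 fb sb[of n] n by simp
  qed
  then show "\<exists>no. \<forall>n\<ge>no. norm (unrm (s n) - 0) < e"
    using unorm_nonneg[OF sl] by (intro exI[of _ "max N0 N1"]) auto
qed

end

section \<open>Fourier coefficients\<close>

context dynamical_system
begin

lemma Urysohn_point:
  assumes "closed C" "x \<notin> C"
  shows "\<exists>f\<in>CX. f x = 1 \<and> (\<forall>y\<in>C. f (y::'a) = 0)"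
proof -
  have "Hausdorff_space (euclidean :: 'a topology)"
    unfolding Hausdorff_space_def disjnt_def by (simp, metis hausdorff)
  then have n: "normal_space (euclidean :: 'a topology)"
    using compact_space by (intro compact_Hausdorff_or_regular_imp_normal_space) (auto simp: compact_space_def)
  have c: "closedin (euclidean :: 'a topology) C" "closedin (euclidean :: 'a topology) {x}" "disjnt C {x}"
    using assms by (auto simp: disjnt_def)
  obtain f :: "'a \<Rightarrow> real" where f: "continuous_map euclidean (top_of_set {0..1}) f" "f ` C \<subseteq> {0}" "f ` {x} \<subseteq> {1}"
    by (rule Urysohn_lemma[OF n c, of 0 1]) simp_all
  have "continuous_on UNIV f" using f(1) by (simp add: continuous_map_in_subtopology)
  then have "(\<lambda>y. complex_of_real (f y)) \<in> CX" by (auto simp: CX_def intro!: continuous_intros)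
  then show ?thesis using f by (intro bexI[of _ "\<lambda>y. complex_of_real (f y)"]) auto
qed

section \<open>The interiors of the periodic sets\<close>

abbreviation FF :: "int \<Rightarrow> 'a set" where "FF k \<equiv> interior (Fix \<sigma> k)"

lemma FF_fix: "x \<in> FF k \<Longrightarrow> spow \<sigma> k x = x"
  using interior_subset by (auto simp: Fix_def)

lemma FF_0: "x \<in> FF 0"
  by (simp add: Fix_def)

lemma FF_neg: "x \<in> FF k \<Longrightarrow> x \<in> FF (- k)"
proof -
  have "FF k \<subseteq> FF (- k)"
  proof (rule interior_maximal, rule subsetI)
    fix y assume "y \<in> FF k"
    then show "y \<in> Fix \<sigma> (- k)" using spow_cancel(1)[of k y] FF_fix[of y k] by (simp add: Fix_def[of \<sigma> "- k"])
  qed simp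
  then show "x \<in> FF k \<Longrightarrow> x \<in> FF (- k)" by blast
qed

lemma FF_fix_neg: "x \<in> FF k \<Longrightarrow> spow \<sigma> (- k) x = x"
  by (rule FF_fix[OF FF_neg])

lemma FF_add: "x \<in> FF j \<Longrightarrow> x \<in> FF k \<Longrightarrow> x \<in> FF (j + k)"
proof -
  have "FF j \<inter> FF k \<subseteq> FF (j + k)"
  proof (rule interior_maximal)
    show "FF j \<inter> FF k \<subseteq> Fix \<sigma> (j + k)"
      using FF_fix by (auto simp: Fix_def[of \<sigma> "j + k"] spow_add)
  qed (rule open_Int[OF open_interior open_interior])
  then show "x \<in> FF j \<Longrightarrow> x \<in> FF k \<Longrightarrow> x \<in> FF (j + k)" by blast
qed

text \<open>Powers of \<sigma> commute, so the preimage of F_k under \<sigma>^(-j) is an open set of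
  points fixed by \<sigma>^k.\<close>

lemma FF_spow: "x \<in> FF k \<Longrightarrow> spow \<sigma> j x \<in> FF k"
proof -
  assume x: "x \<in> FF k"
  let ?U = "spow \<sigma> (- j) -` FF k"
  have "open ?U" using continuous_spow[of "- j"] by (simp add: continuous_on_open_vimage)
  moreover have "?U \<subseteq> Fix \<sigma> k"
  proof
    fix y assume "y \<in> ?U"
    then have "spow \<sigma> k (spow \<sigma> (- j) y) = spow \<sigma> (- j) y" by (simp add: FF_fix)
    then have "spow \<sigma> (- j) (spow \<sigma> k y) = spow \<sigma> (- j) y"
      by (simp add: spow_add[symmetric] add.commute)
    then have "spow \<sigma> k y = y" by (metis spow_cancel(2))
    then show "y \<in> Fix \<sigma> k" by (simp add: Fix_def)
  qed
  ultimately have "?U \<subseteq> FF k" by (rule interior_maximal[rotated])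
  moreover have "spow \<sigma> j x \<in> ?U" using x by simp
  ultimately show ?thesis by blast
qed

lemma FF_spow_iff: "spow \<sigma> j x \<in> FF k \<longleftrightarrow> x \<in> FF k"
  using FF_spow[of x k j] FF_spow[of "spow \<sigma> j x" k "- j"] by auto

lemma FF_mult: "x \<in> FF k \<Longrightarrow> x \<in> FF (k * q)"
proof (induction q rule: int_induct[where k = 0])
  case (step1 i)
  then show ?case using FF_add[of x "k * i" k] by (simp add: algebra_simps)
next
  case (step2 i)
  then show ?case using FF_add[of x "k * i" "- k"] FF_neg by (simp add: algebra_simps)
qed (simp add: FF_0)

text \<open>Where g is non-zero it can be cancelled, so no continuous function separates y from
  \<sigma>^(-k) y and the two coincide. The non-vanishing set of g is open, which is why it lies in
  the interior.\<close>

lemma commuting_support: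
  assumes g: "g \<in> CX" and comm: "\<And>f x. f \<in> CX \<Longrightarrow> g x * f (spow \<sigma> (- k) x) = f x * g x" and x: "g x \<noteq> 0"
  shows "x \<in> FF k"
proof -
  have "{x. g x \<noteq> 0} \<subseteq> FF k"
  proof (rule interior_maximal)
    show "open {x. g x \<noteq> 0}"
      using g unfolding CX_def by (auto intro!: open_Collect_neq continuous_intros)
    show "{x. g x \<noteq> 0} \<subseteq> Fix \<sigma> k"
    proof
      fix y assume "y \<in> {x. g x \<noteq> 0}"
      then have eq: "f (spow \<sigma> (- k) y) = f y" if "f \<in> CX" for f using comm[OF that, of y] by simp
      have "spow \<sigma> (- k) y = y"
      proof (rule ccontr)
        assume "spow \<sigma> (- k) y \<noteq> y"
        then obtain f where "f \<in> CX" "f y = 1" "f (spow \<sigma> (- k) y) = 0"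
          using Urysohn_point[of "{spow \<sigma> (- k) y}" y] by auto
        then show False using eq[of f] by simp
      qed
      then show "y \<in> Fix \<sigma> k" using spow_cancel(2)[of k y] by (simp add: Fix_def)
    qed
  qed
  then show ?thesis using x by blast
qed

definition fourier :: "'a cselt \<Rightarrow> int \<Rightarrow> 'a \<Rightarrow> complex" where
  "fourier A k x = lim (\<lambda>n. rep A n k x)"

lemma coeff_diff_le:
  assumes "a \<in> l1" "b \<in> l1"
  shows "cmod (a k x - b k x) \<le> unrm (l1_sub a b)"
  using coeff_le_unorm[OF l1_sub[OF assms], of k x] by (simp add: l1_sub_def)

text \<open>Each coefficient is contractive from the universal norm to the sup norm: coefficients of
  Cauchy sequences converge uniformly, and equivalent sequences share their limits, so the choice
  inside \<open>fourier\<close> is harmless.\<close>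

lemma fourier_cls:
  assumes s: "cauchy s"
  shows "uniform_limit UNIV (\<lambda>n. s n k) (fourier (cls s) k) sequentially"
proof -
  let ?r = "rep (cls s)"
  note r = rep_cs_cls[OF s]
  have "uniformly_Cauchy_on UNIV (\<lambda>n. s n k)"
  proof (rule uniformly_Cauchy_onI)
    fix e :: real assume "e > 0"
    then obtain N where N: "\<forall>m\<ge>N. \<forall>n\<ge>N. unrm (l1_sub (s m) (s n)) < e"
      using s unfolding cs_cauchy_def by blast
    have "dist (s m k x) (s n k x) < e" if "m \<ge> N" "n \<ge> N" for m n x
      using le_less_trans[OF coeff_diff_le[OF cs_cauchyD[OF s, of m] cs_cauchyD[OF s, of n], of k x]] N that
      by (simp add: dist_norm)
    then show "\<exists>M. \<forall>x\<in>UNIV. \<forall>m\<ge>M. \<forall>n\<ge>M. dist (s m k x) (s n k x) < e" by blast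
  qed
  then obtain g where g: "uniform_limit UNIV (\<lambda>n. s n k) g sequentially"
    using Cauchy_uniformly_convergent uniformly_convergent_on_def by blast
  have "g x = fourier (cls s) k x" for x
  proof -
    have "(\<lambda>n. s n k x) \<longlonglongrightarrow> g x" using tendsto_uniform_limitI[OF g] by simp
    moreover have "(\<lambda>n. ?r n k x - s n k x) \<longlonglongrightarrow> 0"
    proof (rule Lim_null_comparison[OF _ r(2)[unfolded null_diff_def]], intro always_eventually allI)
      show "norm (?r n k x - s n k x) \<le> unrm (l1_sub (s n) (?r n))" for n
        using coeff_diff_le[OF cs_cauchyD[OF s] cs_cauchyD[OF r(1)], of n k x n] by (simp add: norm_minus_commute)
    qed
    ultimately have "(\<lambda>n. s n k x + (?r n k x - s n k x)) \<longlonglongrightarrow> g x + 0" by (rule tendsto_add)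
    then show ?thesis unfolding fourier_def by (simp add: limI)
  qed
  then have "g = fourier (cls s) k" by (rule ext)
  then show ?thesis using g by simp
qed

lemma fourier_tendsto: "cauchy s \<Longrightarrow> (\<lambda>n. s n k x) \<longlonglongrightarrow> fourier (cls s) k x"
  using tendsto_uniform_limitI[OF fourier_cls] by simp

lemma fourier_CX:
  assumes "A \<in> Cs"
  shows "fourier A k \<in> CX"
proof -
  obtain s where s: "cauchy s" "A = cls s" using assms by (meson CstarE)
  have "continuous_on UNIV (s n k)" for n using l1D(1)[OF cs_cauchyD[OF s(1)]] by (simp add: CX_def)
  then show ?thesis
    unfolding s(2) CX_def using uniform_limit_theorem[OF _ fourier_cls[OF s(1)], of k] by simp
qed

lemma fourier_emb: "a \<in> l1 \<Longrightarrow> fourier (emb \<sigma> a) k x = a k x"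
  using fourier_tendsto[OF cs_cauchy_const, of a k x] by (simp add: emb_def LIMSEQ_const_iff)

lemma fourier_cx_mult:
  assumes "A \<in> Cs" "f \<in> CX"
  shows "fourier (csmul (emb \<sigma> (cx f)) A) k x = f x * fourier A k x"
    "fourier (csmul A (emb \<sigma> (cx f))) k x = fourier A k x * f (spow \<sigma> (- k) x)"
proof -
  obtain s where s: "cauchy s" "A = cls s" using assms by (meson CstarE)
  note c = cs_cauchy_const[OF cx_in_l1[OF assms(2)]]
  show "fourier (csmul (emb \<sigma> (cx f)) A) k x = f x * fourier A k x"
    unfolding s(2) emb_def cs_mult_cls[OF c s(1)]
    using fourier_tendsto[OF cs_cauchy_mult[OF c s(1)], of k x]
      tendsto_mult_left[OF fourier_tendsto[OF s(1)], of "f x" k x]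
    unfolding cx_mult by (rule LIMSEQ_unique)
  show "fourier (csmul A (emb \<sigma> (cx f))) k x = fourier A k x * f (spow \<sigma> (- k) x)"
    unfolding s(2) emb_def cs_mult_cls[OF s(1) c]
    using fourier_tendsto[OF cs_cauchy_mult[OF s(1) c], of k x]
      tendsto_mult_right[OF fourier_tendsto[OF s(1)], of k x "f (spow \<sigma> (- k) x)"]
    unfolding mult_cx by (rule LIMSEQ_unique)
qed

lemma comm_starD: "D \<in> comm_star \<sigma> \<Longrightarrow> f \<in> CX \<Longrightarrow> csmul D (emb \<sigma> (cx f)) = csmul (emb \<sigma> (cx f)) D"
  by (simp add: comm_star_def)

lemma fourier_support:
  assumes A: "A \<in> comm_star \<sigma>" and x: "fourier A k x \<noteq> 0"
  shows "x \<in> FF k"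
proof (rule commuting_support)
  have A': "A \<in> Cs" using A by (simp add: comm_star_def)
  show "fourier A k \<in> CX" by (rule fourier_CX[OF A'])
  show "fourier A k y * f (spow \<sigma> (- k) y) = f y * fourier A k y" if f: "f \<in> CX" for f y
    using fourier_cx_mult[OF A' f, of k y] comm_starD[OF A f] by metis
qed (rule x)

section \<open>Monomials and the necessity of closedness\<close>

definition monomial :: "int \<Rightarrow> ('a \<Rightarrow> complex) \<Rightarrow> 'a l1elt" where
  "monomial k f = (\<lambda>j. if j = k then f else (\<lambda>x. 0))"

lemma monomial_c00: "f \<in> CX \<Longrightarrow> monomial k f \<in> c00"
proof -
  assume f: "f \<in> CX"
  have "(\<lambda>j. if j = k then supn f else 0) summable_on UNIV"
    by (rule finite_nonzero_values_imp_summable_on) (auto intro: finite_subset[of _ "{k}"])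
  then have "monomial k f \<in> l1" using f
    by (intro l1I[where M = "\<lambda>j. if j = k then supn f else 0"]) (auto simp: monomial_def CX_intros supn_ge)
  moreover have "finite {j. monomial k f j \<noteq> (\<lambda>x. 0)}"
    by (rule finite_subset[of _ "{k}"]) (auto simp: monomial_def)
  ultimately show ?thesis by (simp add: c00_def)
qed

lemma cx_mult_monomial: "mul1 (cx f) (monomial k (\<lambda>x. 1)) = monomial k f"
  by (intro ext) (simp add: cx_mult monomial_def)

text \<open>A function vanishing off F_k is invariant under \<sigma>^k, so it passes through
  \<delta>^k. This reduces right modules to left modules.\<close>

lemma monomial_mult_cx:
  assumes "\<And>y. y \<notin> FF k \<Longrightarrow> f y = 0"
  shows "mul1 (monomial k g) (cx f) = mul1 (cx f) (monomial k g)"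
proof (intro ext)
  fix n x
  have "f (spow \<sigma> (- k) x) = f x"
  proof (cases "x \<in> FF k")
    case False
    then show ?thesis using assms FF_spow_iff[of "- k" x k] by simp
  qed (simp add: FF_fix_neg)
  then show "mul1 (monomial k g) (cx f) n x = mul1 (cx f) (monomial k g) n x"
    by (simp add: mult_cx cx_mult monomial_def)
qed

lemma monomial_comm_00:
  assumes f: "f \<in> CX" "\<And>y. y \<notin> FF k \<Longrightarrow> f y = 0"
  shows "monomial k f \<in> comm_00 \<sigma>"
  unfolding comm_00_def
proof (intro CollectI conjI ballI)
  fix h :: "'a \<Rightarrow> complex"
  show "mul1 (monomial k f) (cx h) = mul1 (cx h) (monomial k f)"
  proof (intro ext)
    fix n x
    show "mul1 (monomial k f) (cx h) n x = mul1 (cx h) (monomial k f) n x"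
      using f(2)[of x] FF_fix_neg[of x k] by (cases "x \<in> FF k") (simp_all add: mult_cx cx_mult monomial_def)
  qed
qed (rule monomial_c00[OF f(1)])

text \<open>Shared by the left and the right case, with D playing the role of E'(\<delta>^k). The
  module law is demanded only for functions vanishing off F_k, since for these f \<delta>^k lies in
  the commutant, where E' is known. A Urysohn function at each point of F_k then pins the
  coefficient of D to 1 there.\<close>

lemma closed_FF_criterion:
  assumes D: "D \<in> comm_star \<sigma>"
    and mod: "\<And>f. f \<in> CX \<Longrightarrow> (\<And>y. y \<notin> FF k \<Longrightarrow> f y = 0) \<Longrightarrow>
      emb \<sigma> (monomial k f) = csmul (emb \<sigma> (cx f)) D"
  shows "closed (FF k)"
proof -
  have D': "D \<in> Cs" using D by (simp add: comm_star_def)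
  have "fourier D k x = 1" if x: "x \<in> FF k" for x
  proof -
    obtain f where f: "f \<in> CX" "f x = 1" "\<And>y. y \<notin> FF k \<Longrightarrow> f y = 0"
      using Urysohn_point[of "- FF k" x] x by auto
    have "f x = fourier (emb \<sigma> (monomial k f)) k x"
      using fourier_emb[OF c00_l1[OF monomial_c00[OF f(1)]]] by (simp add: monomial_def)
    also have "\<dots> = f x * fourier D k x"
      using mod[OF f(1,3)] fourier_cx_mult(1)[OF D' f(1)] by simp
    finally show ?thesis using f(2) by simp
  qed
  moreover have "x \<in> FF k" if "fourier D k x = 1" for x
    using fourier_support[OF D, of k x] that by simp
  ultimately have "FF k = {x. fourier D k x = 1}" by blast
  moreover have "closed {x. fourier D k x = 1}"
    using fourier_CX[OF D', of k] unfolding CX_def by (auto intro!: closed_Collect_eq continuous_intros)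
  ultimately show ?thesis by simp
qed

lemma cond1_imp_cond3: "cond1 \<sigma> \<Longrightarrow> cond3 \<sigma>"
  unfolding cond3_def
proof
  fix k
  assume "cond1 \<sigma>"
  then obtain E where E: "\<And>a. a \<in> c00 \<Longrightarrow> E a \<in> comm_star \<sigma>" "\<And>a. a \<in> comm_00 \<sigma> \<Longrightarrow> E a = emb \<sigma> a"
      "\<And>f a. f \<in> CX \<Longrightarrow> a \<in> c00 \<Longrightarrow> E (mul1 (cx f) a) = csmul (emb \<sigma> (cx f)) (E a)"
    unfolding cond1_def by blast
  let ?d = "monomial k (\<lambda>x. 1)"
  have d: "?d \<in> c00" by (intro monomial_c00 CX_intros)
  show "closed (FF k)"
  proof (rule closed_FF_criterion[OF E(1)[OF d]])
    fix f :: "'a \<Rightarrow> complex" assume f: "f \<in> CX" "\<And>y. y \<notin> FF k \<Longrightarrow> f y = 0"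
    show "emb \<sigma> (monomial k f) = csmul (emb \<sigma> (cx f)) (E ?d)"
      using E(2)[OF monomial_comm_00[OF f]] E(3)[OF f(1) d] by (simp add: cx_mult_monomial)
  qed
qed

lemma cond2_imp_cond3: "cond2 \<sigma> \<Longrightarrow> cond3 \<sigma>"
  unfolding cond3_def
proof
  fix k
  assume "cond2 \<sigma>"
  then obtain E where E: "\<And>a. a \<in> c00 \<Longrightarrow> E a \<in> comm_star \<sigma>" "\<And>a. a \<in> comm_00 \<sigma> \<Longrightarrow> E a = emb \<sigma> a"
      "\<And>f a. f \<in> CX \<Longrightarrow> a \<in> c00 \<Longrightarrow> E (mul1 a (cx f)) = csmul (E a) (emb \<sigma> (cx f))"
    unfolding cond2_def by blast
  let ?d = "monomial k (\<lambda>x. 1)"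
  have d: "?d \<in> c00" by (intro monomial_c00 CX_intros)
  show "closed (FF k)"
  proof (rule closed_FF_criterion[OF E(1)[OF d]])
    fix f :: "'a \<Rightarrow> complex" assume f: "f \<in> CX" "\<And>y. y \<notin> FF k \<Longrightarrow> f y = 0"
    have "emb \<sigma> (monomial k f) = E (mul1 ?d (cx f))"
      using E(2)[OF monomial_comm_00[OF f]] monomial_mult_cx[OF f(2)] by (simp add: cx_mult_monomial)
    \<comment> \<open>The right module law puts f on the right of E'(\<delta>^k), which commutes
      with it.\<close>
    also have "\<dots> = csmul (emb \<sigma> (cx f)) (E ?d)"
      using E(3)[OF f(1) d] comm_starD[OF E(1)[OF d] f(1)] by simp
    finally show "emb \<sigma> (monomial k f) = csmul (emb \<sigma> (cx f)) (E ?d)" .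
  qed
qed

lemma emb_cx_comm_star: "f \<in> CX \<Longrightarrow> emb \<sigma> (cx f) \<in> comm_star \<sigma>"
proof -
  assume f: "f \<in> CX"
  have "mul1 (cx f) (cx g) = mul1 (cx g) (cx f)" for g :: "'a \<Rightarrow> complex"
    by (intro ext) (simp add: cx_mult, simp add: cx_def)
  then show ?thesis unfolding comm_star_def using f
    by (auto simp: emb_mult[symmetric] cx_in_l1 emb_closed)
qed

lemma comm_00_comm_star: "a \<in> comm_00 \<sigma> \<Longrightarrow> emb \<sigma> a \<in> comm_star \<sigma>"
  unfolding comm_00_def comm_star_def
  by (auto simp: emb_mult[symmetric] cx_in_l1 emb_closed c00_l1)

text \<open>C(X) is commutative and so lies in its own commutant; hence the bimodule law contains
  both module laws, and E' is obtained by restriction to the finite sums.\<close>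

lemma cond4_imp:
  assumes "cond4 \<sigma>"
  shows "cond1 \<sigma>" "cond2 \<sigma>"
proof -
  obtain E where E: "cs_projection_onto \<sigma> E (comm_star \<sigma>)"
    and b: "\<forall>A\<in>comm_star \<sigma>. \<forall>B\<in>Cs.
      E (csmul A B) = csmul A (E B) \<and> E (csmul B A) = csmul (E B) A"
    using assms unfolding cond4_def by (elim exE conjE) (rule that)
  have bim: "E (csmul A B) = csmul A (E B)" "E (csmul B A) = csmul (E B) A"
    if "A \<in> comm_star \<sigma>" "B \<in> Cs" for A B
    using b[rule_format, OF that] by simp_all
  note E' = E[unfolded cs_projection_onto_def]
  note l = E'[THEN conjunct1] and i = E'[THEN conjunct2, THEN conjunct1] and ran = E'[THEN conjunct2, THEN conjunct2]
  have lin: "E (csadd A B) = csadd (E A) (E B)" if "A \<in> Cs" "B \<in> Cs" for A B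
    using l[rule_format, OF that] by simp
  have lin': "E (cssmul c A) = cssmul c (E A)" if "A \<in> Cs" for A c
    using l[rule_format, OF that that] by simp
  let ?E = "\<lambda>a. E (emb \<sigma> a)"
  have 1: "\<forall>a\<in>c00. ?E a \<in> comm_star \<sigma>" using ran emb_closed c00_l1 by blast
  have 2: "lin_c00 \<sigma> ?E" unfolding lin_c00_def
    by (simp add: emb_add emb_smult lin lin' emb_closed c00_l1)
  have "E A = A" if A: "A \<in> comm_star \<sigma>" for A
  proof -
    obtain B where "B \<in> Cs" "A = E B" using A unfolding ran[symmetric] by blast
    then show ?thesis using i by simp
  qed
  then have 3: "\<forall>a\<in>comm_00 \<sigma>. ?E a = emb \<sigma> a" using comm_00_comm_star by blast
  have "\<forall>f\<in>CX. \<forall>a\<in>c00. ?E (mul1 (cx f) a) = csmul (emb \<sigma> (cx f)) (?E a)"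
    using bim(1)[OF emb_cx_comm_star emb_closed] by (simp add: emb_mult cx_in_l1 c00_l1)
  then show "cond1 \<sigma>" unfolding cond1_def using 1 2 3 by (intro exI[of _ ?E] conjI)
  have "\<forall>f\<in>CX. \<forall>a\<in>c00. ?E (mul1 a (cx f)) = csmul (?E a) (emb \<sigma> (cx f))"
    using bim(2)[OF emb_cx_comm_star emb_closed] by (simp add: emb_mult cx_in_l1 c00_l1)
  then show "cond2 \<sigma>" unfolding cond2_def using 1 2 3 by (intro exI[of _ ?E] conjI)
qed

end

section \<open>The conditional expectation\<close>

lemma locally_constant_continuous:
  assumes "\<And>x. \<exists>U. open U \<and> x \<in> U \<and> (\<forall>y\<in>U. f y = f x)"
  shows "continuous_on UNIV f"
  unfolding continuous_on_open_vimage[OF open_UNIV]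
proof (intro allI impI)
  fix B
  have "\<exists>T. open T \<and> x \<in> T \<and> T \<subseteq> f -` B" if "x \<in> f -` B" for x
    using assms[of x] that by (metis subsetI vimageE vimageI2)
  then show "open (f -` B \<inter> UNIV)" by (subst Int_UNIV_right, subst open_subopen) blast
qed

locale closed_periodic_interiors = dynamical_system +
  assumes closed_FF: "closed (interior (Fix \<sigma> k))"
begin

text \<open>The candidate for E' on l1, in multiplier form so that
  \<open>contractive_multiplier\<close> applies.\<close>

definition proj :: "'a l1elt \<Rightarrow> 'a l1elt" where
  "proj a = (\<lambda>k x. (if x \<in> FF k then 1 else 0) * a k x)"

lemma proj_l1:
  assumes a: "a \<in> l1"
  shows "proj a \<in> l1"
proof (rule l1I[where M = "\<lambda>k. supn (a k)"])
  fix k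
  \<comment> \<open>Both F_k and its complement are closed, so the coefficient can be pasted with
    0.\<close>
  have "continuous_on (FF k \<union> - FF k) (\<lambda>x. if x \<in> FF k then a k x else 0)"
    using l1D(1)[OF a, of k] closed_FF[of k] unfolding CX_def
    by (intro continuous_on_cases) (auto intro: continuous_on_subset)
  then have c: "continuous_on UNIV (\<lambda>x. if x \<in> FF k then a k x else 0)" by simp
  have eq: "proj a k = (\<lambda>x. if x \<in> FF k then a k x else 0)" by (auto simp: proj_def)
  show "proj a k \<in> CX" unfolding CX_def eq using c by simp
  show "cmod (proj a k x) \<le> supn (a k)" for x
    using l1_ge[OF a, of k x] a by (simp add: proj_def)
qed (rule l1D(2)[OF a])

text \<open>On elements supported in \<open>[-D, D]\<close> the group \<open>{k. x \<in> FF k}\<close> only enters through its smallest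
  positive element, with \<open>D + 1\<close> standing in for the trivial group.\<close>

definition period :: "nat \<Rightarrow> 'a \<Rightarrow> nat" where
  "period D x = (LEAST j. 1 \<le> j \<and> (j = D + 1 \<or> x \<in> FF (int j)))"

lemma period_props:
  "1 \<le> period D x" "period D x \<le> D + 1" "period D x = D + 1 \<or> x \<in> FF (int (period D x))"
  "1 \<le> j \<Longrightarrow> x \<in> FF (int j) \<Longrightarrow> period D x \<le> j"
proof -
  let ?P = "\<lambda>j. 1 \<le> j \<and> (j = D + 1 \<or> x \<in> FF (int j))"
  have "?P (D + 1)" by simp
  then have "?P (period D x)" "period D x \<le> D + 1" unfolding period_def by (rule LeastI, rule Least_le)
  then show "1 \<le> period D x" "period D x \<le> D + 1" "period D x = D + 1 \<or> x \<in> FF (int (period D x))" by auto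
  show "1 \<le> j \<Longrightarrow> x \<in> FF (int j) \<Longrightarrow> period D x \<le> j"
    unfolding period_def by (rule Least_le) simp
qed

lemma period_le_abs:
  assumes "x \<in> FF k" "k \<noteq> 0"
  shows "int (period D x) \<le> \<bar>k\<bar>"
proof -
  have "x \<in> FF (int (nat \<bar>k\<bar>))" using assms(1) FF_neg[of x k] by (auto simp: abs_if)
  moreover have "1 \<le> nat \<bar>k\<bar>" using assms(2) by linarith
  ultimately have "period D x \<le> nat \<bar>k\<bar>" by (rule period_props(4)[rotated])
  then show ?thesis by linarith
qed

text \<open>Division with remainder in the group of all k with x in F_k: a remainder below the least
  positive element must be 0. If no positive j \<le> D belongs to the group, the period is D + 1,
  whose only multiple in range is 0.\<close>

lemma period_dvd_iff:
  assumes k: "\<bar>k\<bar> \<le> int D"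
  shows "int (period D x) dvd k \<longleftrightarrow> x \<in> FF k"
proof (cases "k = 0")
  case True
  then show ?thesis using FF_0 by simp
next
  case False
  let ?d = "int (period D x)"
  show ?thesis
  proof
    assume dvd: "?d dvd k"
    then have "?d \<le> \<bar>k\<bar>" using False dvd_imp_le_int by (metis abs_of_nat)
    then have "x \<in> FF ?d" using k period_props(3)[of D x] by auto
    then show "x \<in> FF k" using dvd FF_mult by (metis dvdE)
  next
    assume x: "x \<in> FF k"
    have le: "?d \<le> int D" using period_le_abs[OF x False, of D] k by simp
    then have xd: "x \<in> FF ?d" using period_props(3)[of D x] by auto
    have "x \<in> FF (k + ?d * (- (k div ?d)))" by (rule FF_add[OF x FF_mult[OF xd]])
    then have xr: "x \<in> FF (k mod ?d)" by (simp add: minus_mult_div_eq_mod)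
    have "k mod ?d = 0"
    proof (rule ccontr)
      assume nz: "k mod ?d \<noteq> 0"
      have "0 \<le> k mod ?d" "k mod ?d < ?d" using period_props(1)[of D x] by simp_all
      then show False using period_le_abs[OF xr nz, of D] by simp
    qed
    then show "?d dvd k" by (simp add: dvd_eq_mod_eq_0)
  qed
qed

text \<open>Membership in F_1, ..., F_D determines the period, and each of these sets is clopen; the
  cutoff D keeps the intersection finite and hence open.\<close>

lemma period_locally_constant: "\<exists>U. open U \<and> x \<in> U \<and> (\<forall>y\<in>U. period D y = period D x)"
proof -
  let ?U = "\<Inter>j\<in>{1..D}. if x \<in> FF (int j) then FF (int j) else - FF (int j)"
  have "open ?U" using closed_FF by (intro open_INT) auto
  moreover have "x \<in> ?U" by auto
  moreover have "period D y = period D x" if y: "y \<in> ?U" for y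
  proof -
    have "y \<in> FF (int j) \<longleftrightarrow> x \<in> FF (int j)" if "1 \<le> j" "j \<le> D" for j
      using y that by (auto split: if_splits)
    then have "(1 \<le> j \<and> j \<le> D + 1 \<and> (j = D + 1 \<or> y \<in> FF (int j))) \<longleftrightarrow> (1 \<le> j \<and> j \<le> D + 1 \<and> (j = D + 1 \<or> x \<in> FF (int j)))" for j
      by (metis add.commute le_Suc_eq plus_1_eq_Suc)
    then have yx: "1 \<le> j \<and> j \<le> D + 1 \<and> (j = D + 1 \<or> y \<in> FF (int j)) \<Longrightarrow> j = D + 1 \<or> x \<in> FF (int j)"
      and xy: "1 \<le> j \<and> j \<le> D + 1 \<and> (j = D + 1 \<or> x \<in> FF (int j)) \<Longrightarrow> j = D + 1 \<or> y \<in> FF (int j)" for j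
      by blast+
    show ?thesis
    proof (rule order_antisym)
      show "period D y \<le> period D x"
        using xy[of "period D x"] period_props(1-3)[of D x] period_props(4)[of "period D x" y D] period_props(2)[of D y] by auto
      show "period D x \<le> period D y"
        using yx[of "period D y"] period_props(1-3)[of D y] period_props(4)[of "period D y" x D] period_props(2)[of D x] by auto
    qed
  qed
  ultimately show ?thesis by blast
qed

lemma period_invariant: "period D (\<sigma> x) = period D x"
  using FF_spow_iff[of 1 x] spow_Suc[of 0 x] by (simp add: period_def)

lemma proj_contractive_c00:
  assumes a: "a \<in> c00"
  shows "unrm (\<lambda>k x. (if x \<in> FF k then 1 else 0) * a k x) \<le> unrm a"
proof -
  obtain D :: nat where D: "\<And>k. \<bar>k\<bar> > int D \<Longrightarrow> a k = (\<lambda>x. 0)" using c00E[OF a] by blast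
  \<comment> \<open>The factorial is divisible by every possible period 1, ..., D + 1, so one number
    of summands works at all points.\<close>
  define M :: nat where "M = fact (D + 1)"
  have M: "M > 0" by (simp add: M_def)
  \<comment> \<open>The order of the root varies with x, but only through the period, which is
    locally constant and invariant under \<sigma>; so \<open>W t\<close> is an admissible
    twist.\<close>
  define W where "W t x = cis (2 * pi * real t / real (period D x))" for t :: nat and x
  have W: "unimodular (W t)" for t
  proof -
    have "continuous_on UNIV (W t)"
    proof (rule locally_constant_continuous)
      show "\<exists>U. open U \<and> x \<in> U \<and> (\<forall>y\<in>U. W t y = W t x)" for x
        using period_locally_constant[of x D] unfolding W_def by metis
    qed
    then show ?thesis by (simp add: unimodular_def CX_def W_def period_invariant)
  qed
  have sum: "(\<Sum>t<M. complex_of_real (1 / real M) * W t x powi k) = (if x \<in> FF k then 1 else 0)"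
    if k: "\<bar>k\<bar> \<le> int D" for k x
  proof -
    have "period D x dvd M" unfolding M_def using period_props(1,2)[of D x] by (intro dvd_fact) auto
    then have "(\<Sum>t<M. W t x powi k) = (if x \<in> FF k then of_nat M else 0)"
      unfolding W_def using sum_roots_of_unity[of "period D x" M k] period_props(1)[of D x] period_dvd_iff[OF k, of x]
      by simp
    then show ?thesis using M by (simp add: sum_divide_distrib[symmetric])
  qed
  have eq: "(\<lambda>k x. (if x \<in> FF k then 1 else 0) * a k x) =
      (\<lambda>k x. (\<Sum>t<M. complex_of_real (1 / real M) * W t x powi k) * a k x)"
  proof (intro ext)
    fix k x
    show "(if x \<in> FF k then 1 else 0) * a k x = (\<Sum>t<M. complex_of_real (1 / real M) * W t x powi k) * a k x"
      using sum[of k x] D[of k] by (cases "\<bar>k\<bar> \<le> int D") simp_all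
  qed
  show ?thesis unfolding eq
    using unorm_average_le[OF c00_l1[OF a], of "{..<M}" W "\<lambda>t. 1 / real M"] W M by simp
qed

lemma proj_contractive:
  assumes a: "a \<in> l1"
  shows "unrm (proj a) \<le> unrm a"
  unfolding proj_def
  by (rule contractive_multiplier[OF proj_l1[unfolded proj_def] _ proj_contractive_c00 a]) auto

lemma proj_linear:
  "proj (l1_add a b) = l1_add (proj a) (proj b)" "proj (l1_smult c a) = l1_smult c (proj a)"
  "proj (l1_sub a b) = l1_sub (proj a) (proj b)"
  by (intro ext, simp add: proj_def l1_add_def l1_smult_def l1_sub_def)+

lemma proj_proj: "proj (proj a) = proj a"
  by (intro ext) (simp add: proj_def)

lemma FF_neg_iff: "x \<in> FF (- k) \<longleftrightarrow> x \<in> FF k"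
  using FF_neg[of x k] FF_neg[of x "- k"] by auto

lemma proj_star: "proj (star1 a) = star1 (proj a)"
  by (intro ext) (simp add: proj_def l1_star_alt FF_spow_iff FF_neg_iff)

lemma FF_diff_iff: "x \<in> FF k \<Longrightarrow> x \<in> FF (n - k) \<longleftrightarrow> x \<in> FF n"
  using FF_add[of x "n - k" k] FF_add[of x n "- k"] FF_neg[of x k] by auto

lemma FF_diff_iff': "x \<in> FF (n - k) \<Longrightarrow> x \<in> FF k \<longleftrightarrow> x \<in> FF n"
  using FF_diff_iff[of x "n - k" n] by simp

text \<open>In each surviving summand x lies in F_k, and then the subgroup property makes x in F_n
  equivalent to x in F_(n - k); the outer indicator thus moves to the second factor.\<close>

lemma proj_mult_left: "proj (mul1 (proj a) b) = mul1 (proj a) (proj b)"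
proof (intro ext)
  fix n x
  have "proj (mul1 (proj a) b) n x =
      (\<Sum>\<^sub>\<infinity>k. (if x \<in> FF n then 1 else 0) * (proj a k x * b (n - k) (spow \<sigma> (- k) x)))"
    by (simp only: proj_def[of "mul1 (proj a) b"] l1_mult_alt infsum_cmult_right')
  also have "\<dots> = (\<Sum>\<^sub>\<infinity>k. proj a k x * proj b (n - k) (spow \<sigma> (- k) x))"
    by (rule infsum_cong) (auto simp: proj_def FF_spow_iff FF_diff_iff)
  finally show "proj (mul1 (proj a) b) n x = mul1 (proj a) (proj b) n x"
    by (simp only: l1_mult_alt)
qed

lemma proj_mult_right: "proj (mul1 b (proj a)) = mul1 (proj b) (proj a)"
proof (intro ext)
  fix n x
  have "proj (mul1 b (proj a)) n x =
      (\<Sum>\<^sub>\<infinity>k. (if x \<in> FF n then 1 else 0) * (b k x * proj a (n - k) (spow \<sigma> (- k) x)))"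
    by (simp only: proj_def[of "mul1 b (proj a)"] l1_mult_alt infsum_cmult_right')
  also have "\<dots> = (\<Sum>\<^sub>\<infinity>k. proj b k x * proj a (n - k) (spow \<sigma> (- k) x))"
    by (rule infsum_cong) (auto simp: proj_def FF_spow_iff FF_diff_iff')
  finally show "proj (mul1 b (proj a)) n x = mul1 (proj b) (proj a) n x"
    by (simp only: l1_mult_alt)
qed

lemma proj_commutes: "mul1 (proj a) (cx f) = mul1 (cx f) (proj a)"
  by (intro ext) (auto simp: mult_cx cx_mult proj_def FF_fix_neg)

lemma proj_c00: "a \<in> c00 \<Longrightarrow> proj a \<in> c00"
proof -
  assume a: "a \<in> c00"
  have "{k. proj a k \<noteq> (\<lambda>x. 0)} \<subseteq> {k. a k \<noteq> (\<lambda>x. 0)}" by (auto simp: proj_def)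
  then show ?thesis using a proj_l1 finite_subset unfolding c00_def by blast
qed

lemma proj_comm_00: "a \<in> c00 \<Longrightarrow> proj a \<in> comm_00 \<sigma>"
  unfolding comm_00_def using proj_c00 proj_commutes by blast

lemma proj_id: "a \<in> comm_00 \<sigma> \<Longrightarrow> proj a = a"
proof (intro ext)
  fix k x
  assume a: "a \<in> comm_00 \<sigma>"
  have l: "a \<in> l1" using a by (simp add: comm_00_def c00_l1)
  have "a k x \<noteq> 0 \<Longrightarrow> x \<in> FF k"
  proof (rule commuting_support[OF l1D(1)[OF l]])
    fix f :: "'a \<Rightarrow> complex" and y assume "f \<in> CX"
    then have "mul1 a (cx f) k y = mul1 (cx f) a k y" using a by (simp add: comm_00_def)
    then show "a k y * f (spow \<sigma> (- k) y) = f y * a k y" by (simp add: mult_cx cx_mult)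
  qed
  then show "proj a k x = a k x" by (auto simp: proj_def)
qed

lemma proj_cx: "proj (cx f) = cx f"
  using FF_0 by (intro ext) (auto simp: proj_def cx_def)

section \<open>The expectation on C*(Sigma)\<close>

definition EE :: "'a cselt \<Rightarrow> 'a cselt" where
  "EE A = cls (\<lambda>n. proj (rep A n))"

lemma proj_Lipschitz:
  "a \<in> l1 \<Longrightarrow> b \<in> l1 \<Longrightarrow> unrm (l1_sub (proj a) (proj b)) \<le> 1 * unrm (l1_sub a b)"
  using proj_contractive[OF l1_sub] by (simp add: proj_linear(3))

lemma cs_cauchy_proj: "cauchy s \<Longrightarrow> cauchy (\<lambda>n. proj (s n))"
  by (rule cs_cauchy_map[where F = proj, OF _ proj_l1 proj_Lipschitz])

lemma EE_cls: "cauchy s \<Longrightarrow> EE (cls s) = cls (\<lambda>n. proj (s n))"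
  unfolding EE_def by (rule cs_cls_map[where F = proj, OF _ proj_l1 proj_Lipschitz])

lemma EE_closed: "A \<in> Cs \<Longrightarrow> EE A \<in> Cs"
  by (elim CstarE) (simp add: EE_cls cs_cls_in_Cstar cs_cauchy_proj)

lemma EE_emb: "a \<in> l1 \<Longrightarrow> EE (emb \<sigma> a) = emb \<sigma> (proj a)"
  unfolding emb_def by (simp add: EE_cls cs_cauchy_const)

lemma EE_linear:
  "A \<in> Cs \<Longrightarrow> B \<in> Cs \<Longrightarrow> EE (csadd A B) = csadd (EE A) (EE B)"
  "A \<in> Cs \<Longrightarrow> EE (cssmul c A) = cssmul c (EE A)"
  "A \<in> Cs \<Longrightarrow> EE (csstar A) = csstar (EE A)"
  by (elim CstarE, simp add: EE_cls cs_add_cls cs_smult_cls cs_star_cls cs_cauchy_add cs_cauchy_smult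
      cs_cauchy_star cs_cauchy_proj proj_linear proj_star)+

lemma EE_EE: "A \<in> Cs \<Longrightarrow> EE (EE A) = EE A"
  by (elim CstarE) (simp add: EE_cls cs_cauchy_proj proj_proj)

lemma EE_norm:
  assumes "A \<in> Cs"
  shows "csnorm (EE A) \<le> csnorm A"
proof -
  obtain s where s: "cauchy s" "A = cls s" using assms by (meson CstarE)
  show ?thesis unfolding s(2) EE_cls[OF s(1)]
    by (rule LIMSEQ_le[OF cs_norm_cls[OF cs_cauchy_proj[OF s(1)]] cs_norm_cls[OF s(1)]])
      (intro exI allI impI proj_contractive cs_cauchyD[OF s(1)])
qed

lemma EE_comm_star:
  assumes "A \<in> Cs"
  shows "EE A \<in> comm_star \<sigma>"
proof -
  obtain s where s: "cauchy s" "A = cls s" using assms by (meson CstarE)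
  have "csmul (EE A) (emb \<sigma> (cx f)) = csmul (emb \<sigma> (cx f)) (EE A)" if "f \<in> CX" for f
    unfolding s(2) EE_cls[OF s(1)] emb_def using cs_cauchy_const[OF cx_in_l1[OF that]] cs_cauchy_proj[OF s(1)]
    by (simp add: cs_mult_cls proj_commutes)
  then show ?thesis using EE_closed[OF assms] by (simp add: comm_star_def)
qed

lemma supn_null:
  assumes "uniform_limit UNIV f (\<lambda>x::'a. 0) sequentially" "\<And>n. f n \<in> CX"
  shows "(\<lambda>n. supn (f n)) \<longlonglongrightarrow> 0"
proof (rule LIMSEQ_I)
  fix e :: real assume e: "e > 0"
  have "\<forall>\<^sub>F n in sequentially. \<forall>x\<in>UNIV. dist (f n x) 0 < e / 2"
    by (rule uniform_limitD[OF assms(1)]) (use e in simp)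
  then obtain N where N: "\<And>n x. n \<ge> N \<Longrightarrow> cmod (f n x) < e / 2"
    unfolding eventually_sequentially by auto
  have "supn (f n) \<le> e / 2" if "n \<ge> N" for n
    by (rule supn_le) (use N[OF that] less_imp_le in blast)
  then show "\<exists>no. \<forall>n\<ge>no. norm (supn (f n) - 0) < e"
    using e supn_nonneg[OF assms(2)] by (intro exI[of _ N]) fastforce
qed

text \<open>For a sequence s representing A, \<open>proj (s n)\<close> and \<open>s n\<close> differ
  only off F_k, where the k-th coefficients tend uniformly to that of A, which is 0 there. By
  \<open>coeffs_null_imp_norm_null\<close> the difference is null in norm.\<close>

lemma EE_id:
  assumes A: "A \<in> comm_star \<sigma>"
  shows "EE A = A"
proof -
  have A': "A \<in> Cs" using A by (simp add: comm_star_def)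
  obtain s where s: "cauchy s" "A = cls s" using A' by (meson CstarE)
  note ps = cs_cauchy_proj[OF s(1)]
  note d = cs_diff_cls(2)[OF ps s(1)]
  have "(\<lambda>n. unrm (l1_sub (proj (s n)) (s n))) \<longlonglongrightarrow> 0"
  proof (rule coeffs_null_imp_norm_null[OF d])
    fix k
    show "(\<lambda>n. supn (l1_sub (proj (s n)) (s n) k)) \<longlonglongrightarrow> 0"
    proof (rule supn_null)
      show "uniform_limit UNIV (\<lambda>n. l1_sub (proj (s n)) (s n) k) (\<lambda>x. 0) sequentially"
      proof (rule uniform_limitI)
        fix e :: real assume "e > 0"
        then have "\<forall>\<^sub>F n in sequentially. \<forall>x\<in>UNIV. dist (s n k x) (fourier A k x) < e"
          using uniform_limitD[OF fourier_cls[OF s(1), of k]] s(2) by simp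
        then show "\<forall>\<^sub>F n in sequentially. \<forall>x\<in>UNIV. dist (l1_sub (proj (s n)) (s n) k x) 0 < e"
        proof eventually_elim
          case (elim n)
          show ?case
          proof
            fix x
            show "dist (l1_sub (proj (s n)) (s n) k x) 0 < e"
            proof (cases "x \<in> FF k")
              case True
              then show ?thesis using \<open>e > 0\<close> by (simp add: l1_sub_def proj_def)
            next
              case False
              then have "fourier A k x = 0" using fourier_support[OF A] by blast
              then show ?thesis using elim[rule_format, of x] False by (simp add: l1_sub_def proj_def)
            qed
          qed
        qed
      qed
      show "l1_sub (proj (s n)) (s n) k \<in> CX" for n by (rule l1D(1)[OF cs_cauchyD[OF d]])
    qed
  qed
  then have "null_diff (\<lambda>n. proj (s n)) s" by (simp add: null_diff_def)
  then show ?thesis unfolding s(2) EE_cls[OF s(1)] using cs_cls_eq_iff[OF ps s(1)] by simp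
qed

text \<open>Since A is fixed by \<open>EE\<close>, it is represented by a sequence in the range of
  \<open>proj\<close>, where the module laws hold term by term.\<close>

lemma EE_bimodule:
  assumes A: "A \<in> comm_star \<sigma>" and B: "B \<in> Cs"
  shows "EE (csmul A B) = csmul A (EE B)" "EE (csmul B A) = csmul (EE B) A"
proof -
  obtain s where s: "cauchy s" "A = cls s" using A unfolding comm_star_def by (auto elim: CstarE)
  obtain t where t: "cauchy t" "B = cls t" using B by (meson CstarE)
  note ps = cs_cauchy_proj[OF s(1)] and pt = cs_cauchy_proj[OF t(1)]
  have A': "A = cls (\<lambda>n. proj (s n))" using EE_id[OF A] s EE_cls by simp
  have "EE (csmul A B) = cls (\<lambda>n. proj (mul1 (proj (s n)) (t n)))"
    unfolding A' t(2) by (simp add: cs_mult_cls[OF ps t(1)] EE_cls[OF cs_cauchy_mult[OF ps t(1)]])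
  also have "\<dots> = csmul A (EE B)"
    unfolding A' t(2) by (simp add: cs_mult_cls[OF ps pt] EE_cls[OF t(1)] proj_mult_left)
  finally show "EE (csmul A B) = csmul A (EE B)" .
  have "EE (csmul B A) = cls (\<lambda>n. proj (mul1 (t n) (proj (s n))))"
    unfolding A' t(2) by (simp add: cs_mult_cls[OF t(1) ps] EE_cls[OF cs_cauchy_mult[OF t(1) ps]])
  also have "\<dots> = csmul (EE B) A"
    unfolding A' t(2) by (simp add: cs_mult_cls[OF pt ps] EE_cls[OF t(1)] proj_mult_right)
  finally show "EE (csmul B A) = csmul (EE B) A" .
qed

lemma EE_one: "EE cs_one = cs_one"
  unfolding cs_one_def EE_emb[OF cx_one_in_l1] proj_cx ..

text \<open>A unital contraction is positive: \<open>\<parallel>t - E a\<parallel> = \<parallel>E (t - a)\<parallel> \<le> \<parallel>t - a\<parallel> \<le> t\<close>.\<close>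

lemma EE_pos:
  assumes "cs_pos \<sigma> A"
  shows "cs_pos \<sigma> (EE A)"
proof -
  obtain B where B: "B \<in> Cs" "A = csmul (csstar B) B" using assms by (auto simp: cs_pos_def)
  have A: "A \<in> Cs" unfolding B(2) by (intro cs_mult_closed cs_star_closed B)
  \<comment> \<open>The norm condition behind \<open>cs.pos\<close> can be transported by
    \<open>EE\<close>, unlike the factorisation behind \<open>cs_pos\<close>.\<close>
  have "cs.pos A" using cs.pos_star_mult[of B] B by simp
  then obtain t where t: "t > 0"
      "csnorm (csadd (cssmul (complex_of_real t) cs_one) (cssmul (- 1) A)) \<le> t"
    and sA: "csstar A = A"
    using A by (auto simp: cs.pos_def cs.diff_eq_smul cs_one_closed cs_smult_closed)
  let ?D = "csadd (cssmul (complex_of_real t) cs_one) (cssmul (- 1) A)"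
  have D: "?D \<in> Cs" by (intro cs_add_closed cs_smult_closed cs_one_closed A)
  have "EE ?D = csadd (cssmul (complex_of_real t) cs_one) (cssmul (- 1) (EE A))"
    using A by (simp add: EE_linear EE_one cs_one_closed cs_smult_closed)
  then have "csnorm (csadd (cssmul (complex_of_real t) cs_one) (cssmul (- 1) (EE A))) \<le> t"
    using EE_norm[OF D] t(2) by simp
  moreover have "csstar (EE A) = EE A" using EE_linear(3)[OF A] sA by simp
  ultimately have "cs.pos (EE A)"
    using t(1) EE_closed[OF A] by (auto simp: cs.pos_def cs.diff_eq_smul cs_one_closed cs_smult_closed)
  \<comment> \<open>Back to a factorisation: the root of \<open>EE A\<close> is self-adjoint, so its
    square has the form C* C.\<close>
  then show ?thesis
  proof (rule cs.pos_sqrt_exists)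
    fix C assume "cs.pos C" "monoid.mult cs_ring C C = EE A"
    then show ?thesis unfolding cs_pos_def by (intro bexI[of _ C]) (simp_all add: cs.pos_def)
  qed
qed

text \<open>At x the coefficient of b* b at 0 is a sum of squared moduli taken along the orbit of x.
  The point \<sigma>^(-k) y is chosen so that the summand j = -k is the squared modulus of
  b_k(y).\<close>

lemma star_mult_coeff_ge:
  assumes b: "b \<in> l1"
  shows "(cmod (b k y))\<^sup>2 \<le> cmod (mul1 (star1 b) b 0 (spow \<sigma> (- k) y))"
proof -
  let ?x = "spow \<sigma> (- k) y" and ?S = "mul1 (star1 b) b 0 (spow \<sigma> (- k) y)"
  let ?t = "\<lambda>j. star1 b j ?x * b (0 - j) (spow \<sigma> (- j) ?x)"
  have "(?t has_sum ?S) UNIV"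
    unfolding l1_mult_alt
    by (rule has_sum_infsum, rule abs_summable_summable, rule l1_mult_summable[OF l1_star[OF b] b])
  then have "((\<lambda>j. Re (?t j)) has_sum Re ?S) UNIV" by (rule has_sum_Re)
  moreover have t: "Re (?t j) = (cmod (b (- j) (spow \<sigma> (- j) ?x)))\<^sup>2" for j
    by (simp only: l1_star_alt cnj_mult_self diff_0 Re_complex_of_real)
  ultimately have "((\<lambda>j. (cmod (b (- j) (spow \<sigma> (- j) ?x)))\<^sup>2) has_sum Re ?S) UNIV" by simp
  then have "(\<Sum>j\<in>{- k}. (cmod (b (- j) (spow \<sigma> (- j) ?x)))\<^sup>2) \<le> Re ?S"
    by (rule finite_sum_le_has_sum) auto
  then show ?thesis using complex_Re_le_cmod[of ?S] by simp
qed

text \<open>As F_0 is the whole space, \<open>proj\<close> leaves the coefficient at 0 untouched.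
  For A = B* B that coefficient dominates the squares of all coefficients of B, so these vanish, and
  B = 0 because coefficients determine elements.\<close>

lemma EE_faithful:
  assumes "cs_pos \<sigma> A" "EE A = cs_zero \<sigma>"
  shows "A = cs_zero \<sigma>"
proof -
  obtain B where B: "B \<in> Cs" "A = csmul (csstar B) B" using assms(1) by (auto simp: cs_pos_def)
  obtain s where s: "cauchy s" "B = cls s" using B(1) by (meson CstarE)
  let ?q = "\<lambda>n. mul1 (star1 (s n)) (s n)"
  have q: "cauchy ?q" by (rule cs_cauchy_mult[OF cs_cauchy_star[OF s(1)] s(1)])
  have "A = cls ?q"
    unfolding B(2) s(2) cs_star_cls[OF s(1)] by (rule cs_mult_cls[OF cs_cauchy_star[OF s(1)] s(1)])
  then have "cls (\<lambda>n. proj (?q n)) = cls (\<lambda>n k x. 0)"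
    using assms(2) EE_cls[OF q] by (simp add: cs_zero_eq)
  then have lim: "(\<lambda>n. unrm (proj (?q n))) \<longlonglongrightarrow> 0"
    using cs_cls_eq_iff[OF cs_cauchy_proj[OF q] cs_cauchy_zero] by (simp add: null_diff_def l1_sub_def)
  have "(\<lambda>n. unrm (s n)) \<longlonglongrightarrow> 0"
  proof (rule coeffs_null_imp_norm_null[OF s(1)])
    fix k
    have le: "supn (s n k) \<le> sqrt (unrm (proj (?q n)))" for n
    proof (rule supn_le)
      fix y
      have "(cmod (s n k y))\<^sup>2 \<le> cmod (?q n 0 (spow \<sigma> (- k) y))"
        by (rule star_mult_coeff_ge[OF cs_cauchyD[OF s(1)]])
      also have "\<dots> = cmod (proj (?q n) 0 (spow \<sigma> (- k) y))" using FF_0 by (simp add: proj_def)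
      also have "\<dots> \<le> unrm (proj (?q n))" by (rule coeff_le_unorm[OF proj_l1[OF cs_cauchyD[OF q]]])
      finally show "cmod (s n k y) \<le> sqrt (unrm (proj (?q n)))" by (rule real_le_rsqrt)
    qed
    have sq: "(\<lambda>n. sqrt (unrm (proj (?q n)))) \<longlonglongrightarrow> 0" using tendsto_real_sqrt[OF lim] by simp
    show "(\<lambda>n. supn (s n k)) \<longlonglongrightarrow> 0"
    proof (rule Lim_null_comparison[OF always_eventually sq], rule allI)
      show "norm (supn (s n k)) \<le> sqrt (unrm (proj (?q n)))" for n
        using le[of n] cs_cauchyD[OF s(1), of n] by simp
    qed
  qed
  then have "csnorm B = 0" unfolding s(2) using cs_norm_cls[OF s(1)] LIMSEQ_unique by blast
  then have "csnorm A = 0" using cs_norm_star_mult[OF B(1)] B(2) by simp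
  moreover have "A \<in> Cs" unfolding B(2) by (intro cs_mult_closed cs_star_closed B)
  ultimately show ?thesis by (rule cs_norm_zeroD[rotated])
qed

text \<open>The coefficient at 0 is the constant 1 on a non-empty space, which excludes the value 0.
  Hence the unit witnesses that the projection has norm exactly one.\<close>

lemma cs_norm_one: "csnorm cs_one = 1"
proof (rule order_antisym)
  show "csnorm cs_one \<le> 1" using cs.nrm_one_le by simp
  show "1 \<le> csnorm cs_one"
    unfolding cs_one_def cs_norm_emb[OF cx_one_in_l1]
    using coeff_le_unorm[OF cx_one_in_l1, of 0] by (simp add: cx_def)
qed

theorem cond4_holds: "cond4 \<sigma>"
  unfolding cond4_def
proof (intro exI[of _ EE] conjI ballI impI)
  have ran: "EE ` Cs = comm_star \<sigma>"
  proof
    show "EE ` Cs \<subseteq> comm_star \<sigma>" using EE_comm_star by blast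
    show "comm_star \<sigma> \<subseteq> EE ` Cs"
    proof
      fix A assume A: "A \<in> comm_star \<sigma>"
      then have "A = EE A" "A \<in> Cs" using EE_id by (simp_all add: comm_star_def)
      then show "A \<in> EE ` Cs" by (rule image_eqI)
    qed
  qed
  then show "cs_projection_onto \<sigma> EE (comm_star \<sigma>)"
    unfolding cs_projection_onto_def using EE_linear EE_EE by simp
  have le: "csnorm (EE A) \<le> 1" if "A \<in> {A \<in> Cs. csnorm A \<le> 1}" for A
    using EE_norm[of A] that by simp
  then show bdd: "bdd_above ((\<lambda>A. csnorm (EE A)) ` {A \<in> Cs. csnorm A \<le> 1})"
    by (rule bdd_aboveI2)
  have one: "cs_one \<in> {A \<in> Cs. csnorm A \<le> 1}" using cs_one_closed cs_norm_one by simp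
  show "(SUP A\<in>{A \<in> Cs. csnorm A \<le> 1}. csnorm (EE A)) = 1"
  proof (rule order_antisym)
    show "(SUP A\<in>{A \<in> Cs. csnorm A \<le> 1}. csnorm (EE A)) \<le> 1"
      by (rule cSUP_least) (use one le in auto)
    show "1 \<le> (SUP A\<in>{A \<in> Cs. csnorm A \<le> 1}. csnorm (EE A))"
      using cSUP_upper[OF one bdd] by (simp add: EE_one cs_norm_one)
  qed
  show "EE ` (emb \<sigma> ` c00) = emb \<sigma> ` comm_00 \<sigma>"
  proof
    show "EE ` (emb \<sigma> ` c00) \<subseteq> emb \<sigma> ` comm_00 \<sigma>"
      using EE_emb[OF c00_l1] proj_comm_00 by auto
    show "emb \<sigma> ` comm_00 \<sigma> \<subseteq> EE ` (emb \<sigma> ` c00)"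
    proof
      fix A assume "A \<in> emb \<sigma> ` comm_00 \<sigma>"
      then obtain a where a: "a \<in> comm_00 \<sigma>" "A = emb \<sigma> a" by blast
      then have c: "a \<in> c00" by (simp add: comm_00_def)
      have "A = EE (emb \<sigma> a)" using EE_emb[OF c00_l1[OF c]] proj_id[OF a(1)] a(2) by simp
      then show "A \<in> EE ` (emb \<sigma> ` c00)" using c by blast
    qed
  qed
  show "cs_pos \<sigma> (EE A)" if "cs_pos \<sigma> A" for A using that by (rule EE_pos)
  show "A = cs_zero \<sigma>" if "cs_pos \<sigma> A \<and> EE A = cs_zero \<sigma>" for A
    using that by (elim conjE) (rule EE_faithful)
  fix A B assume "A \<in> comm_star \<sigma>" "B \<in> Cs"
  then show "EE (csmul A B) = csmul A (EE B)" "EE (csmul B A) = csmul (EE B) A"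
    by (rule EE_bimodule)+
qed

end

theorem theorem5p2:
  fixes \<sigma> :: "'a::t2_space \<Rightarrow> 'a"
  assumes "compact (UNIV :: 'a set)"
    and "\<exists>\<tau>. homeomorphism UNIV UNIV \<sigma> \<tau>"
  shows "(cond1 \<sigma> \<longleftrightarrow> cond2 \<sigma>) \<and> (cond2 \<sigma> \<longleftrightarrow> cond3 \<sigma>) \<and> (cond3 \<sigma> \<longleftrightarrow> cond4 \<sigma>)"
proof -
  interpret dynamical_system \<sigma> by standard (fact assms)+
  \<comment> \<open>The remaining implications are at hand: (4) contains (1) and (2), and each of
    these gives (3).\<close>
  have "cond4 \<sigma>" if "cond3 \<sigma>"
  proof -
    interpret closed_periodic_interiors \<sigma> by standard (use that in \<open>simp add: cond3_def\<close>)
    show ?thesis by (rule cond4_holds)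
  qed
  then show ?thesis using cond1_imp_cond3 cond2_imp_cond3 cond4_imp by blast
qed

end
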